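(* Let $k\in\mathbb{Z}^+$ with $p\nmid k$, and let $P$ be a Sylow $p$-subgroup of $\mathfrak{S}_{kp}$. Then $$\dim_F\big((\mathrm{Res}^{\mathfrak{S}_{kp}}_P\mathrm{Lie}(kp))_{pf}\big)=(p-1)\,(k-1)!\,N,$$ where $N$ is the number of right cosets $Dx$ ($x\in\mathfrak{S}_{kp}$) such that $(\Delta_k\mathfrak{S}_p)^x\cap P\ne1$.
   Context: $p$ is a prime and $F$ is a field of characteristic $p$. $\mathfrak{S}_n$ is the symmetric group on $\{1,\dots,n\}$, acting on the right (products composed left to right). For a subgroup $A$, $A^x=x^{-1}Ax$. $\mathrm{Lie}(n)=\omega_nF\mathfrak{S}_n$ is the right ideal of $F\mathfrak{S}_n$ generated by $\omega_n=(1-c_2)(1-c_3)\cdots(1-c_n)$, $c_j=(1,2,\dots,j)$. For a finite-dimensional module $W$ over $FG$, $G$ a finite group, $W=W_{pr}\oplus W_{pf}$ (unique up to isomorphism) with $W_{pr}$ projective and $W_{pf}$ without nonzero projective summands. For $\tau\in\mathfrak{S}_p$, $\Delta_k\tau\in\mathfrak{S}_{kp}$ is given by $((i-1)p+j)\Delta_k\tau=(i-1)p+j\tau$; for $\sigma\in\mathfrak{S}_k$, $\sigma^{[p]}\in\mathfrak{S}_{kp}$ is given by $((i-1)p+j)\sigma^{[p]}=(i\sigma-1)p+j$ ($1\le i\le k$, $1\le j\le p$). $\Delta_k\mathfrak{S}_p$ and $\mathfrak{S}_k^{[p]}$ are the images of these (commuting) embeddings, and $D=\Delta_k\mathfrak{S}_p\times\mathfrak{S}_k^{[p]}\le\mathfrak{S}_{kp}$.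 *)

theory Defs
  imports
    "HOL-Algebra.Algebra"
    "HOL-Combinatorics.Cycles"
    "HOL-Library.Function_Algebras"
begin

section \<open>Right modules over a ring\<close>

text \<open>
  Right modules are encoded in the \<^type>\<open>Module.module\<close> record of HOL-Algebra by reading
  \<open>r \<odot>\<^bsub>M\<^esub> m\<close> as \<open>m \<cdot> r\<close>. The locale \<^locale>\<open>submodule\<close> does not depend on the side.
  The fields \<^const>\<open>monoid.mult\<close> and \<^const>\<open>monoid.one\<close> of a module record play no role.
\<close>

definition internal_direct_sum ::
    "('a, 'x) ring_scheme \<Rightarrow> ('a, 'b, 'y) module_scheme \<Rightarrow> 'b set \<Rightarrow> 'b set \<Rightarrow> bool" where
  "internal_direct_sum R M U V \<longleftrightarrow>
     submodule U R M \<and> submodule V R M \<and>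
     U \<inter> V = {\<zero>\<^bsub>M\<^esub>} \<and> U <+>\<^bsub>M\<^esub> V = carrier M"

definition module_iso ::
    "('a, 'x) ring_scheme \<Rightarrow> ('a, 'b, 'y) module_scheme \<Rightarrow> ('a, 'c, 'z) module_scheme
      \<Rightarrow> ('b \<Rightarrow> 'c) set" where
  "module_iso R M N =
     {f \<in> iso (add_monoid M) (add_monoid N).
        \<forall>r \<in> carrier R. \<forall>m \<in> carrier M. f (r \<odot>\<^bsub>M\<^esub> m) = r \<odot>\<^bsub>N\<^esub> f m}"

text \<open>The free right module \<open>R\<^sup>(\<^sup>I\<^sup>)\<close> of finitely supported families.\<close>

definition free_right_module :: "('a, 'x) ring_scheme \<Rightarrow> 'i set \<Rightarrow> ('a, 'i \<Rightarrow> 'a) module" where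
  "free_right_module R I =
     \<lparr>carrier = {v. (\<forall>i. v i \<in> carrier R) \<and> (\<forall>i. i \<notin> I \<longrightarrow> v i = \<zero>\<^bsub>R\<^esub>) \<and>
                    finite {i. v i \<noteq> \<zero>\<^bsub>R\<^esub>}},
      monoid.mult = (\<lambda>v w i. v i \<otimes>\<^bsub>R\<^esub> w i),
      monoid.one = (\<lambda>i. \<one>\<^bsub>R\<^esub>),
      ring.zero = (\<lambda>i. \<zero>\<^bsub>R\<^esub>),
      ring.add = (\<lambda>v w i. v i \<oplus>\<^bsub>R\<^esub> w i),
      smult = (\<lambda>r v i. v i \<otimes>\<^bsub>R\<^esub> r)\<rparr>"

text \<open>
  A module is projective iff it is isomorphic to a direct summand of a free module. Index sets
  \<open>I\<close> inside the element type of \<open>M\<close> suffice: a projective module is a summand of the free module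
  on any of its generating sets.
\<close>

definition projective_right_module ::
    "('a, 'x) ring_scheme \<Rightarrow> ('a, 'b, 'y) module_scheme \<Rightarrow> bool" where
  "projective_right_module R M \<longleftrightarrow>
     (\<exists>(I :: 'b set) U V.
        internal_direct_sum R (free_right_module R I) U V \<and>
        module_iso R M ((free_right_module R I)\<lparr>carrier := U\<rparr>) \<noteq> {})"

definition projective_free ::
    "('a, 'x) ring_scheme \<Rightarrow> ('a, 'b, 'y) module_scheme \<Rightarrow> bool" where
  "projective_free R M \<longleftrightarrow>
     (\<forall>U V. internal_direct_sum R M U V \<and> projective_right_module R (M\<lparr>carrier := U\<rparr>)
        \<longrightarrow> U = {\<zero>\<^bsub>M\<^esub>})"

text \<open>\<open>M = M\<^sub>p\<^sub>r \<oplus> M\<^sub>p\<^sub>f\<close> with \<open>M\<^sub>p\<^sub>r = U\<close> and \<open>M\<^sub>p\<^sub>f = V\<close>.\<close>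

definition pr_pf_decomposition ::
    "('a, 'x) ring_scheme \<Rightarrow> ('a, 'b, 'y) module_scheme \<Rightarrow> 'b set \<Rightarrow> 'b set \<Rightarrow> bool" where
  "pr_pf_decomposition R M U V \<longleftrightarrow>
     internal_direct_sum R M U V \<and>
     projective_right_module R (M\<lparr>carrier := U\<rparr>) \<and>
     projective_free R (M\<lparr>carrier := V\<rparr>)"


section \<open>Group algebras\<close>

text \<open>
  The group algebra over the field \<open>'f\<close> of a finite group \<open>G\<close>: functions vanishing outside \<open>G\<close>,
  multiplied by convolution. If \<open>H\<close> is a subgroup of \<open>G\<close>, the group algebra of
  \<open>G\<lparr>carrier := H\<rparr>\<close> is literally a subring of that of \<open>G\<close>.
\<close>

definition group_algebra :: "('g, 'x) monoid_scheme \<Rightarrow> ('g \<Rightarrow> 'f :: field) ring" where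
  "group_algebra G =
     \<lparr>carrier = {a. \<forall>g. g \<notin> carrier G \<longrightarrow> a g = 0},
      monoid.mult = (\<lambda>a b g. \<Sum>x\<in>carrier G. \<Sum>y\<in>carrier G. if x \<otimes>\<^bsub>G\<^esub> y = g then a x * b y else 0),
      monoid.one = (\<lambda>g. if g = \<one>\<^bsub>G\<^esub> then 1 else 0),
      ring.zero = (\<lambda>g. 0),
      ring.add = (\<lambda>a b g. a g + b g)\<rparr>"

definition group_elem :: "'g \<Rightarrow> 'g \<Rightarrow> 'f :: field" where
  "group_elem g = (\<lambda>x. if x = g then 1 else 0)"

definition fun_scale :: "'f :: field \<Rightarrow> ('g \<Rightarrow> 'f) \<Rightarrow> 'g \<Rightarrow> 'f" where
  "fun_scale c a = (\<lambda>x. c * a x)"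

lemma vector_space_fun_scale: "vector_space (fun_scale :: 'f :: field \<Rightarrow> ('g \<Rightarrow> 'f) \<Rightarrow> _)"
  by unfold_locales (auto simp: fun_scale_def fun_eq_iff algebra_simps)

abbreviation fun_dim :: "('g \<Rightarrow> 'f :: field) set \<Rightarrow> nat" where
  "fun_dim \<equiv> vector_space.dim (fun_scale :: 'f \<Rightarrow> ('g \<Rightarrow> 'f) \<Rightarrow> 'g \<Rightarrow> 'f)"


section \<open>Symmetric groups acting on the right\<close>

text \<open>The opposite of \<^const>\<open>sym_group\<close>: products are composed from left to right.\<close>

definition sym_group_r :: "nat \<Rightarrow> (nat \<Rightarrow> nat) monoid" where
  "sym_group_r n = \<lparr>carrier = {\<pi>. \<pi> permutes {1..n}}, monoid.mult = (\<lambda>\<sigma> \<tau>. \<tau> \<circ> \<sigma>), monoid.one = id\<rparr>"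

definition sylow_subgroup :: "nat \<Rightarrow> ('g, 'x) monoid_scheme \<Rightarrow> 'g set \<Rightarrow> bool" where
  "sylow_subgroup p G P \<longleftrightarrow> subgroup P G \<and> card P = p ^ multiplicity p (order G)"

definition conj_set :: "('g, 'x) monoid_scheme \<Rightarrow> 'g set \<Rightarrow> 'g \<Rightarrow> 'g set" where
  "conj_set G A x = (\<lambda>a. inv\<^bsub>G\<^esub> x \<otimes>\<^bsub>G\<^esub> a \<otimes>\<^bsub>G\<^esub> x) ` A"


section \<open>The Lie module\<close>

definition lie_omega :: "nat \<Rightarrow> (nat \<Rightarrow> nat) \<Rightarrow> 'f :: field" where
  "lie_omega n =
     (let A = group_algebra (sym_group_r n)
      in foldr (\<lambda>j a. (\<one>\<^bsub>A\<^esub> \<ominus>\<^bsub>A\<^esub> group_elem (cycle_of_list [1..<Suc j])) \<otimes>\<^bsub>A\<^esub> a)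
           [2..<Suc n] \<one>\<^bsub>A\<^esub>)"

text \<open>
  The right ideal generated by \<^const>\<open>lie_omega\<close>, acted upon by right multiplication.
  Its restriction to a subgroup \<open>P\<close> is the same record, with scalars from the group algebra
  of \<open>P\<close>.
\<close>

definition lie_module :: "nat \<Rightarrow> ((nat \<Rightarrow> nat) \<Rightarrow> 'f :: field, (nat \<Rightarrow> nat) \<Rightarrow> 'f) module" where
  "lie_module n =
     (let A = group_algebra (sym_group_r n)
      in \<lparr>carrier = {lie_omega n \<otimes>\<^bsub>A\<^esub> a | a. a \<in> carrier A},
          monoid.mult = monoid.mult A, monoid.one = \<one>\<^bsub>A\<^esub>, ring.zero = \<zero>\<^bsub>A\<^esub>, ring.add = ring.add A,
          smult = (\<lambda>a v. v \<otimes>\<^bsub>A\<^esub> a)\<rparr>)"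


section \<open>The subgroups of the symmetric group of degree \<open>k p\<close>\<close>

text \<open>For \<open>x = (i - 1) p + j\<close> with \<open>1 \<le> j \<le> p\<close>, these are \<open>i\<close> and \<open>j\<close>.\<close>

definition block_index :: "nat \<Rightarrow> nat \<Rightarrow> nat" where
  "block_index p x = (x - 1) div p + 1"

definition block_pos :: "nat \<Rightarrow> nat \<Rightarrow> nat" where
  "block_pos p x = (x - 1) mod p + 1"

definition diag_perm :: "nat \<Rightarrow> nat \<Rightarrow> (nat \<Rightarrow> nat) \<Rightarrow> nat \<Rightarrow> nat" where
  "diag_perm p k \<tau> = (\<lambda>x. if x \<in> {1..k * p}
     then (block_index p x - 1) * p + \<tau> (block_pos p x) else x)"

definition block_perm :: "nat \<Rightarrow> nat \<Rightarrow> (nat \<Rightarrow> nat) \<Rightarrow> nat \<Rightarrow> nat" where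
  "block_perm p k \<sigma> = (\<lambda>x. if x \<in> {1..k * p}
     then (\<sigma> (block_index p x) - 1) * p + block_pos p x else x)"

lemma
  assumes "i \<in> {1..k}" "j \<in> {1..p}"
  shows diag_perm_apply: "diag_perm p k \<tau> ((i - 1) * p + j) = (i - 1) * p + \<tau> j"
    and block_perm_apply: "block_perm p k \<sigma> ((i - 1) * p + j) = (\<sigma> i - 1) * p + j"
proof -
  obtain i' j' where ij: "i = Suc i'" "j = Suc j'" "i' < k" "j' < p"
    using assms by (cases i; cases j) auto
  have "Suc i' * p \<le> k * p"
    using ij by (intro mult_le_mono1) auto
  then have "(i - 1) * p + j \<in> {1..k * p}"
    using ij by auto
  moreover have "block_index p ((i - 1) * p + j) = i" "block_pos p ((i - 1) * p + j) = j"
    using ij by (auto simp: block_index_def block_pos_def)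
  ultimately show "diag_perm p k \<tau> ((i - 1) * p + j) = (i - 1) * p + \<tau> j"
    and "block_perm p k \<sigma> ((i - 1) * p + j) = (\<sigma> i - 1) * p + j"
    by (auto simp: diag_perm_def block_perm_def)
qed

definition diag_subgroup :: "nat \<Rightarrow> nat \<Rightarrow> (nat \<Rightarrow> nat) set" where
  "diag_subgroup p k = diag_perm p k ` carrier (sym_group_r p)"

definition block_subgroup :: "nat \<Rightarrow> nat \<Rightarrow> (nat \<Rightarrow> nat) set" where
  "block_subgroup p k = block_perm p k ` carrier (sym_group_r k)"

definition D_subgroup :: "nat \<Rightarrow> nat \<Rightarrow> (nat \<Rightarrow> nat) set" where
  "D_subgroup p k = diag_subgroup p k <#>\<^bsub>sym_group_r (k * p)\<^esub> block_subgroup p k"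

end

theory Submission
  imports Defs "HOL-Combinatorics.Multiset_Permutations"
begin

text \<open>
  For a finite \<open>p\<close>-group \<open>P\<close> and a field \<open>F\<close> of characteristic \<open>p\<close>, the projective part of a
  finite-dimensional \<open>FP\<close>-module \<open>M\<close> is measured by the norm element \<open>\<nu>\<close>, the sum of the elements of
  \<open>P\<close>. On the one hand, lifting a basis of \<open>M\<nu>\<close> to \<open>M\<close> produces a free summand on whose complement \<open>\<nu>\<close> vanishes
  (\<open>free_summand\<close>); on the other hand, every fixed vector of a projective module is a norm
  (\<open>fixed_in_projective_is_norm\<close>). Hence \<open>dim M\<^sub>p\<^sub>f = dim M - |P| dim M\<nu>\<close>
  (\<open>pr_pf_decomposition_dim\<close>), and the theorem becomes a statement on the rank of \<open>\<nu>\<close> on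
  \<open>Lie(n)\<close>, where \<open>n = kp\<close>.

  A permutation is read as the word of its values. Right multiplication then substitutes letters, and
  left multiplication by \<open>\<omega>\<^sub>n\<close> is the linear map \<open>lie_map\<close>, whose matrix consists of the
  coefficients of left-normed brackets (\<open>to_words_lie_omega\<close>). This map kills the sum of the shuffles
  of two nonempty words (\<open>lie_coeff_shuffle\<close>). Modulo its kernel every word can therefore be
  rewritten by words that start with a given letter, and the words with this first letter have
  independent images; so \<open>Lie(n)\<close> has dimension \<open>(n - 1)!\<close>.

  Since \<open>p\<close> does not divide \<open>k\<close>, the number of \<open>p\<close>-subsets of the alphabet is prime to \<open>p\<close>, so
  that \<open>P\<close> leaves some set \<open>Y\<close> of \<open>p\<close> letters invariant (\<open>ex_invariant_subset\<close>). An element of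
  \<open>P\<close> that stabilizes a proper nonempty subset of \<open>Y\<close> fixes \<open>Y\<close> pointwise. Hence there is a
  \<open>P\<close>-equivariant choice of a letter \<open>d(B) \<in> B\<close> for the proper nonempty subsets \<open>B\<close> of \<open>Y\<close>
  (\<open>ex_equivariant_choice\<close>). Let \<open>A\<close> be the space with basis the words that start in \<open>Y\<close>. These
  words are permuted freely by \<open>P\<close>, and \<open>A\<close> is mapped onto \<open>Lie(n)\<close>. A second basis of \<open>A\<close> is
  indexed by cuttings: sets of words which together use every letter once, each word \<open>u\<close> starting
  with the letter \<open>d(Y \<inter> u)\<close>; the basis vector is the sum of all interleavings of the words
  (\<open>shuffle_sum_basis\<close>). The cuttings into at least two words span the kernel of \<open>A \<rightarrow> Lie(n)\<close>
  (\<open>kernel_lie_map\<close>), and they are permuted by \<open>P\<close>.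

  The vectors of \<open>A\<close> that are fixed by \<open>P\<close> are its norms, so \<open>Lie(n)\<nu>\<close> is the image of the space of
  fixed vectors of \<open>A\<close>, and its dimension is the number of orbits on words that start in \<open>Y\<close> minus the
  number of orbits on cuttings into at least two words. Multiplied by \<open>|P|\<close>, these are the number of
  words and the sum of the orders of the stabilizers of the cuttings. The difference of the numbers of
  words and of cuttings is \<open>(n - 1)!\<close>. A stabilizer has order \<open>1\<close> or \<open>p\<close>, and it follows
  that \<open>|P| dim Lie(n)\<nu> = (n - 1)! - (p - 1) s\<close>, where \<open>s\<close> is the number of cuttings with a nontrivial
  stabilizer (\<open>rank_norm_lie_p\<close>). So \<open>Lie(n)\<^sub>p\<^sub>f\<close> has dimension \<open>(p - 1) s\<close>.

  A cutting with a nontrivial stabilizer consists of the \<open>p\<close> images of one word of length \<open>k\<close> under the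
  powers of some \<open>h \<in> P\<close>. Used as the columns of an array, these words form a permutation
  \<open>x\<close> for which \<open>h\<close> is the conjugate by \<open>x\<close> of the element \<open>\<Delta>\<^sub>k(1,2,\<dots>,p)\<close>. Once two of the
  values of \<open>x\<close> are prescribed, \<open>x\<close> is determined by the cutting
  (\<open>card_symmetric_cuts\<close>). Finally, every coset \<open>Dx\<close> with \<open>(\<Delta>\<^sub>k\<SS>\<^sub>p)\<^sup>x \<inter> P \<noteq> 1\<close> contains
  exactly \<open>(k - 1)!\<close> of these permutations: they differ by the permutations of the \<open>k\<close> blocks that fix
  the first block (\<open>card_intertwiners\<close>). Thus \<open>s = (k - 1)! N\<close>.
\<close>

section \<open>Finite groups acting on finite sets from the right\<close>

locale right_action = group G for G (structure) +
  fixes E :: "'e set" and act :: "'e \<Rightarrow> 'a \<Rightarrow> 'e"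
  assumes finite_group: "finite (carrier G)"
    and finite_set: "finite E"
    and act_closed: "e \<in> E \<Longrightarrow> g \<in> carrier G \<Longrightarrow> act e g \<in> E"
    and act_one: "e \<in> E \<Longrightarrow> act e \<one> = e"
    and act_mult: "e \<in> E \<Longrightarrow> g \<in> carrier G \<Longrightarrow> h \<in> carrier G \<Longrightarrow> act (act e g) h = act e (g \<otimes> h)"
begin

definition stab :: "'e \<Rightarrow> 'a set" where
  "stab e = {g \<in> carrier G. act e g = e}"

definition orb :: "'e \<Rightarrow> 'e set" where
  "orb e = {act e g |g. g \<in> carrier G}"

lemma act_inv: "e \<in> E \<Longrightarrow> g \<in> carrier G \<Longrightarrow> act (act e g) (inv g) = e"
  by (simp add: act_mult act_one)

lemma act_inv': "e \<in> E \<Longrightarrow> g \<in> carrier G \<Longrightarrow> act (act e (inv g)) g = e"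
  by (simp add: act_mult act_one)

text \<open>
  The theory of orbits for \<^locale>\<open>group_action\<close> concerns left actions by extensional functions;
  acting by inverses makes it applicable to a right action.
\<close>

lemma left_action: "group_action G E (\<lambda>g. \<lambda>e\<in>E. act e (inv g))"
proof (unfold_locales, goal_cases)
  case 1 then show ?case using group_BijGroup[of E] by (simp add: group.is_monoid monoid.m_assoc monoid.m_closed)
next
  case 2 then show ?case using group_BijGroup[of E] by (simp add: group.is_monoid monoid.m_assoc)
next
  case 3 then show ?case using group_BijGroup[of E] by (simp add: group.is_monoid monoid.one_closed)
next
  case 4 then show ?case using group_BijGroup[of E] by (simp add: group.is_monoid monoid.l_one)
next
  case 5 then show ?case using group_BijGroup[of E] by (simp add: group.is_monoid monoid.r_one)
next
  case 6 then show ?case using group_BijGroup[of E] by (simp add: group.Units)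
next
  case 7
  have bij: "(\<lambda>e\<in>E. act e (inv g)) \<in> Bij E" if "g \<in> carrier G" for g
  proof -
    have "bij_betw (\<lambda>e. act e (inv g)) E E"
      by (rule bij_betwI[where g = "\<lambda>e. act e g"]) (use that in \<open>auto simp: act_closed act_inv act_inv'\<close>)
    then show ?thesis by (simp add: Bij_def bij_betw_restrict_eq)
  qed
  show ?case
    unfolding hom_def BijGroup_def using bij
    by (auto simp: compose_def restrict_def fun_eq_iff act_closed act_mult inv_mult_group)
qed

lemma orbit_eq: "e \<in> E \<Longrightarrow> orbit G (\<lambda>g. \<lambda>e\<in>E. act e (inv g)) e = orb e"
  unfolding orbit_def orb_def by (auto; metis inv_closed inv_inv)

lemma stabilizer_eq: "e \<in> E \<Longrightarrow> stabilizer G (\<lambda>g. \<lambda>e\<in>E. act e (inv g)) e = stab e"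
  unfolding stabilizer_def stab_def by (auto; metis act_inv act_inv')

lemma orbits_eq: "orbits G E (\<lambda>g. \<lambda>e\<in>E. act e (inv g)) = orb ` E"
  unfolding orbits_def using orbit_eq by auto

lemma card_orb_stab: "e \<in> E \<Longrightarrow> card (orb e) * card (stab e) = order G"
  using group_action.orbit_stabilizer_theorem[OF left_action] by (simp add: orbit_eq stabilizer_eq)

lemma orb_subset: "e \<in> E \<Longrightarrow> orb e \<subseteq> E"
  unfolding orb_def using act_closed by auto

lemma orb_self: "e \<in> E \<Longrightarrow> e \<in> orb e"
  unfolding orb_def using act_one[of e] one_closed by (intro CollectI exI[of _ \<one>]) simp

lemma orb_disjoint: "e \<in> E \<Longrightarrow> f \<in> E \<Longrightarrow> orb e = orb f \<or> orb e \<inter> orb f = {}"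
  using group_action.disjoint_union[OF left_action, of "orb e" "orb f"] by (auto simp: orbits_eq)

lemma sum_over_orbits: "(\<Sum>Q\<in>orb ` E. sum f Q) = sum f E"
  using group_action.disjoint_sum[OF left_action finite_set] by (simp add: orbits_eq)

text \<open>
  By the orbit-stabilizer theorem, the summands of each orbit add up to the order of the group.
\<close>

lemma sum_card_stab: "(\<Sum>e\<in>E. card (stab e)) = card (orb ` E) * order G"
proof -
  have "(\<Sum>e\<in>Q. card (stab e)) = order G" if "Q \<in> orb ` E" for Q
  proof -
    have "Q \<subseteq> E" using that orb_subset by auto
    then have "(\<Sum>e\<in>Q. card (stab e)) = (\<Sum>e\<in>Q. card (stabilizer G (\<lambda>g. \<lambda>e\<in>E. act e (inv g)) e))"
      by (intro sum.cong) (auto simp: stabilizer_eq)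
    then show ?thesis
      using group_action.card_stablizer_sum[OF left_action finite_group, of Q] that
      by (simp add: orbits_eq)
  qed
  then show ?thesis
    by (subst sum_over_orbits[symmetric]) simp
qed

definition fixed_points :: "'e set" where
  "fixed_points = {e \<in> E. \<forall>g\<in>carrier G. act e g = e}"

lemma fixed_point_iff: "e \<in> E \<Longrightarrow> e \<in> fixed_points \<longleftrightarrow> card (orb e) = 1"
proof
  assume "e \<in> E" "e \<in> fixed_points"
  then have "orb e = {e}" unfolding fixed_points_def orb_def by (auto intro: exI[of _ \<one>])
  then show "card (orb e) = 1" by simp
next
  assume "e \<in> E" "card (orb e) = 1"
  then have "orb e = {e}" using orb_self[of e] by (auto simp: card_1_singleton_iff)
  then show "e \<in> fixed_points"
    using \<open>e \<in> E\<close> unfolding fixed_points_def orb_def by auto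
qed

text \<open>
  The size of an orbit is a power of \<open>p\<close>, hence divisible by \<open>p\<close> unless the orbit is a fixed point.
\<close>

theorem card_fixed_points_mod:
  fixes p :: nat
  assumes "Factorial_Ring.prime p" "order G = p ^ m"
  shows "card fixed_points mod p = card E mod p"
proof -
  have "p dvd (\<Sum>e\<in>Q. if e \<in> fixed_points then 0 else 1)" if O: "Q \<in> orb ` E" for Q
  proof -
    obtain e where e: "e \<in> E" "Q = orb e" using O by auto
    have same: "card (orb f) = card Q" if "f \<in> Q" for f
    proof -
      have "f \<in> E" using e orb_subset that by auto
      then have "orb f = orb e" using orb_disjoint[of f e] orb_self[of f] that e by auto
      then show ?thesis using e by simp
    qed
    have sub: "Q \<subseteq> E" using e orb_subset by auto
    show ?thesis
    proof (cases "card Q = 1")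
      case True
      then have "\<forall>f\<in>Q. f \<in> fixed_points" using same fixed_point_iff sub by auto
      then show ?thesis by simp
    next
      case False
      then have "\<forall>f\<in>Q. f \<notin> fixed_points" using same fixed_point_iff sub by auto
      then have "(\<Sum>e\<in>Q. if e \<in> fixed_points then 0 else 1) = card Q" by simp
      moreover have "card Q dvd p ^ m" using card_orb_stab[OF e(1)] e assms(2) by (metis dvd_triv_left)
      then obtain i where "card Q = p ^ i" using divides_primepow_nat[OF assms(1)] by auto
      then have "p dvd card Q" using False by (cases i) auto
      ultimately show ?thesis by simp
    qed
  qed
  then have "p dvd (\<Sum>Q\<in>orb ` E. \<Sum>e\<in>Q. if e \<in> fixed_points then 0 else 1)"
    by (rule dvd_sum)
  then have "p dvd (\<Sum>e\<in>E. if e \<in> fixed_points then 0 else 1)"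
    by (simp add: sum_over_orbits)
  moreover have "(\<Sum>e\<in>E. if e \<in> fixed_points then 0 else 1 :: nat) = card (E - fixed_points)"
    using finite_set by (simp add: sum.If_cases Diff_eq)
  moreover have "fixed_points \<subseteq> E" unfolding fixed_points_def by auto
  then have "card E = card (E - fixed_points) + card fixed_points"
    using card_Un_disjoint[of "E - fixed_points" fixed_points] finite_set
    by (simp add: finite_subset[of fixed_points E] Un_absorb2 inf.commute Diff_disjoint)
  ultimately have "p dvd card E - card fixed_points" "card fixed_points \<le> card E" by auto
  then show ?thesis using mod_eq_dvd_iff_nat[of "card fixed_points" "card E" p] by simp
qed

end

section \<open>Linear algebra\<close>

context vector_space begin

lemma span_Int_span_Diff:
  assumes "independent B" "C \<subseteq> B" "x \<in> span C" "x \<in> span (B - C)"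
  shows "x = 0"
proof -
  have "representation B x = representation C x" "representation B x = representation (B - C) x"
    using representation_extend[OF assms(1) assms(3,2)] representation_extend[OF assms(1) assms(4)] by auto
  then have "representation C x b = 0" for b
    using representation_ne_zero[of C x b] representation_ne_zero[of "B - C" x b] by force
  moreover have "(\<Sum>b | representation C x b \<noteq> 0. scale (representation C x b) b) = x"
    using assms independent_mono by (intro sum_nonzero_representation_eq) auto
  ultimately show ?thesis by simp
qed

end

context vector_space_pair begin

lemma rank_nullity:
  assumes f: "Vector_Spaces.linear s1 s2 f" and S: "vs1.subspace S" and fin: "finite F" "S \<subseteq> vs1.span F"
  shows "vs1.dim S = vs2.dim (f ` S) + vs1.dim {x \<in> S. f x = 0}"
proof -
  interpret f: Vector_Spaces.linear s1 s2 f by fact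
  let ?K = "{x \<in> S. f x = 0}"
  have K: "vs1.subspace ?K"
    using S unfolding vs1.subspace_def by (auto simp: f.add f.scale f.zero)
  obtain C where C: "C \<subseteq> ?K" "vs1.independent C" "?K \<subseteq> vs1.span C" "card C = vs1.dim ?K"
    by (rule vs1.basis_exists)
  obtain B where B: "C \<subseteq> B" "B \<subseteq> S" "vs1.independent B" "S \<subseteq> vs1.span B"
    using vs1.maximal_independent_subset_extend[of C S] C by blast
  have finB: "finite B" using vs1.independent_span_bound[OF fin(1) B(3)] B(2) fin(2) by auto
  have dS: "vs1.dim S = card B" using vs1.basis_card_eq_dim[OF B(2,4,3)] by simp
  let ?D = "B - C"
  have indD: "vs1.independent ?D" using B(3) vs1.independent_mono by blast
  have inj: "inj_on f (vs1.span ?D)"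
  proof (subst f.inj_on_iff_eq_0)
    show "vs1.subspace (vs1.span ?D)" by (rule vs1.subspace_span)
    show "\<forall>x\<in>vs1.span ?D. f x = 0 \<longrightarrow> x = 0"
    proof (intro ballI impI)
      fix x assume x: "x \<in> vs1.span ?D" "f x = 0"
      have "x \<in> S" using x(1) B(2) S by (meson Diff_subset subset_eq vs1.span_minimal vs1.span_mono order_trans)
      then have "x \<in> vs1.span C" using x C by auto
      then show "x = 0" using vs1.span_Int_span_Diff[OF B(3,1)] x(1) by auto
    qed
  qed
  have "vs2.independent (f ` ?D)" using linear_independent_injective_image[OF f indD inj] .
  moreover have "f ` ?D \<subseteq> f ` S" using B(2) by auto
  moreover have "f ` S \<subseteq> vs2.span (f ` ?D)"
  proof -
    have "f ` B \<subseteq> insert 0 (f ` ?D)" using C(1) by auto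
    then have "vs2.span (f ` B) \<subseteq> vs2.span (f ` ?D)"
      by (metis vs2.span_insert_0 vs2.span_mono)
    moreover have "f ` S \<subseteq> vs2.span (f ` B)"
      using linear_span_image[OF f, of B] B(4) by blast
    ultimately show ?thesis by auto
  qed
  ultimately have "vs2.dim (f ` S) = card (f ` ?D)"
    by (metis vs2.basis_card_eq_dim)
  also have "\<dots> = card ?D"
    by (rule card_image) (use inj vs1.span_superset in \<open>meson inj_on_subset\<close>)
  also have "\<dots> = card B - card C" using B(1) finB by (meson card_Diff_subset finite_subset)
  finally show ?thesis using dS C(4) card_mono[OF finB B(1)] by simp
qed

end

context vector_space begin

lemma dim_mono_finite:
  assumes "S \<subseteq> T" "finite F" "T \<subseteq> span F"
  shows "dim S \<le> dim T"
proof -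
  obtain B where B: "B \<subseteq> T" "independent B" "T \<subseteq> span B" "card B = dim T" by (rule basis_exists)
  then have "finite B" using independent_span_bound[OF assms(2) B(2)] assms(3) by auto
  then show ?thesis using dim_le_card[of S B] B assms(1) by auto
qed

lemma subspace_eq_dim_finite:
  assumes "subspace S" "S \<subseteq> T" "finite F" "T \<subseteq> span F" "dim T \<le> dim S"
  shows "S = T"
proof (rule ccontr)
  assume "S \<noteq> T"
  then obtain x where x: "x \<in> T" "x \<notin> S" using assms(2) by auto
  obtain B where B: "B \<subseteq> S" "independent B" "S \<subseteq> span B" "card B = dim S" by (rule basis_exists)
  have "finite B" using independent_span_bound[OF assms(3) B(2)] assms(4,2) B(1) by auto
  have "span B = S" using B assms(1) by (meson span_minimal subset_antisym)
  then have "independent (insert x B)" "x \<notin> B" using x B span_base by (auto simp: independent_insert)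
  then have "dim (insert x B) = Suc (card B)"
    using dim_eq_card_independent \<open>finite B\<close> by simp
  moreover have "dim (insert x B) \<le> dim T"
    using dim_mono_finite[of "insert x B" T F] x B assms by auto
  ultimately show False using assms(5) B by simp
qed

text \<open>
  The proof of this criterion extracts a basis from \<open>B\<close>, which by counting has to be all of \<open>B\<close>.
\<close>

lemma independent_if_spans:
  assumes "finite B" "card B \<le> dim V" "V \<subseteq> span B" "B \<subseteq> V"
  shows "independent B"
proof -
  obtain C where C: "C \<subseteq> B" "independent C" "B \<subseteq> span C"
    using maximal_independent_subset[of B] by blast
  then have "span B = span C" by (meson span_minimal span_mono subset_antisym subspace_span)
  then have "dim V = card C" using C assms basis_card_eq_dim[of C V] by auto
  moreover have "card C \<le> card B" by (rule card_mono[OF assms(1) C(1)])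
  ultimately have "C = B" using card_subset_eq[OF assms(1) C(1)] assms(2) by simp
  then show ?thesis using C by simp
qed

end

text \<open>
  In contrast to independence of the set \<open>b ` I\<close>, independence of the family \<open>b\<close> makes \<open>b\<close> injective
  on \<open>I\<close>.
\<close>

definition independent_family :: "('f :: zero \<Rightarrow> 'b \<Rightarrow> 'b :: ab_group_add) \<Rightarrow> ('i \<Rightarrow> 'b) \<Rightarrow> 'i set \<Rightarrow> bool" where
  "independent_family scale b I \<longleftrightarrow> (\<forall>c. (\<Sum>i\<in>I. scale (c i) (b i)) = 0 \<longrightarrow> (\<forall>i\<in>I. c i = 0))"

context vector_space begin

lemma span_family:
  assumes "finite I"
  shows "span (b ` I) = range (\<lambda>c. \<Sum>i\<in>I. scale (c i) (b i))"
proof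
  have sub: "subspace (range (\<lambda>c. \<Sum>i\<in>I. scale (c i) (b i)))"
  proof (rule subspaceI)
    show "0 \<in> range (\<lambda>c. \<Sum>i\<in>I. scale (c i) (b i))"
      by (rule image_eqI[of _ _ "\<lambda>_. 0"]) auto
  next
    fix x y assume "x \<in> range (\<lambda>c. \<Sum>i\<in>I. scale (c i) (b i))" "y \<in> range (\<lambda>c. \<Sum>i\<in>I. scale (c i) (b i))"
    then obtain c d where "x = (\<Sum>i\<in>I. scale (c i) (b i))" "y = (\<Sum>i\<in>I. scale (d i) (b i))" by auto
    then show "x + y \<in> range (\<lambda>c. \<Sum>i\<in>I. scale (c i) (b i))"
      by (intro image_eqI[of _ _ "\<lambda>i. c i + d i"]) (auto simp: scale_left_distrib sum.distrib)
  next
    fix r x assume "x \<in> range (\<lambda>c. \<Sum>i\<in>I. scale (c i) (b i))"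
    then obtain c where "x = (\<Sum>i\<in>I. scale (c i) (b i))" by auto
    then show "scale r x \<in> range (\<lambda>c. \<Sum>i\<in>I. scale (c i) (b i))"
      by (intro image_eqI[of _ _ "\<lambda>i. r * c i"]) (auto simp: scale_sum_right)
  qed
  have "b j \<in> range (\<lambda>c. \<Sum>i\<in>I. scale (c i) (b i))" if "j \<in> I" for j
  proof (rule image_eqI[of _ _ "\<lambda>i. if i = j then 1 else 0"])
    have "(\<Sum>i\<in>I. scale (if i = j then 1 else 0) (b i)) = (\<Sum>i\<in>I. if i = j then b i else 0)"
      by (intro sum.cong) auto
    then show "b j = (\<Sum>i\<in>I. scale (if i = j then 1 else 0) (b i))"
      using assms that by simp
  qed simp
  then show "span (b ` I) \<subseteq> range (\<lambda>c. \<Sum>i\<in>I. scale (c i) (b i))"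
    using sub by (intro span_minimal) auto
  show "range (\<lambda>c. \<Sum>i\<in>I. scale (c i) (b i)) \<subseteq> span (b ` I)"
    by (force intro: span_sum span_scale span_base)
qed

lemma independent_family_iff:
  assumes "finite I"
  shows "independent_family scale b I \<longleftrightarrow> inj_on b I \<and> independent (b ` I)"
proof
  assume ind: "independent_family scale b I"
  have inj: "inj_on b I"
  proof (rule inj_onI, rule ccontr)
    fix i j assume ij: "i \<in> I" "j \<in> I" "b i = b j" "i \<noteq> j"
    let ?c = "\<lambda>k. if k = i then 1 else if k = j then - 1 else 0"
    have "(\<Sum>k\<in>I. scale (?c k) (b k)) = (\<Sum>k\<in>{i, j}. scale (?c k) (b k))"
      using ij assms by (intro sum.mono_neutral_right) auto
    also have "\<dots> = 0" using ij by simp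
    finally show False using ind[unfolded independent_family_def, rule_format, of ?c i] ij(1) by simp
  qed
  have "independent (b ` I)"
    unfolding dependent_finite[OF finite_imageI[OF assms]]
  proof (intro notI, elim exE conjE bexE)
    fix u v assume u: "v \<in> b ` I" "u v \<noteq> 0" "(\<Sum>v\<in>b ` I. scale (u v) v) = 0"
    then have "(\<Sum>i\<in>I. scale (u (b i)) (b i)) = 0" using inj by (simp add: sum.reindex)
    then show False using ind[unfolded independent_family_def, rule_format, of "\<lambda>i. u (b i)"] u by auto
  qed
  with inj show "inj_on b I \<and> independent (b ` I)" by simp
next
  assume A: "inj_on b I \<and> independent (b ` I)"
  show "independent_family scale b I"
    unfolding independent_family_def
  proof (intro allI impI ballI)
    fix c i assume c: "(\<Sum>i\<in>I. scale (c i) (b i)) = 0" "i \<in> I"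
    have "(\<Sum>v\<in>b ` I. scale (c (the_inv_into I b v)) v) = (\<Sum>i\<in>I. scale (c i) (b i))"
      using A by (subst sum.reindex) (auto simp: the_inv_into_f_f intro!: sum.cong)
    then have "c (the_inv_into I b (b i)) = 0"
      using A c assms independentD[of "b ` I" "b ` I" "\<lambda>v. c (the_inv_into I b v)" "b i"] by auto
    then show "c i = 0" using A c by (simp add: the_inv_into_f_f)
  qed
qed

lemma dim_span_family: "finite I \<Longrightarrow> independent_family scale b I \<Longrightarrow> dim (span (b ` I)) = card I"
  by (simp add: independent_family_iff dim_eq_card_independent card_image)

lemma independent_family_subset:
  assumes "independent_family scale b I" "J \<subseteq> I" "finite I"
  shows "independent_family scale b J"
  using assms independent_family_iff[of I b] independent_family_iff[of J b]
  by (meson finite_subset image_mono independent_mono inj_on_subset)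

end

context vector_space begin

lemma dim_direct_sum:
  assumes U: "subspace U" "U \<subseteq> C" and W: "subspace W" "W \<subseteq> C" and "U \<inter> W = {0}"
    and C: "\<And>c. c \<in> C \<Longrightarrow> \<exists>u\<in>U. \<exists>w\<in>W. c = u + w" and fin: "finite F" "C \<subseteq> span F"
  shows "dim C = dim U + dim W"
proof -
  obtain A where A: "A \<subseteq> U" "independent A" "U \<subseteq> span A" "card A = dim U" by (rule basis_exists)
  obtain B where B: "B \<subseteq> W" "independent B" "W \<subseteq> span B" "card B = dim W" by (rule basis_exists)
  have finA: "finite A" using independent_span_bound[OF fin(1) A(2)] A(1) U(2) fin(2) by blast
  have finB: "finite B" using independent_span_bound[OF fin(1) B(2)] B(1) W(2) fin(2) by blast
  have zero: "0 \<notin> A" using A(2) dependent_zero by blast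
  have "A \<inter> B \<subseteq> U \<inter> W" using A(1) B(1) by blast
  then have disj: "A \<inter> B = {}" using zero unfolding assms(5) by blast
  have "independent (A \<union> B)"
    unfolding dependent_finite[OF finite_UnI[OF finA finB]]
  proof (intro notI, elim exE conjE bexE)
    fix u v assume u: "v \<in> A \<union> B" "u v \<noteq> 0" "(\<Sum>v\<in>A \<union> B. scale (u v) v) = 0"
    then have s: "(\<Sum>v\<in>A. scale (u v) v) + (\<Sum>v\<in>B. scale (u v) v) = 0"
      using sum.union_disjoint[OF finA finB disj, of "\<lambda>v. scale (u v) v"] by simp
    have 1: "(\<Sum>v\<in>A. scale (u v) v) \<in> U" "(\<Sum>v\<in>B. scale (u v) v) \<in> W"
      using A(1) B(1) U(1) W(1) by (auto intro!: subspace_sum subspace_scale)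
    then have "(\<Sum>v\<in>A. scale (u v) v) \<in> W"
      using s subspace_neg[OF W(1) 1(2)] by (simp add: eq_neg_iff_add_eq_0[symmetric])
    then have 2: "(\<Sum>v\<in>A. scale (u v) v) = 0" using 1(1) assms(5) by auto
    then have "(\<Sum>v\<in>B. scale (u v) v) = 0" using s by simp
    with 2 show False
      using u independentD[OF A(2) finA subset_refl, of u v] independentD[OF B(2) finB subset_refl, of u v] by auto
  qed
  moreover have "A \<union> B \<subseteq> C" using A B U W by auto
  moreover have "C \<subseteq> span (A \<union> B)"
  proof
    fix c assume "c \<in> C"
    then obtain u w where "u \<in> U" "w \<in> W" "c = u + w" using C by blast
    then show "c \<in> span (A \<union> B)"
      using A(3) B(3) span_mono[of A "A \<union> B"] span_mono[of B "A \<union> B"] by (auto intro!: span_add)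
  qed
  ultimately have "dim C = card (A \<union> B)" using basis_card_eq_dim by metis
  then show ?thesis using card_Un_disjoint[OF finA finB disj] A B by simp
qed

end

section \<open>Linear actions of finite groups\<close>

locale right_representation = vector_space scale + group G
  for scale :: "'f :: field \<Rightarrow> 'v :: ab_group_add \<Rightarrow> 'v" and G :: "('g, 'x) monoid_scheme" (structure) +
  fixes act :: "'v \<Rightarrow> 'g \<Rightarrow> 'v"
  assumes finite_carrier: "finite (carrier G)"
    and act_add: "g \<in> carrier G \<Longrightarrow> act (u + v) g = act u g + act v g"
    and act_scale: "g \<in> carrier G \<Longrightarrow> act (scale c v) g = scale c (act v g)"
    and act_one: "act v \<one> = v"
    and act_mult: "g \<in> carrier G \<Longrightarrow> h \<in> carrier G \<Longrightarrow> act (act v g) h = act v (g \<otimes> h)"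
begin

lemma act_zero: "g \<in> carrier G \<Longrightarrow> act 0 g = 0"
  using act_add[of g 0 0] by simp

lemma act_sum: "g \<in> carrier G \<Longrightarrow> act (\<Sum>i\<in>I. f i) g = (\<Sum>i\<in>I. act (f i) g)"
  by (induction I rule: infinite_finite_induct) (auto simp: act_zero act_add)

definition invariant :: "'v set \<Rightarrow> bool" where
  "invariant V \<longleftrightarrow> subspace V \<and> (\<forall>v\<in>V. \<forall>g\<in>carrier G. act v g \<in> V)"

definition fixed :: "'v \<Rightarrow> bool" where
  "fixed v \<longleftrightarrow> (\<forall>g\<in>carrier G. act v g = v)"

text \<open>
  The action of the norm element of the group algebra.
\<close>

definition norm :: "'v \<Rightarrow> 'v" where
  "norm v = (\<Sum>h\<in>carrier G. act v h)"

lemma sum_mult_right: "g \<in> carrier G \<Longrightarrow> (\<Sum>h\<in>carrier G. f (h \<otimes> g)) = (\<Sum>h\<in>carrier G. f h)"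
  by (rule sum.reindex_bij_witness[where i = "\<lambda>h. h \<otimes> inv g" and j = "\<lambda>h. h \<otimes> g"])
    (auto simp: m_assoc)

lemma sum_inverse: "(\<Sum>h\<in>carrier G. f (inv h)) = (\<Sum>h\<in>carrier G. f h)"
  by (rule sum.reindex_bij_witness[where i = "\<lambda>h. inv h" and j = "\<lambda>h. inv h"]) auto

lemma fixed_norm: "fixed (norm v)"
  unfolding fixed_def norm_def by (auto simp: act_sum act_mult sum_mult_right)

lemma norm_in_invariant: "invariant V \<Longrightarrow> v \<in> V \<Longrightarrow> norm v \<in> V"
  unfolding invariant_def norm_def by (auto intro!: subspace_sum)

lemma linear_norm: "Vector_Spaces.linear scale scale norm"
  by (rule vector_space_pair.linear_compose_sum[unfolded vector_space_pair_def, of _ _ "carrier G" "\<lambda>h v. act v h", folded norm_def])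
    (auto intro!: Vector_Spaces.linear.intro vector_space_axioms module_hom.intro simp: module_hom_axioms_def
      module_axioms act_add act_scale)

text \<open>
  Comparison of coefficients shows that a combination of a permuted basis is fixed if and only if its
  coefficients are constant on the orbits. So the orbit sums form a basis of the space of fixed vectors.
\<close>

theorem fixed_permutation_basis:
  assumes "right_action G I actI" and ind: "independent_family scale b I"
    and perm: "\<And>i g. i \<in> I \<Longrightarrow> g \<in> carrier G \<Longrightarrow> act (b i) g = b (actI i g)"
  shows "{v \<in> span (b ` I). fixed v} = span ((\<lambda>Q. \<Sum>i\<in>Q. b i) ` right_action.orb G actI ` I)"
    and "dim {v \<in> span (b ` I). fixed v} = card (right_action.orb G actI ` I)"
proof -
  interpret I: right_action G I actI by fact
  let ?s = "\<lambda>Q. \<Sum>i\<in>Q. b i"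
  have regroup: "(\<Sum>Q\<in>I.orb ` I. scale (c Q) (?s Q)) = (\<Sum>i\<in>I. scale (c (I.orb i)) (b i))" for c
  proof -
    have "(\<Sum>Q\<in>I.orb ` I. scale (c Q) (?s Q)) = (\<Sum>Q\<in>I.orb ` I. \<Sum>i\<in>Q. scale (c (I.orb i)) (b i))"
    proof (rule sum.cong[OF refl])
      fix Q assume "Q \<in> I.orb ` I"
      then obtain e where e: "e \<in> I" "Q = I.orb e" by auto
      have "I.orb i = Q" if "i \<in> Q" for i
        using e that I.orb_subset[of e] I.orb_disjoint[of i e] I.orb_self[of i] by auto
      then show "scale (c Q) (?s Q) = (\<Sum>i\<in>Q. scale (c (I.orb i)) (b i))"
        by (auto simp: scale_sum_right intro!: sum.cong)
    qed
    then show ?thesis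
      using I.sum_over_orbits[of "\<lambda>i. scale (c (I.orb i)) (b i)"] by simp
  qed
  have fin: "finite I" "finite (I.orb ` I)" using I.finite_set by auto
  have inds: "independent_family scale ?s (I.orb ` I)"
    unfolding independent_family_def
    using ind by (auto simp: regroup independent_family_def)
  show eq: "{v \<in> span (b ` I). fixed v} = span (?s ` I.orb ` I)"
  proof (intro subset_antisym subsetI)
    fix v assume "v \<in> {v \<in> span (b ` I). fixed v}"
    then obtain c where c: "v = (\<Sum>i\<in>I. scale (c i) (b i))" and v: "fixed v"
      by (auto simp: span_family[OF fin(1)])
    have const: "c (actI i g) = c i" if "g \<in> carrier G" "i \<in> I" for i g
    proof -
      have "act v g = (\<Sum>i\<in>I. scale (c i) (b (actI i g)))"
        unfolding c using that by (simp add: act_sum act_scale perm)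
      also have "\<dots> = (\<Sum>i\<in>I. scale (c (actI i (inv g))) (b i))"
        by (rule sum.reindex_bij_witness[where i = "\<lambda>i. actI i (inv g)" and j = "\<lambda>i. actI i g"])
          (use that in \<open>auto simp: I.act_inv I.act_inv' I.act_closed\<close>)
      finally have "(\<Sum>i\<in>I. scale (c (actI i (inv g)) - c i) (b i)) = act v g - v"
        by (simp add: c scale_left_diff_distrib sum_subtractf)
      also have "\<dots> = 0" using v that unfolding fixed_def by auto
      finally have "c (actI (actI i g) (inv g)) - c (actI i g) = 0"
        using ind[unfolded independent_family_def, rule_format, of "\<lambda>i. c (actI i (inv g)) - c i" "actI i g"]
          I.act_closed[OF that(2,1)] by simp
      then show ?thesis using that by (simp add: I.act_inv)
    qed
    define d where "d Q = c (SOME i. i \<in> Q)" for Q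
    have "c i = d (I.orb i)" if "i \<in> I" for i
    proof -
      have "(SOME j. j \<in> I.orb i) \<in> I.orb i" using I.orb_self[OF that] by (rule someI)
      then show ?thesis unfolding d_def I.orb_def using const that by auto
    qed
    then have "v = (\<Sum>Q\<in>I.orb ` I. scale (d Q) (?s Q))" unfolding regroup c by (auto intro: sum.cong)
    then show "v \<in> span (?s ` I.orb ` I)" using span_family[OF fin(2)] by auto
  next
    fix v assume "v \<in> span (?s ` I.orb ` I)"
    then obtain d where "v = (\<Sum>Q\<in>I.orb ` I. scale (d Q) (?s Q))" using span_family[OF fin(2)] by auto
    then have v: "v = (\<Sum>i\<in>I. scale (d (I.orb i)) (b i))" using regroup by simp
    have "act v g = v" if g: "g \<in> carrier G" for g
    proof -
      have "act v g = (\<Sum>i\<in>I. scale (d (I.orb i)) (b (actI i g)))"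
        unfolding v using g by (simp add: act_sum act_scale perm)
      also have "\<dots> = (\<Sum>i\<in>I. scale (d (I.orb (actI i (inv g)))) (b i))"
        by (rule sum.reindex_bij_witness[where i = "\<lambda>i. actI i (inv g)" and j = "\<lambda>i. actI i g"])
          (use g in \<open>auto simp: I.act_inv I.act_inv' I.act_closed\<close>)
      also have "\<dots> = v"
      proof -
        have "I.orb (actI i (inv g)) = I.orb i" if "i \<in> I" for i
        proof -
          have "actI i (inv g) \<in> I.orb i" unfolding I.orb_def using g by auto
          then show ?thesis
            using that g I.act_closed[of i "inv g"] I.orb_self[of "actI i (inv g)"]
              I.orb_disjoint[of "actI i (inv g)" i] by auto
        qed
        then show ?thesis unfolding v by (auto intro: sum.cong)
      qed
      finally show ?thesis .
    qed
    then show "v \<in> {v \<in> span (b ` I). fixed v}"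
      using v span_family[OF fin(1)] unfolding fixed_def by auto
  qed
  show "dim {v \<in> span (b ` I). fixed v} = card (I.orb ` I)"
    using eq dim_span_family[OF fin(2) inds] by simp
qed

end

section \<open>Modular representations of p-groups\<close>

interpretation fun_space: vector_space fun_scale
  by (rule vector_space_fun_scale)

lemma sum_fun_apply: "(\<Sum>i\<in>I. f i) x = (\<Sum>i\<in>I. f i x)"
  by (induction I rule: infinite_finite_induct) auto

definition supported :: "'i set \<Rightarrow> ('i \<Rightarrow> 'f :: field) set" where
  "supported A = {c. \<forall>x. x \<notin> A \<longrightarrow> c x = 0}"

lemma subspace_supported: "fun_space.subspace (supported A)"
  by (rule fun_space.subspaceI) (auto simp: supported_def fun_scale_def)

lemma sum_group_elem: "finite A \<Longrightarrow> (\<Sum>a\<in>A. fun_scale (c a) (group_elem a)) = (\<lambda>x. if x \<in> A then c x else 0)"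
  by (auto simp: fun_eq_iff sum_fun_apply fun_scale_def group_elem_def if_distrib cong: if_cong)

lemma independent_group_elem: "finite A \<Longrightarrow> independent_family fun_scale group_elem A"
  by (auto simp: independent_family_def sum_group_elem fun_eq_iff split: if_splits)

lemma span_group_elem: "finite A \<Longrightarrow> fun_space.span (group_elem ` A) = supported A"
  unfolding fun_space.span_family sum_group_elem supported_def
  by (auto simp: fun_eq_iff image_iff)

lemma dim_supported: "finite A \<Longrightarrow> fun_dim (supported A) = card A"
  using fun_space.dim_span_family[OF _ independent_group_elem] span_group_elem by metis

locale modular_representation = right_representation scale G act
  for scale :: "'f :: field \<Rightarrow> 'v :: ab_group_add \<Rightarrow> 'v" and G :: "('g, 'x) monoid_scheme" (structure) and act +
  fixes p m :: nat
  assumes prime: "Factorial_Ring.prime p" and char: "CHAR('f) = p" and order: "order G = p ^ m"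
begin

lemma of_nat_mod_char: "(of_nat (n mod p) :: 'f) = of_nat n"
proof -
  have "(of_nat n :: 'f) = of_nat (p * (n div p) + n mod p)" by simp
  also have "\<dots> = of_nat (n mod p)" unfolding of_nat_add of_nat_mult using of_nat_CHAR[where ?'a = 'f] char by simp
  finally show ?thesis by simp
qed

text \<open>
  The combinations of the translates of \<open>v\<close> with coefficients in the prime field form a finite
  invariant set \<open>T\<close>. Adding multiples of \<open>v\<close> lets \<open>\<int>/p\<close> act on \<open>T\<close> without fixed points, so \<open>p\<close>
  divides the size of \<open>T\<close>. Then \<open>p\<close> also divides the number of vectors of \<open>T\<close> that are fixed by
  \<open>G\<close>, and \<open>0\<close> cannot be the only one.
\<close>

theorem ex_fixed_vector:
  assumes V: "invariant V" and v: "v \<in> V" "v \<noteq> 0"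
  shows "\<exists>w\<in>V. w \<noteq> 0 \<and> fixed w"
proof -
  define comb where "comb n = (\<Sum>h\<in>carrier G. scale (of_nat (n h)) (act v h))" for n :: "'g \<Rightarrow> nat"
  define T where "T = range comb"
  have "T \<subseteq> comb ` (carrier G \<rightarrow>\<^sub>E {..<p})"
  proof
    fix t assume "t \<in> T"
    then obtain n where "t = comb n" by (auto simp: T_def)
    also have "\<dots> = comb (restrict (\<lambda>h. n h mod p) (carrier G))"
      unfolding comb_def by (intro sum.cong) (auto simp: of_nat_mod_char)
    finally show "t \<in> comb ` (carrier G \<rightarrow>\<^sub>E {..<p})"
      using prime_gt_0_nat[OF prime] by (intro image_eqI) auto
  qed
  then have finT: "finite T"
    by (rule finite_subset) (intro finite_imageI finite_PiE finite_carrier finite_lessThan)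
  have TV: "T \<subseteq> V"
    using V v unfolding T_def comb_def invariant_def by (auto intro!: subspace_sum subspace_scale)
  have shift: "comb n + scale (of_nat j) v = comb (n(\<one> := n \<one> + j))" for n j
  proof -
    have "comb (n(\<one> := n \<one> + j)) = (\<Sum>h\<in>carrier G. scale (of_nat (n h)) (act v h) + (if h = \<one> then scale (of_nat j) v else 0))"
      unfolding comb_def by (intro sum.cong) (auto simp: scale_left_distrib act_one)
    then show ?thesis by (simp add: sum.distrib comb_def finite_carrier)
  qed
  have p1: "1 < p" using prime_gt_1_nat[OF prime] .
  let ?Z = "integer_mod_group p"
  have Z: "carrier ?Z = {0..<int p}" "\<one>\<^bsub>?Z\<^esub> = 0" "x \<otimes>\<^bsub>?Z\<^esub> y = (x + y) mod int p" for x y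
    using p1 by (auto simp: integer_mod_group_def)
  interpret Z: right_action ?Z T "\<lambda>t i. t + scale (of_nat (nat i)) v"
  proof (intro right_action.intro right_action_axioms.intro)
    show "Group.group ?Z" by simp
    show "finite (carrier ?Z)" by (simp add: Z)
    show "finite T" by fact
    show "t + scale (of_nat (nat i)) v \<in> T" if "t \<in> T" for t i
      using that shift by (auto simp: T_def)
    show "t + scale (of_nat (nat \<one>\<^bsub>?Z\<^esub>)) v = t" for t by (simp add: Z)
    show "t + scale (of_nat (nat i)) v + scale (of_nat (nat j)) v = t + scale (of_nat (nat (i \<otimes>\<^bsub>?Z\<^esub> j))) v"
      if "i \<in> carrier ?Z" "j \<in> carrier ?Z" for t i j
    proof -
      have "nat (i \<otimes>\<^bsub>?Z\<^esub> j) = (nat i + nat j) mod p"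
        using that by (simp add: Z nat_mod_distrib nat_add_distrib)
      then show ?thesis by (simp only: of_nat_mod_char) (simp add: scale_left_distrib add.assoc)
    qed
  qed
  have "Z.fixed_points = {}"
  proof -
    have "(1 :: int) \<in> carrier ?Z" using p1 by (simp add: Z)
    moreover have "t + scale (of_nat (nat 1)) v \<noteq> t" for t using v by simp
    ultimately show ?thesis unfolding Z.fixed_points_def by blast
  qed
  moreover have "Coset.order ?Z = p ^ 1" by (simp add: order_def Z)
  ultimately have T0: "card T mod p = 0"
    using Z.card_fixed_points_mod[OF prime, of 1] by simp
  have comb_act: "act (comb n) g = comb (\<lambda>h. n (h \<otimes> inv g))" if "g \<in> carrier G" for n g
  proof -
    have "act (comb n) g = (\<Sum>h\<in>carrier G. scale (of_nat (n ((h \<otimes> g) \<otimes> inv g))) (act v (h \<otimes> g)))"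
      unfolding comb_def using that by (auto simp: act_sum act_scale act_mult m_assoc intro!: sum.cong)
    then show ?thesis
      using sum_mult_right[OF that, of "\<lambda>k. scale (of_nat (n (k \<otimes> inv g))) (act v k)"] by (simp add: comb_def)
  qed
  interpret T: right_action G T act
  proof (intro right_action.intro right_action_axioms.intro)
    show "act t g \<in> T" if "t \<in> T" "g \<in> carrier G" for t g
      using that comb_act by (auto simp: T_def)
  qed (auto simp: finite_carrier finT act_one act_mult is_group)
  have "card T.fixed_points mod p = 0"
    using T.card_fixed_points_mod[OF prime order] T0 by simp
  moreover have "0 \<in> T.fixed_points"
  proof -
    have "comb (\<lambda>_. 0) = 0" unfolding comb_def by simp
    then have "0 \<in> T" unfolding T_def by (metis rangeI)
    then show ?thesis unfolding T.fixed_points_def by (simp add: act_zero)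
  qed
  moreover have "finite T.fixed_points" using finT unfolding T.fixed_points_def by simp
  ultimately have "card T.fixed_points \<ge> p" by (metis card_0_eq dvd_imp_le empty_iff gr0I mod_0_imp_dvd)
  then have "\<not> T.fixed_points \<subseteq> {0}" using p1 card_mono[of "{0}" T.fixed_points] by auto
  then obtain w where "w \<in> T" "w \<noteq> 0" "fixed w" unfolding T.fixed_points_def fixed_def by auto
  then show ?thesis using TV by auto
qed

text \<open>
  The submodule generated by \<open>I\<close>.
\<close>

definition translates :: "'v set \<Rightarrow> 'v set" where
  "translates I = span ((\<lambda>(u, h). act u h) ` (I \<times> carrier G))"

lemma translates_eq:
  "finite I \<Longrightarrow> translates I = range (\<lambda>c. \<Sum>(u, h)\<in>I \<times> carrier G. scale (c (u, h)) (act u h))"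
  unfolding translates_def using span_family[of "I \<times> carrier G" "\<lambda>(u, h). act u h"] finite_carrier
  by (simp add: case_prod_unfold)

text \<open>
  Choose vectors \<open>u\<close> whose norms form a basis of \<open>norm ` V\<close>. Let \<open>\<iota>\<close> be the homomorphism into \<open>V\<close>
  from the free module on these vectors. The coordinates \<open>\<phi> u\<close> with respect to the basis of norms,
  extended to linear functionals on the whole space, induce a homomorphism \<open>\<rho>\<close> in the
  opposite direction. If the kernel of \<open>\<rho> \<circ> \<iota>\<close> were nonzero, it would contain a nonzero fixed
  vector, that is, a nonzero family \<open>c\<close> of coefficients which do not depend on the group element; but
  \<open>\<iota>\<close> maps it to \<open>\<Sum>u. c u \<cdot> norm u\<close>, from which \<open>\<phi> u\<close> recovers \<open>c u\<close>. Hence \<open>\<rho> \<circ> \<iota>\<close> is bijective,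
  and \<open>V\<close> is the direct sum of the image of \<open>\<iota>\<close> and the kernel \<open>Q\<close> of \<open>\<rho>\<close>. For \<open>q \<in> Q\<close> all
  functionals \<open>\<phi> u\<close> vanish on the translates of \<open>q\<close> and so on \<open>norm q\<close>, which is therefore \<open>0\<close>.
\<close>

theorem free_summand:
  assumes V: "invariant V" and fin: "finite F" "V \<subseteq> span F"
  obtains I Q where "finite I" "I \<subseteq> V" "independent_family scale (\<lambda>(u, h). act u h) (I \<times> carrier G)"
    "invariant Q" "Q \<subseteq> V" "\<And>v. v \<in> V \<Longrightarrow> \<exists>w\<in>translates I. \<exists>q\<in>Q. v = w + q"
    "translates I \<inter> Q = {0}" "\<And>q. q \<in> Q \<Longrightarrow> norm q = 0" "card I = dim (norm ` V)"
proof -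
  interpret norm: Vector_Spaces.linear scale scale norm by (rule linear_norm)
  have subV: "subspace V" and actV: "\<And>v g. v \<in> V \<Longrightarrow> g \<in> carrier G \<Longrightarrow> act v g \<in> V"
    using V unfolding invariant_def by auto
  have normV: "norm ` V \<subseteq> V" using V norm_in_invariant by auto
  have subN: "subspace (norm ` V)" by (rule norm.subspace_image[OF subV])
  obtain B where B: "B \<subseteq> norm ` V" "independent B" "norm ` V \<subseteq> span B" "card B = dim (norm ` V)"
    by (rule basis_exists)
  have finB: "finite B" using independent_span_bound[OF fin(1) B(2)] B(1) normV fin(2) by blast
  obtain pre where pre: "\<And>b. b \<in> B \<Longrightarrow> pre b \<in> V \<and> norm (pre b) = b"
  proof -
    have "\<forall>b\<in>B. \<exists>v. v \<in> V \<and> norm v = b" using B(1) by auto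
    then show thesis using bchoice that by meson
  qed
  define I where "I = pre ` B"
  have finI: "finite I" and IV: "I \<subseteq> V" using finB pre by (auto simp: I_def)
  have injI: "inj_on norm I" using pre by (auto simp: I_def inj_on_def)
  have normI: "norm ` I = B" using pre by (force simp: I_def)
  have cardI: "card I = card B" using card_image[OF injI] normI by simp
  have indN: "independent_family scale norm I"
    using independent_family_iff[OF finI] injI normI B(2) by simp
  define J where "J = I \<times> carrier G"
  have finJ: "finite J" using finI finite_carrier by (simp add: J_def)
  define \<iota> where "\<iota> c = (\<Sum>(u, h)\<in>J. scale (c (u, h)) (act u h))" for c
  \<comment> \<open>The free module is the space of functions supported on \<open>J\<close>, with the action by right translation.\<close>
  define actX :: "('v \<times> 'g \<Rightarrow> 'f) \<Rightarrow> 'g \<Rightarrow> 'v \<times> 'g \<Rightarrow> 'f"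
    where "actX c g = (\<lambda>(u, h). if h \<in> carrier G then c (u, h \<otimes> inv g) else c (u, h))" for c g
  define \<phi> where "\<phi> u v = representation (extend_basis B) v (norm u)" for u v
  define \<rho> :: "'v \<Rightarrow> 'v \<times> 'g \<Rightarrow> 'f"
    where "\<rho> v = (\<lambda>(u, h). if (u, h) \<in> J then \<phi> u (act v (inv h)) else 0)" for v
  have ext: "independent (extend_basis B)" "v \<in> span (extend_basis B)" "B \<subseteq> extend_basis B" for v
    using B(2) by (auto simp: independent_extend_basis extend_basis_superset)
  have \<phi>_add: "\<phi> u (v + w) = \<phi> u v + \<phi> u w" and \<phi>_scale: "\<phi> u (scale r v) = r * \<phi> u v" for u v w r
    unfolding \<phi>_def using representation_add[OF ext(1) ext(2) ext(2)] representation_scale[OF ext(1) ext(2)] by auto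
  have \<phi>_sum: "\<phi> u (\<Sum>j\<in>S. f j) = (\<Sum>j\<in>S. \<phi> u (f j))" for u f and S :: "'j set"
    unfolding \<phi>_def by (subst representation_sum[OF ext(1) ext(2)]) simp
  have \<phi>_norm: "\<phi> u (norm w) = (if u = w then 1 else 0)" if "u \<in> I" "w \<in> I" for u w
  proof -
    have "norm w \<in> extend_basis B" using that normI ext(3) by auto
    then show ?thesis unfolding \<phi>_def
      using representation_basis[OF ext(1)] that injI by (auto simp: inj_on_def)
  qed
  have \<phi>_comb: "\<phi> u (\<Sum>w\<in>I. scale (c w) (norm w)) = c u" if "u \<in> I" for u c
  proof -
    have "\<phi> u (\<Sum>w\<in>I. scale (c w) (norm w)) = (\<Sum>w\<in>I. if u = w then c w else 0)"
      unfolding \<phi>_sum \<phi>_scale using that by (intro sum.cong) (auto simp: \<phi>_norm)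
    then show ?thesis using that finI by simp
  qed
  interpret X: modular_representation fun_scale G actX p m
  proof unfold_locales
    show "actX (u + v) g = actX u g + actX v g" for u v g by (auto simp: actX_def fun_eq_iff)
    show "actX (fun_scale r u) g = fun_scale r (actX u g)" for u r g by (auto simp: actX_def fun_scale_def fun_eq_iff)
    show "actX v \<one> = v" for v by (auto simp: actX_def fun_eq_iff)
    show "actX (actX v g) h = actX v (g \<otimes> h)" if "g \<in> carrier G" "h \<in> carrier G" for v g h
      using that by (auto simp: actX_def fun_eq_iff inv_mult_group m_assoc)
  qed (auto simp: finite_carrier prime char order)
  have lin\<iota>: "Vector_Spaces.linear fun_scale scale \<iota>"
  proof unfold_locales
    show "\<iota> (c + d) = \<iota> c + \<iota> d" "\<iota> (fun_scale r c) = scale r (\<iota> c)" for c d r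
      by (auto simp: \<iota>_def fun_scale_def scale_left_distrib sum.distrib scale_sum_right case_prod_unfold)
  qed
  have lin\<rho>: "Vector_Spaces.linear scale fun_scale \<rho>"
  proof unfold_locales
    show "\<rho> (c + d) = \<rho> c + \<rho> d" "\<rho> (scale r c) = fun_scale r (\<rho> c)" for c d r
      by (auto simp: \<rho>_def fun_scale_def fun_eq_iff act_add act_scale \<phi>_add \<phi>_scale J_def)
  qed
  have lin: "Vector_Spaces.linear fun_scale fun_scale (\<rho> \<circ> \<iota>)"
    using lin\<iota> lin\<rho> by (rule Vector_Spaces.linear_compose)
  interpret \<iota>: Vector_Spaces.linear fun_scale scale \<iota> by fact
  interpret \<rho>: Vector_Spaces.linear scale fun_scale \<rho> by fact
  have \<rho>_act: "\<rho> (act v g) = actX (\<rho> v) g" if "g \<in> carrier G" for v g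
    using that by (auto simp: \<rho>_def actX_def fun_eq_iff act_mult inv_mult_group J_def)
  have \<iota>_act: "\<iota> (actX c g) = act (\<iota> c) g" if g: "g \<in> carrier G" for c g
  proof -
    have "act (\<iota> c) g = (\<Sum>u\<in>I. \<Sum>h\<in>carrier G. scale (c (u, (h \<otimes> g) \<otimes> inv g)) (act u (h \<otimes> g)))"
      unfolding \<iota>_def J_def sum.cartesian_product[symmetric] using g
      by (auto simp: act_sum act_scale act_mult m_assoc intro!: sum.cong)
    also have "\<dots> = (\<Sum>u\<in>I. \<Sum>h\<in>carrier G. scale (c (u, h \<otimes> inv g)) (act u h))"
      using sum_mult_right[OF g, of "\<lambda>k. scale (c (_, k \<otimes> inv g)) (act _ k)"] by simp
    also have "\<dots> = \<iota> (actX c g)"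
      unfolding \<iota>_def J_def sum.cartesian_product[symmetric] by (auto simp: actX_def intro!: sum.cong)
    finally show ?thesis by simp
  qed
  \<comment> \<open>The kernel of \<open>\<rho> \<circ> \<iota>\<close> is invariant, so that it is enough to exclude nonzero fixed vectors.\<close>
  have inj0: "c = 0" if c: "c \<in> supported J" "\<rho> (\<iota> c) = 0" for c
  proof (rule ccontr)
    assume "c \<noteq> 0"
    let ?K = "{c \<in> supported J. \<rho> (\<iota> c) = 0}"
    have "X.invariant ?K"
      unfolding X.invariant_def
    proof (intro conjI ballI)
      show "fun_space.subspace ?K"
        using subspace_supported[of J] unfolding fun_space.subspace_def
        by (auto simp: \<iota>.add \<iota>.scale \<iota>.zero \<rho>.add \<rho>.scale \<rho>.zero)
      show "actX c g \<in> ?K" if "c \<in> ?K" "g \<in> carrier G" for c g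
      proof -
        have "\<rho> (\<iota> (actX c g)) = actX 0 g" using that \<iota>_act \<rho>_act by simp
        moreover have "actX c g \<in> supported J" using that by (auto simp: supported_def actX_def J_def)
        ultimately show ?thesis using that X.act_zero by auto
      qed
    qed
    then obtain d where d: "d \<in> supported J" "\<rho> (\<iota> d) = 0" "d \<noteq> 0" "X.fixed d"
      using X.ex_fixed_vector[of ?K c] c \<open>c \<noteq> 0\<close> by auto
    have const: "d (u, h) = d (u, \<one>)" if "h \<in> carrier G" for u h
    proof -
      have "actX d h (u, h) = d (u, h)" using d(4) that unfolding X.fixed_def by simp
      then show ?thesis using that by (simp add: actX_def)
    qed
    have "\<iota> d = (\<Sum>u\<in>I. scale (d (u, \<one>)) (norm u))"
      unfolding \<iota>_def J_def sum.cartesian_product[symmetric] norm_def scale_sum_right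
      by (intro sum.cong refl arg_cong2[where f = scale]) (rule const)
    then have "\<phi> u (\<iota> d) = d (u, \<one>)" if "u \<in> I" for u
      using that by (simp add: \<phi>_comb)
    moreover have "\<phi> u (\<iota> d) = 0" if "u \<in> I" for u
      using that fun_cong[OF d(2), of "(u, \<one>)"] by (simp add: \<rho>_def J_def act_one)
    ultimately have "d (u, h) = 0" if "u \<in> I" "h \<in> carrier G" for u h
      using const[of h u] that by simp
    then have "d = 0" using d(1) by (auto simp: supported_def J_def fun_eq_iff)
    then show False using d by simp
  qed
  have spanJ: "fun_space.span (group_elem ` J) = (supported J :: ('v \<times> 'g \<Rightarrow> 'f) set)"
    by (rule span_group_elem[OF finJ])
  have surj: "(\<rho> \<circ> \<iota>) ` supported J = supported J"
  proof (rule fun_space.subspace_eq_dim_finite)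
    interpret l: Vector_Spaces.linear fun_scale fun_scale "\<rho> \<circ> \<iota>" by fact
    show "fun_space.subspace ((\<rho> \<circ> \<iota>) ` supported J)"
      by (rule l.subspace_image[OF subspace_supported])
    show "(\<rho> \<circ> \<iota>) ` supported J \<subseteq> supported J"
      by (auto simp: \<rho>_def supported_def)
    show "finite (group_elem ` J :: ('v \<times> 'g \<Rightarrow> 'f) set)" using finJ by simp
    show "supported J \<subseteq> fun_space.span (group_elem ` J :: ('v \<times> 'g \<Rightarrow> 'f) set)" using spanJ by simp
    have "fun_dim (supported J :: ('v \<times> 'g \<Rightarrow> 'f) set) = fun_dim ((\<rho> \<circ> \<iota>) ` supported J) + fun_dim {c \<in> supported J. (\<rho> \<circ> \<iota>) c = 0}"
      using spanJ finJ
      by (intro vector_space_pair.rank_nullity[of fun_scale fun_scale _ _ "group_elem ` J :: ('v \<times> 'g \<Rightarrow> 'f) set"])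
         (auto simp: lin subspace_supported vector_space_pair_def vector_space_fun_scale)
    moreover have "{c \<in> supported J. (\<rho> \<circ> \<iota>) c = 0} \<subseteq> {0}" using inj0 by auto
    then have "fun_dim {c \<in> supported J. (\<rho> \<circ> \<iota>) c = 0} \<le> 0"
      using fun_space.dim_le_card[of _ "{}"] by simp
    ultimately show "fun_dim (supported J :: ('v \<times> 'g \<Rightarrow> 'f) set) \<le> fun_dim ((\<rho> \<circ> \<iota>) ` supported J)" by simp
  qed
  have \<iota>_mod: "\<iota> c = \<iota> (\<lambda>x. if x \<in> J then c x else 0)" "(\<lambda>x. if x \<in> J then c x else 0) \<in> supported J" for c
    unfolding \<iota>_def supported_def by (auto intro!: sum.cong)
  have W: "translates I = \<iota> ` supported J"
    unfolding translates_eq[OF finI] J_def[symmetric] \<iota>_def[symmetric] using \<iota>_mod by blast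
  define Q where "Q = {v \<in> V. \<rho> v = 0}"
  show thesis
  proof
    show "finite I" "I \<subseteq> V" by fact+
    show "card I = dim (norm ` V)" using cardI B by simp
    show "independent_family scale (\<lambda>(u, h). act u h) (I \<times> carrier G)"
      unfolding independent_family_def
    proof (intro allI impI ballI)
      fix c x assume c: "(\<Sum>i\<in>I \<times> carrier G. scale (c i) (case i of (u, h) \<Rightarrow> act u h)) = 0" "x \<in> I \<times> carrier G"
      then have "\<iota> c = 0" unfolding \<iota>_def J_def by (simp add: case_prod_unfold)
      then have "(\<lambda>x. if x \<in> J then c x else 0) = 0"
        by - (rule inj0[OF \<iota>_mod(2)], simp only: \<iota>_mod(1)[of c, symmetric] \<rho>.zero)
      then show "c x = 0" using c(2) by (auto simp: J_def fun_eq_iff split: if_splits)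
    qed
    show "invariant Q"
      unfolding invariant_def Q_def using subV actV \<rho>_act X.act_zero
      by (auto simp: subspace_def \<rho>.add \<rho>.scale \<rho>.zero)
    show "Q \<subseteq> V" by (auto simp: Q_def)
    have WV: "translates I \<subseteq> V"
      unfolding translates_def using IV actV subV by (intro span_minimal) auto
    show "\<exists>w\<in>translates I. \<exists>q\<in>Q. v = w + q" if "v \<in> V" for v
    proof -
      have "\<rho> v \<in> supported J" by (auto simp: \<rho>_def supported_def)
      then obtain c where c: "c \<in> supported J" "\<rho> v = \<rho> (\<iota> c)" using surj by (metis comp_apply imageE)
      have "\<iota> c \<in> translates I" using W c by auto
      moreover have "v - \<iota> c \<in> Q"
        using c \<open>\<iota> c \<in> translates I\<close> WV that subV unfolding Q_def by (auto simp: \<rho>.diff subspace_diff)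
      ultimately show ?thesis by (intro bexI[of _ "\<iota> c"] bexI[of _ "v - \<iota> c"]) auto
    qed
    show "translates I \<inter> Q = {0}"
    proof
      have "\<iota> c = 0" if "c \<in> supported J" "\<rho> (\<iota> c) = 0" for c
        using inj0[OF that] \<iota>.zero by simp
      then show "translates I \<inter> Q \<subseteq> {0}" by (auto simp: W Q_def)
      show "{0} \<subseteq> translates I \<inter> Q"
        using subV \<rho>.zero by (auto simp: Q_def translates_def span_zero subspace_0)
    qed
    \<comment> \<open>The norm of \<open>q\<close> is a combination of the norms of \<open>I\<close>; the functionals \<open>\<phi> u\<close> read off its coefficients.\<close>
    show "norm q = 0" if "q \<in> Q" for q
    proof -
      have "norm q \<in> span B" using that B(3) by (auto simp: Q_def)
      then have "norm q \<in> span (norm ` I)" using normI by simp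
      then obtain c where c: "norm q = (\<Sum>u\<in>I. scale (c u) (norm u))"
        using span_family[OF finI] by auto
      have "c u = 0" if u: "u \<in> I" for u
      proof -
        have "c u = \<phi> u (norm q)" unfolding c using u by (simp add: \<phi>_comb)
        also have "\<dots> = (\<Sum>h\<in>carrier G. \<phi> u (act q (inv h)))"
          unfolding norm_def by (simp add: \<phi>_sum sum_inverse[of "\<lambda>h. \<phi> u (act q h)"])
        also have "\<dots> = 0"
        proof (rule sum.neutral, intro ballI)
          fix h assume "h \<in> carrier G"
          then have "\<phi> u (act q (inv h)) = \<rho> q (u, h)" using u by (simp add: \<rho>_def J_def)
          then show "\<phi> u (act q (inv h)) = 0" using \<open>q \<in> Q\<close> by (simp add: Q_def)
        qed
        finally show ?thesis .
      qed
      then show ?thesis using c by simp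
    qed
  qed
qed

lemma invariant_translates:
  assumes "I \<subseteq> V" "invariant V"
  shows "invariant (translates I)" "translates I \<subseteq> V"
proof -
  have "act v g \<in> translates I" if v: "v \<in> translates I" and g: "g \<in> carrier G" for v g
  proof -
    have "translates I \<subseteq> {v. act v g \<in> translates I}"
      unfolding translates_def
    proof (rule span_minimal)
      let ?S = "span ((\<lambda>(u, h). act u h) ` (I \<times> carrier G))"
      show "subspace {v. act v g \<in> ?S}"
        using g by (auto simp: subspace_def act_zero act_add act_scale span_zero span_add span_scale)
      show "(\<lambda>(u, h). act u h) ` (I \<times> carrier G) \<subseteq> {v. act v g \<in> ?S}"
      proof clarsimp
        fix u h assume uh: "u \<in> I" "h \<in> carrier G"
        then have "act (act u h) g = (\<lambda>(u, h). act u h) (u, h \<otimes> g)" using g by (simp add: act_mult)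
        then show "act (act u h) g \<in> ?S"
          using uh g by (metis (no_types, lifting) SigmaI imageI m_closed span_base)
      qed
    qed
    then show ?thesis using v by auto
  qed
  then show "invariant (translates I)" unfolding invariant_def translates_def by auto
  show "translates I \<subseteq> V"
    using assms unfolding translates_def invariant_def by (intro span_minimal) auto
qed

text \<open>
  In the splitting given by \<open>free_summand\<close> the complement is zero, and the module is free: a nonzero
  complement would contain a nonzero fixed vector, which is the norm of a vector of \<open>U\<close>, but the norms
  of \<open>U\<close> lie in the free summand.
\<close>

lemma dim_if_fixed_are_norms:
  assumes U: "invariant U" and fin: "finite F" "U \<subseteq> span F"
    and norms: "\<And>u. u \<in> U \<Longrightarrow> fixed u \<Longrightarrow> \<exists>v\<in>U. u = norm v"
  shows "dim U = order G * dim (norm ` U)"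
proof -
  interpret norm: Vector_Spaces.linear scale scale norm by (rule linear_norm)
  obtain I Q where I: "finite I" "I \<subseteq> U" "independent_family scale (\<lambda>(u, h). act u h) (I \<times> carrier G)"
    and Q: "invariant Q" "Q \<subseteq> U" "\<And>v. v \<in> U \<Longrightarrow> \<exists>w\<in>translates I. \<exists>q\<in>Q. v = w + q"
      "translates I \<inter> Q = {0}" "\<And>q. q \<in> Q \<Longrightarrow> norm q = 0" and card: "card I = dim (norm ` U)"
    by (rule free_summand[OF U fin]) blast
  have "q = 0" if q: "q \<in> Q" for q
  proof (rule ccontr)
    assume "q \<noteq> 0"
    then obtain r where r: "r \<in> Q" "r \<noteq> 0" "fixed r" using ex_fixed_vector[OF Q(1) q] by auto
    then obtain v where v: "v \<in> U" "r = norm v" using norms Q(2) by blast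
    obtain w q' where "w \<in> translates I" "q' \<in> Q" "v = w + q'" using Q(3)[OF v(1)] by blast
    then have "r = norm w" using v Q(5) by (simp add: norm.add)
    then have "r \<in> translates I"
      using norm_in_invariant[OF invariant_translates(1)[OF I(2) U] \<open>w \<in> translates I\<close>] by simp
    then show False using r Q(4) by auto
  qed
  then have "U \<subseteq> translates I" using Q(3) by force
  then have "U = translates I" using invariant_translates(2)[OF I(2) U] by auto
  then have "dim U = card (I \<times> carrier G)"
    unfolding translates_def using dim_span_family[OF _ I(3)] I(1) finite_carrier by simp
  then show ?thesis using card by (simp add: card_cartesian_product order_def)
qed

end

section \<open>Projective-free parts of modules over p-groups\<close>

lemma group_algebra_mult:
  assumes "Group.group G" "finite (carrier G)"
  shows "(a \<otimes>\<^bsub>group_algebra G\<^esub> b) g =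
    (if g \<in> carrier G then \<Sum>y\<in>carrier G. a (g \<otimes>\<^bsub>G\<^esub> inv\<^bsub>G\<^esub> y) * b y else 0)"
proof -
  interpret group G by fact
  have "(a \<otimes>\<^bsub>group_algebra G\<^esub> b) g = (\<Sum>y\<in>carrier G. \<Sum>x\<in>carrier G. if x \<otimes>\<^bsub>G\<^esub> y = g then a x * b y else 0)"
    by (simp add: group_algebra_def) (rule sum.swap)
  also have "\<dots> = (\<Sum>y\<in>carrier G. if g \<in> carrier G then a (g \<otimes>\<^bsub>G\<^esub> inv\<^bsub>G\<^esub> y) * b y else 0)"
  proof (rule sum.cong[OF refl])
    fix y assume y: "y \<in> carrier G"
    have "(\<Sum>x\<in>carrier G. if x \<otimes>\<^bsub>G\<^esub> y = g then a x * b y else 0)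
        = (\<Sum>x\<in>carrier G. if x = g \<otimes>\<^bsub>G\<^esub> inv\<^bsub>G\<^esub> y \<and> g \<in> carrier G then a x * b y else 0)"
      using y by (intro sum.cong refl if_cong) (auto simp: m_assoc)
    also have "\<dots> = (if g \<in> carrier G then a (g \<otimes>\<^bsub>G\<^esub> inv\<^bsub>G\<^esub> y) * b y else 0)"
      using y assms(2) by (cases "g \<in> carrier G") simp_all
    finally show "(\<Sum>x\<in>carrier G. if x \<otimes>\<^bsub>G\<^esub> y = g then a x * b y else 0)
      = (if g \<in> carrier G then a (g \<otimes>\<^bsub>G\<^esub> inv\<^bsub>G\<^esub> y) * b y else 0)" .
  qed
  finally show ?thesis by simp
qed

text \<open>
  The dictionary between modules over the group algebra, given as records, and linear actions: the
  submodules of \<open>M\<close> are the invariant subspaces.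
\<close>

locale group_algebra_module = modular_representation scale G act p m
  for scale :: "'f :: field \<Rightarrow> 'v :: ab_group_add \<Rightarrow> 'v" and G :: "('g, 'x) monoid_scheme" (structure) and act p m +
  fixes M :: "('g \<Rightarrow> 'f, 'v) module" and F :: "'v set"
  assumes add_M: "ring.add M = (+)" and zero_M: "ring.zero M = 0"
    and smult_M: "a \<in> carrier (group_algebra G) \<Longrightarrow> v \<in> carrier M \<Longrightarrow>
      a \<odot>\<^bsub>M\<^esub> v = (\<Sum>h\<in>carrier G. scale (a h) (act v h))"
    and invariant_M: "invariant (carrier M)"
    and finite_dim: "finite F" "carrier M \<subseteq> span F"
begin

abbreviation R :: "('g \<Rightarrow> 'f) ring" where "R \<equiv> group_algebra G"

lemma group_elem_closed: "g \<in> carrier G \<Longrightarrow> fun_scale c (group_elem g) \<in> carrier R"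
  by (auto simp: group_algebra_def group_elem_def fun_scale_def)

lemma smult_group_elem:
  assumes "g \<in> carrier G" "v \<in> carrier M"
  shows "fun_scale c (group_elem g) \<odot>\<^bsub>M\<^esub> v = scale c (act v g)"
proof -
  have "fun_scale c (group_elem g) \<odot>\<^bsub>M\<^esub> v = (\<Sum>h\<in>carrier G. if h = g then scale c (act v h) else 0)"
    using smult_M[OF group_elem_closed[OF assms(1)] assms(2)]
    by (auto simp: fun_scale_def group_elem_def intro!: sum.cong)
  then show ?thesis using assms finite_carrier by simp
qed

lemma submodule_iff:
  assumes V: "invariant V" "V \<subseteq> carrier M"
  shows "submodule U R (M\<lparr>carrier := V\<rparr>) \<longleftrightarrow> U \<subseteq> V \<and> invariant U"
proof
  assume "submodule U R (M\<lparr>carrier := V\<rparr>)"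
  then interpret U: submodule U R "M\<lparr>carrier := V\<rparr>" .
  have UV: "U \<subseteq> V" using U.subset by simp
  have sc: "scale c (act u g) \<in> U" if "u \<in> U" "g \<in> carrier G" for c u g
    using U.smult_closed[OF group_elem_closed[OF that(2)] that(1)] smult_group_elem that UV V(2) by auto
  have "subspace U"
  proof (rule subspaceI)
    show "0 \<in> U" using U.one_closed by (simp add: zero_M)
    show "x + y \<in> U" if "x \<in> U" "y \<in> U" for x y using U.m_closed[OF that] by (simp add: add_M)
    show "scale c x \<in> U" if "x \<in> U" for c x using sc[OF that one_closed] by (simp add: act_one)
  qed
  moreover have "act u g \<in> U" if "u \<in> U" "g \<in> carrier G" for u g using sc[OF that, of 1] by simp
  ultimately show "U \<subseteq> V \<and> invariant U" using UV by (auto simp: invariant_def)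
next
  assume U: "U \<subseteq> V \<and> invariant U"
  then have sub: "subspace U" and act: "\<And>u g. u \<in> U \<Longrightarrow> g \<in> carrier G \<Longrightarrow> act u g \<in> U"
    by (auto simp: invariant_def)
  have subV: "subspace V" using V by (simp add: invariant_def)
  have inv: "inv\<^bsub>add_monoid (M\<lparr>carrier := V\<rparr>)\<^esub> x = - x" if "x \<in> V" for x
    unfolding m_inv_def
    by (rule the_equality)
      (use that subspace_neg[OF subV] in \<open>auto simp: add_M zero_M eq_neg_iff_add_eq_0 add.commute\<close>)
  show "submodule U R (M\<lparr>carrier := V\<rparr>)"
  proof (intro submodule.intro subgroup.intro submodule_axioms.intro)
    fix a u assume "a \<in> carrier R" "u \<in> U"
    moreover have "u \<in> carrier M" using \<open>u \<in> U\<close> U V by auto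
    ultimately show "a \<odot>\<^bsub>M\<lparr>carrier := V\<rparr>\<^esub> u \<in> U"
      using smult_M[of a u] sub act by (auto intro!: subspace_sum subspace_scale)
  next
    fix x assume "x \<in> U"
    then show "inv\<^bsub>add_monoid (M\<lparr>carrier := V\<rparr>)\<^esub> x \<in> U"
      using U inv[of x] subspace_neg[OF sub] by auto
  qed (use U sub in \<open>auto simp: add_M zero_M subspace_add subspace_0\<close>)
qed

lemma internal_direct_sum_iff:
  assumes V: "invariant V" "V \<subseteq> carrier M"
  shows "internal_direct_sum R (M\<lparr>carrier := V\<rparr>) U W \<longleftrightarrow>
    invariant U \<and> U \<subseteq> V \<and> invariant W \<and> W \<subseteq> V \<and> U \<inter> W = {0} \<and> (\<forall>v\<in>V. \<exists>u\<in>U. \<exists>w\<in>W. v = u + w)"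
proof -
  have "U <+>\<^bsub>M\<lparr>carrier := V\<rparr>\<^esub> W = {u + w |u w. u \<in> U \<and> w \<in> W}"
    unfolding set_add_def set_mult_def by (auto simp: add_M)
  moreover have "{u + w |u w. u \<in> U \<and> w \<in> W} = V \<longleftrightarrow> (\<forall>v\<in>V. \<exists>u\<in>U. \<exists>w\<in>W. v = u + w)"
    if "U \<subseteq> V" "W \<subseteq> V"
  proof
    assume "{u + w |u w. u \<in> U \<and> w \<in> W} = V"
    then show "\<forall>v\<in>V. \<exists>u\<in>U. \<exists>w\<in>W. v = u + w" by blast
  next
    assume A: "\<forall>v\<in>V. \<exists>u\<in>U. \<exists>w\<in>W. v = u + w"
    have "u + w \<in> V" if "u \<in> U" "w \<in> W" for u w
      using that \<open>U \<subseteq> V\<close> \<open>W \<subseteq> V\<close> V unfolding invariant_def by (auto intro!: subspace_add)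
    then show "{u + w |u w. u \<in> U \<and> w \<in> W} = V" using A by blast
  qed
  ultimately show ?thesis
    unfolding internal_direct_sum_def submodule_iff[OF V] by (auto simp: zero_M)
qed

text \<open>
  The coordinates of a fixed vector \<open>y\<close> of a free module are constant on the group, so that \<open>y\<close> is the
  norm of the vector \<open>z\<close> formed by the coordinates at \<open>1\<close>. If \<open>y\<close> lies in a direct summand \<open>U'\<close>
  with complement \<open>V'\<close>, then the components of \<open>z\<close> in \<open>U'\<close> and \<open>V'\<close> have norms in \<open>U'\<close> and \<open>V'\<close>
  with sum \<open>y\<close>; hence \<open>y\<close> is the norm of the first component.
\<close>

lemma fixed_in_projective_is_norm:
  assumes U: "invariant U" "U \<subseteq> carrier M" and proj: "projective_right_module R (M\<lparr>carrier := U\<rparr>)"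
    and u: "u \<in> U" "fixed u"
  shows "\<exists>v\<in>U. u = norm v"
proof -
  obtain I :: "'v set" and U' V' f where ds: "internal_direct_sum R (free_right_module R I) U' V'"
    and f: "f \<in> module_iso R (M\<lparr>carrier := U\<rparr>) ((free_right_module R I)\<lparr>carrier := U'\<rparr>)"
    using proj unfolding projective_right_module_def by auto
  let ?L = "free_right_module R I"
  have bij: "bij_betw f U U'" and hom: "\<And>r v. r \<in> carrier R \<Longrightarrow> v \<in> U \<Longrightarrow> f (r \<odot>\<^bsub>M\<^esub> v) = r \<odot>\<^bsub>?L\<^esub> f v"
    using f by (auto simp: module_iso_def iso_def)
  interpret U': submodule U' R ?L using ds by (simp add: internal_direct_sum_def)
  interpret V': submodule V' R ?L using ds by (simp add: internal_direct_sum_def)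
  have L: "\<And>r v. r \<odot>\<^bsub>?L\<^esub> v = (\<lambda>i. v i \<otimes>\<^bsub>R\<^esub> r)" "ring.add ?L = (\<lambda>v w i g. v i g + w i g)" "\<zero>\<^bsub>?L\<^esub> = (\<lambda>i g. 0)"
    "carrier ?L = {v. (\<forall>i. v i \<in> carrier R) \<and> (\<forall>i. i \<notin> I \<longrightarrow> v i = (\<lambda>g. 0)) \<and> finite {i. v i \<noteq> (\<lambda>g. 0)}}"
    by (auto simp: free_right_module_def group_algebra_def)
  note mult = group_algebra_mult[OF is_group finite_carrier]
  define n :: "'g \<Rightarrow> 'f" where "n = (\<lambda>g. if g \<in> carrier G then 1 else 0)"
  have n: "n \<in> carrier R" by (simp add: n_def group_algebra_def)
  have smult_n: "n \<odot>\<^bsub>M\<^esub> v = norm v" if "v \<in> U" for v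
    using smult_M[OF n] that U by (auto simp: norm_def n_def intro!: sum.cong)
  let ?y = "f u"
  have y: "?y \<in> U'" using bij u by (auto simp: bij_betw_def)
  have const: "?y i g = ?y i \<one>" if g: "g \<in> carrier G" for i g
  proof -
    have "group_elem g \<odot>\<^bsub>M\<^esub> u = u"
      using smult_group_elem[OF g, of u 1] u U g by (auto simp: fixed_def fun_scale_def)
    then have "?y = group_elem g \<odot>\<^bsub>?L\<^esub> ?y"
      using hom[of "group_elem g" u] group_elem_closed[OF g, of 1] u by (simp add: fun_scale_def)
    then have "?y i g = (?y i \<otimes>\<^bsub>R\<^esub> group_elem g) g" by (simp add: L fun_eq_iff)
    also have "\<dots> = (\<Sum>h\<in>carrier G. if h = g then ?y i (g \<otimes> inv h) else 0)"
      using g unfolding mult by (auto simp: group_elem_def intro!: sum.cong)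
    also have "\<dots> = ?y i \<one>" using g finite_carrier by simp
    finally show ?thesis .
  qed
  define z :: "'v \<Rightarrow> 'g \<Rightarrow> 'f" where "z i = (\<lambda>g. if g = \<one> then ?y i \<one> else 0)" for i
  have yL: "?y \<in> carrier ?L" using y U'.subset by auto
  have "{i. z i \<noteq> (\<lambda>g. 0)} \<subseteq> {i. ?y i \<noteq> (\<lambda>g. 0)}" by (auto simp: z_def fun_eq_iff)
  then have "finite {i. z i \<noteq> (\<lambda>g. 0)}" by (rule finite_subset) (use yL in \<open>simp add: L(4)\<close>)
  moreover have "z i \<in> carrier R" for i by (simp add: z_def group_algebra_def)
  moreover have "z i = (\<lambda>g. 0)" if "i \<notin> I" for i using that yL unfolding L(4) by (auto simp: z_def)
  ultimately have "z \<in> carrier ?L" by (simp add: L(4))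
  moreover have "U' <+>\<^bsub>?L\<^esub> V' = carrier ?L" using ds by (simp add: internal_direct_sum_def)
  ultimately have "z \<in> (\<Union>x\<in>U'. \<Union>x'\<in>V'. {x \<oplus>\<^bsub>?L\<^esub> x'})"
    by (simp add: set_add_def set_mult_def)
  then obtain z1 z2 where z12: "z1 \<in> U'" "z2 \<in> V'" "z = z1 \<oplus>\<^bsub>?L\<^esub> z2"
    by blast
  let ?w1 = "n \<odot>\<^bsub>?L\<^esub> z1" and ?w2 = "n \<odot>\<^bsub>?L\<^esub> z2"
  have w: "?w1 \<in> U'" "?w2 \<in> V'" using U'.smult_closed[OF n z12(1)] V'.smult_closed[OF n z12(2)] by auto
  have "n \<odot>\<^bsub>?L\<^esub> z = ?y"
  proof -
    have "(z i \<otimes>\<^bsub>R\<^esub> n) g = ?y i g" for i g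
    proof (cases "g \<in> carrier G")
      case True
      then have "g \<otimes> inv h = \<one> \<longleftrightarrow> h = g" if "h \<in> carrier G" for h
        using that inv_equality[of g "inv h"] by auto
      then have "(z i \<otimes>\<^bsub>R\<^esub> n) g = (\<Sum>h\<in>carrier G. if h = g then ?y i \<one> else 0)"
        using True unfolding mult by (auto simp: z_def n_def intro!: sum.cong)
      then show ?thesis using True finite_carrier const[OF True] by simp
    next
      case False
      have "?y i \<in> carrier R" using yL unfolding L(4) by auto
      then show ?thesis using False unfolding mult by (simp add: group_algebra_def)
    qed
    then show ?thesis by (simp add: L fun_eq_iff)
  qed
  moreover have "n \<odot>\<^bsub>?L\<^esub> z = ?w1 \<oplus>\<^bsub>?L\<^esub> ?w2"
    unfolding z12(3) L(1,2) mult fun_eq_iff by (auto simp: distrib_right sum.distrib)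
  ultimately have yw: "?y = ?w1 \<oplus>\<^bsub>?L\<^esub> ?w2" by simp
  \<comment> \<open>Closure of \<open>U'\<close> under subtraction is expressed through multiplication by \<open>-1\<close>.\<close>
  have "?w2 = fun_scale (- 1) (group_elem \<one>) \<odot>\<^bsub>?L\<^esub> ?w1 \<oplus>\<^bsub>?L\<^esub> ?y"
  proof -
    have "(a \<otimes>\<^bsub>R\<^esub> fun_scale (- 1) (group_elem \<one>)) g = - a g" if "a \<in> carrier R" for a g
    proof (cases "g \<in> carrier G")
      case True
      then have "(a \<otimes>\<^bsub>R\<^esub> fun_scale (- 1) (group_elem \<one>)) g = (\<Sum>h\<in>carrier G. if h = \<one> then - a g else 0)"
        unfolding mult by (auto simp: fun_scale_def group_elem_def intro!: sum.cong)
      then show ?thesis using finite_carrier by simp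
    next
      case False
      then show ?thesis using that unfolding mult by (simp add: group_algebra_def)
    qed
    moreover have "?w1 i \<in> carrier R" for i using w U'.subset unfolding L(4) by auto
    ultimately show ?thesis using yw by (auto simp: L(1,2) fun_eq_iff)
  qed
  also have "\<dots> \<in> U'"
    using U'.m_closed[of "fun_scale (- 1) (group_elem \<one>) \<odot>\<^bsub>?L\<^esub> ?w1" ?y]
      U'.smult_closed[OF group_elem_closed[OF one_closed, of "- 1"] w(1)] y by simp
  finally have "?w2 \<in> U' \<inter> V'" using w(2) by blast
  then have "?w2 = (\<lambda>i g. 0)"
    using ds unfolding internal_direct_sum_def L(3) by (elim conjE) (simp only: singleton_iff)
  then have yw1: "?y = ?w1" using yw by (simp add: L(2))
  obtain v where v: "v \<in> U" "z1 = f v" using z12(1) bij by (auto simp: bij_betw_def)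
  have "f (norm v) = f u" using hom[OF n v(1)] smult_n[OF v(1)] yw1 v by simp
  moreover have "norm v \<in> U" using norm_in_invariant[OF U(1) v(1)] .
  ultimately have "u = norm v" using bij u(1) by (auto simp: bij_betw_def inj_on_def)
  then show ?thesis using v by auto
qed

lemma free_module_group: "Group.group (add_monoid (free_right_module R (I :: 'i set)))"
proof (rule groupI)
  let ?L = "free_right_module R I"
  fix x assume "x \<in> carrier (add_monoid ?L)"
  then have "(\<lambda>i g. - x i g) \<in> carrier (add_monoid ?L)"
    by (auto simp: free_right_module_def group_algebra_def fun_eq_iff)
  then show "\<exists>y\<in>carrier (add_monoid ?L). y \<otimes>\<^bsub>add_monoid ?L\<^esub> x = \<one>\<^bsub>add_monoid ?L\<^esub>"
    by (intro bexI[of _ "\<lambda>i g. - x i g"]) (auto simp: free_right_module_def group_algebra_def)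
next
  let ?L = "free_right_module R I"
  fix x y assume xy: "x \<in> carrier (add_monoid ?L)" "y \<in> carrier (add_monoid ?L)"
  have "{i. (\<lambda>g. x i g + y i g) \<noteq> (\<lambda>g. 0)} \<subseteq> {i. x i \<noteq> (\<lambda>g. 0)} \<union> {i. y i \<noteq> (\<lambda>g. 0)}"
    by (auto simp: fun_eq_iff)
  moreover have "finite ({i. x i \<noteq> (\<lambda>g. 0)} \<union> {i. y i \<noteq> (\<lambda>g. 0)})"
    using xy by (simp add: free_right_module_def group_algebra_def)
  ultimately have "finite {i. (\<lambda>g. x i g + y i g) \<noteq> (\<lambda>g. 0)}" by (rule finite_subset)
  then show "x \<otimes>\<^bsub>add_monoid ?L\<^esub> y \<in> carrier (add_monoid ?L)"
    using xy by (simp add: free_right_module_def group_algebra_def)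
qed (auto simp: free_right_module_def group_algebra_def add.assoc)

text \<open>
  This exhibits the free module as a direct summand of itself, as the definition of projectivity
  demands.
\<close>

lemma free_module_trivial_sum:
  "internal_direct_sum R (free_right_module R I) (carrier (free_right_module R I)) {\<zero>\<^bsub>free_right_module R I\<^esub>}"
proof -
  let ?L = "free_right_module R I"
  interpret L: Group.group "add_monoid ?L" by (rule free_module_group)
  have closed: "a \<odot>\<^bsub>?L\<^esub> v \<in> carrier ?L" if "a \<in> carrier R" "v \<in> carrier ?L" for a v
  proof -
    have zero: "((\<lambda>g. 0) \<otimes>\<^bsub>R\<^esub> a) = (\<lambda>g. 0)"
      by (simp add: group_algebra_mult[OF is_group finite_carrier] fun_eq_iff)
    have "v i \<otimes>\<^bsub>R\<^esub> a \<in> carrier R" for i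
      using group_algebra_mult[OF is_group finite_carrier, of "v i" a]
      by (simp add: group_algebra_def[of G])
    moreover have "v i \<otimes>\<^bsub>R\<^esub> a = (\<lambda>g. 0)" if "v i = (\<lambda>g. 0)" for i using that zero by simp
    then have "{i. v i \<otimes>\<^bsub>R\<^esub> a \<noteq> (\<lambda>g. 0)} \<subseteq> {i. v i \<noteq> (\<lambda>g. 0)}" by blast
    moreover have "finite {i. v i \<noteq> (\<lambda>g. 0)}" "\<And>i. i \<notin> I \<Longrightarrow> v i = (\<lambda>g. 0)"
      using that by (simp_all add: free_right_module_def group_algebra_def)
    moreover have "\<zero>\<^bsub>R\<^esub> = (\<lambda>g. 0)" by (simp add: group_algebra_def)
    ultimately show ?thesis using zero by (auto simp: free_right_module_def intro: finite_subset)
  qed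
  have zero: "a \<odot>\<^bsub>?L\<^esub> \<zero>\<^bsub>?L\<^esub> = \<zero>\<^bsub>?L\<^esub>" for a
    using group_algebra_mult[OF is_group finite_carrier, of "\<zero>\<^bsub>R\<^esub>" a]
    by (simp add: free_right_module_def fun_eq_iff group_algebra_def[of G])
  have "submodule (carrier ?L) R ?L"
    using L.subgroup_self closed by (intro submodule.intro submodule_axioms.intro) auto
  moreover have "submodule {\<zero>\<^bsub>?L\<^esub>} R ?L"
    using L.triv_subgroup zero by (intro submodule.intro submodule_axioms.intro) auto
  moreover have "carrier ?L <+>\<^bsub>?L\<^esub> {\<zero>\<^bsub>?L\<^esub>} = carrier ?L"
    unfolding set_add_def set_mult_def using L.r_one by auto
  moreover have "carrier ?L \<inter> {\<zero>\<^bsub>?L\<^esub>} = {\<zero>\<^bsub>?L\<^esub>}" using L.one_closed by auto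
  ultimately show ?thesis unfolding internal_direct_sum_def by blast
qed

text \<open>
  As the translates are independent, coordinates give an isomorphism with the free module on \<open>I\<close>.
\<close>

lemma projective_translates:
  assumes I: "finite I" "I \<subseteq> carrier M"
    and ind: "independent_family scale (\<lambda>(u, h). act u h) (I \<times> carrier G)"
  shows "projective_right_module R (M\<lparr>carrier := translates I\<rparr>)"
proof -
  let ?L = "free_right_module R I"
  note mult = group_algebra_mult[OF is_group finite_carrier]
  have L: "\<And>r v. r \<odot>\<^bsub>?L\<^esub> v = (\<lambda>i. v i \<otimes>\<^bsub>R\<^esub> r)" "ring.add ?L = (\<lambda>v w i g. v i g + w i g)"
    "carrier ?L = {v. (\<forall>i. v i \<in> carrier R) \<and> (\<forall>i. i \<notin> I \<longrightarrow> v i = (\<lambda>g. 0)) \<and> finite {i. v i \<noteq> (\<lambda>g. 0)}}"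
    by (auto simp: free_right_module_def group_algebra_def)
  define g where "g v = (\<Sum>u\<in>I. \<Sum>h\<in>carrier G. scale (v u h) (act u h))" for v :: "'v \<Rightarrow> 'g \<Rightarrow> 'f"
  have g_alt: "g v = (\<Sum>x\<in>I \<times> carrier G. scale (v (fst x) (snd x)) ((\<lambda>(u, h). act u h) x))" for v
    unfolding g_def sum.cartesian_product by (simp add: case_prod_unfold)
  have g_add: "g (v \<oplus>\<^bsub>?L\<^esub> w) = g v + g w" for v w
    by (simp add: g_def L(2) scale_left_distrib sum.distrib)
  have W: "translates I \<subseteq> carrier M" using invariant_translates(2)[OF I(2) invariant_M] .
  have g_range: "g v \<in> translates I" for v
    unfolding g_def translates_def by (intro span_sum span_scale span_base) auto
  have g_smult: "g (a \<odot>\<^bsub>?L\<^esub> v) = a \<odot>\<^bsub>M\<^esub> g v" if a: "a \<in> carrier R" for a v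
  proof -
    have "a \<odot>\<^bsub>M\<^esub> g v = (\<Sum>y\<in>carrier G. scale (a y) (act (g v) y))"
      using smult_M[OF a] g_range W by blast
    also have "\<dots> = (\<Sum>y\<in>carrier G. \<Sum>u\<in>I. \<Sum>h\<in>carrier G. scale (a y * v u ((h \<otimes> y) \<otimes> inv y)) (act u (h \<otimes> y)))"
      unfolding g_def by (auto simp: act_sum act_scale act_mult scale_sum_right m_assoc intro!: sum.cong)
    also have "\<dots> = (\<Sum>y\<in>carrier G. \<Sum>u\<in>I. \<Sum>h\<in>carrier G. scale (a y * v u (h \<otimes> inv y)) (act u h))"
      by (intro sum.cong refl sum_mult_right[of _ "\<lambda>h. scale (a _ * v _ (h \<otimes> inv _)) (act _ h)"])
    also have "\<dots> = (\<Sum>u\<in>I. \<Sum>h\<in>carrier G. \<Sum>y\<in>carrier G. scale (a y * v u (h \<otimes> inv y)) (act u h))"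
      by (subst sum.swap, rule sum.cong[OF refl], rule sum.swap)
    also have "\<dots> = g (a \<odot>\<^bsub>?L\<^esub> v)"
      unfolding g_def L(1) by (intro sum.cong refl) (simp add: mult scale_sum_left mult.commute)
    finally show ?thesis by simp
  qed
  have inj: "inj_on g (carrier ?L)"
  proof (rule inj_onI)
    fix v w assume vw: "v \<in> carrier ?L" "w \<in> carrier ?L" "g v = g w"
    then have "(\<Sum>x\<in>I \<times> carrier G. scale (v (fst x) (snd x) - w (fst x) (snd x)) ((\<lambda>(u, h). act u h) x)) = 0"
      by (simp add: g_alt scale_left_diff_distrib sum_subtractf)
    then have "v u h - w u h = 0" if "u \<in> I" "h \<in> carrier G" for u h
      using ind[unfolded independent_family_def, rule_format, of "\<lambda>x. v (fst x) (snd x) - w (fst x) (snd x)" "(u, h)"] that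
      by auto
    moreover have "v u h = w u h" if "u \<notin> I" for u h using that vw unfolding L(3) by auto
    moreover have "v u h = w u h" if "h \<notin> carrier G" for u h using that vw unfolding L(3) by (auto simp: group_algebra_def)
    ultimately show "v = w" unfolding fun_eq_iff by (metis eq_iff_diff_eq_0)
  qed
  have img: "g ` carrier ?L = translates I"
  proof
    show "translates I \<subseteq> g ` carrier ?L"
    proof
      fix w assume "w \<in> translates I"
      then obtain c where c: "w = (\<Sum>x\<in>I \<times> carrier G. scale (c x) ((\<lambda>(u, h). act u h) x))"
        unfolding translates_def using span_family[of "I \<times> carrier G" "\<lambda>(u, h). act u h"] I(1) finite_carrier by auto
      define v where "v u = (\<lambda>h. if u \<in> I \<and> h \<in> carrier G then c (u, h) else 0)" for u
      have "{u. v u \<noteq> (\<lambda>h. 0)} \<subseteq> I" by (auto simp: v_def fun_eq_iff)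
      then have "v \<in> carrier ?L" using I(1) unfolding L(3) by (auto simp: v_def group_algebra_def intro: finite_subset)
      moreover have "g v = w" unfolding g_alt c by (intro sum.cong) (auto simp: v_def)
      ultimately show "w \<in> g ` carrier ?L" by auto
    qed
  qed (use g_range in auto)
  define f where "f = inv_into (carrier ?L) g"
  have fg: "f w \<in> carrier ?L" "g (f w) = w" if "w \<in> translates I" for w
    using that img unfolding f_def by (auto simp: inv_into_into f_inv_into_f)
  have gf: "f (g v) = v" if "v \<in> carrier ?L" for v using that inj by (simp add: f_def)
  interpret LG: Group.group "add_monoid ?L" by (rule free_module_group)
  interpret L: submodule "carrier ?L" R ?L
    using free_module_trivial_sum[of I] by (simp add: internal_direct_sum_def)
  have "bij_betw f (translates I) (carrier ?L)"
    unfolding f_def using bij_betw_inv_into[of g "carrier ?L" "translates I"] inj img by (simp add: bij_betw_def)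
  moreover have "f (w + w') = f w \<oplus>\<^bsub>?L\<^esub> f w'" if "w \<in> translates I" "w' \<in> translates I" for w w'
    using gf[OF L.m_closed[of "f w" "f w'"]] that fg by (simp add: g_add)
  moreover have "f (a \<odot>\<^bsub>M\<^esub> w) = a \<odot>\<^bsub>?L\<^esub> f w" if "a \<in> carrier R" "w \<in> translates I" for a w
    using gf[OF L.smult_closed[of a "f w"]] that fg by (simp add: g_smult)
  ultimately have "f \<in> module_iso R (M\<lparr>carrier := translates I\<rparr>) (?L\<lparr>carrier := carrier ?L\<rparr>)"
    by (auto simp: module_iso_def iso_def hom_def add_M bij_betw_def)
  then show ?thesis
    unfolding projective_right_module_def using free_module_trivial_sum[of I] by blast
qed

text \<open>
  For the existence, split off a free summand with a complement \<open>Q\<close> on which the norm vanishes. A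
  nonzero projective submodule of \<open>Q\<close> would contain a nonzero fixed vector, and this would be a nonzero norm.
  
  Conversely, let \<open>U\<close> and \<open>V\<close> be the summands of any such decomposition. The norm vanishes on \<open>V\<close>,
  because otherwise \<open>V\<close> would have a nonzero free summand. Therefore the norms of \<open>M\<close> are those of \<open>U\<close>,
  and the dimension of \<open>U\<close> is \<open>order G\<close> times the dimension of its space of norms.
\<close>

theorem pr_pf_decomposition_dim:
  shows "\<exists>U V. pr_pf_decomposition R M U V"
    and "pr_pf_decomposition R M U V \<Longrightarrow>
      dim V + order G * dim (norm ` carrier M) = dim (carrier M)"
proof -
  interpret norm: Vector_Spaces.linear scale scale norm by (rule linear_norm)
  have M: "M\<lparr>carrier := carrier M\<rparr> = M" by simp
  note direct = internal_direct_sum_iff[OF invariant_M subset_refl, unfolded M]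
  obtain I Q where I: "finite I" "I \<subseteq> carrier M" "independent_family scale (\<lambda>(u, h). act u h) (I \<times> carrier G)"
    and Q: "invariant Q" "Q \<subseteq> carrier M" "\<And>v. v \<in> carrier M \<Longrightarrow> \<exists>w\<in>translates I. \<exists>q\<in>Q. v = w + q"
      "translates I \<inter> Q = {0}" "\<And>q. q \<in> Q \<Longrightarrow> norm q = 0"
    by (rule free_summand[OF invariant_M finite_dim]) blast
  have "internal_direct_sum R M (translates I) Q"
    unfolding direct using invariant_translates[OF I(2) invariant_M] Q by auto
  moreover have "projective_right_module R (M\<lparr>carrier := translates I\<rparr>)"
    by (rule projective_translates[OF I])
  moreover have "projective_free R (M\<lparr>carrier := Q\<rparr>)"
    unfolding projective_free_def
  proof (intro allI impI, elim conjE)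
    fix U V
    assume ds: "internal_direct_sum R (M\<lparr>carrier := Q\<rparr>) U V"
      and proj: "projective_right_module R (M\<lparr>carrier := Q, carrier := U\<rparr>)"
    have U: "invariant U" "U \<subseteq> Q" using ds unfolding internal_direct_sum_iff[OF Q(1,2)] by auto
    have proj': "projective_right_module R (M\<lparr>carrier := U\<rparr>)" using proj by simp
    have "u = 0" if u: "u \<in> U" for u
    proof (rule ccontr)
      assume "u \<noteq> 0"
      then obtain w where w: "w \<in> U" "w \<noteq> 0" "fixed w" using ex_fixed_vector[OF U(1) u] by auto
      then obtain v where "v \<in> U" "w = norm v"
        using fixed_in_projective_is_norm[OF U(1) _ proj' w(1,3)] U(2) Q(2) by blast
      then show False using Q(5) U(2) w by auto
    qed
    moreover have "0 \<in> U" using U(1) by (simp add: invariant_def subspace_0)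
    ultimately show "U = {\<zero>\<^bsub>M\<lparr>carrier := Q\<rparr>\<^esub>}" by (auto simp: zero_M)
  qed
  ultimately show "\<exists>U V. pr_pf_decomposition R M U V" unfolding pr_pf_decomposition_def by blast
  assume "pr_pf_decomposition R M U V"
  then have ds: "internal_direct_sum R M U V" and proj: "projective_right_module R (M\<lparr>carrier := U\<rparr>)"
    and pf: "projective_free R (M\<lparr>carrier := V\<rparr>)" unfolding pr_pf_decomposition_def by auto
  have UV: "invariant U" "U \<subseteq> carrier M" "invariant V" "V \<subseteq> carrier M" "U \<inter> V = {0}"
    "\<And>v. v \<in> carrier M \<Longrightarrow> \<exists>u\<in>U. \<exists>w\<in>V. v = u + w"
    using ds unfolding direct by auto
  have finV: "V \<subseteq> span F" and finU: "U \<subseteq> span F" using UV finite_dim by auto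
  have normV: "norm v = 0" if v: "v \<in> V" for v
  proof -
    obtain J T where J: "finite J" "J \<subseteq> V" "independent_family scale (\<lambda>(u, h). act u h) (J \<times> carrier G)"
      and T: "invariant T" "T \<subseteq> V" "\<And>v. v \<in> V \<Longrightarrow> \<exists>w\<in>translates J. \<exists>q\<in>T. v = w + q"
        "translates J \<inter> T = {0}" "\<And>q. q \<in> T \<Longrightarrow> norm q = 0"
      by (rule free_summand[OF UV(3) finite_dim(1) finV]) blast
    have "internal_direct_sum R (M\<lparr>carrier := V\<rparr>) (translates J) T"
      unfolding internal_direct_sum_iff[OF UV(3,4)] using invariant_translates[OF J(2) UV(3)] T by auto
    moreover have "projective_right_module R (M\<lparr>carrier := V, carrier := translates J\<rparr>)"
      using projective_translates[OF J(1) _ J(3)] J(2) UV(4) by simp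
    ultimately have "translates J = {0}" using pf unfolding projective_free_def by (auto simp: zero_M)
    then show ?thesis using T(3)[OF v] T(5) by auto
  qed
  have "norm ` carrier M = norm ` U"
  proof
    show "norm ` carrier M \<subseteq> norm ` U"
    proof clarify
      fix v assume "v \<in> carrier M"
      then obtain u w where "u \<in> U" "w \<in> V" "v = u + w" using UV(6) by blast
      then show "norm v \<in> norm ` U" using normV by (simp add: norm.add)
    qed
  qed (use UV(2) in auto)
  moreover have "dim U = order G * dim (norm ` U)"
    by (rule dim_if_fixed_are_norms[OF UV(1) finite_dim(1) finU])
       (rule fixed_in_projective_is_norm[OF UV(1,2) proj])
  moreover have "dim (carrier M) = dim U + dim V"
    using UV by (intro dim_direct_sum[OF _ _ _ _ _ _ finite_dim]) (auto simp: invariant_def)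
  ultimately show "dim V + order G * dim (norm ` carrier M) = dim (carrier M)" by simp
qed

end

section \<open>Words and shuffles\<close>

text \<open>
  The coefficient of the word \<open>w\<close> in the left-normed bracket \<open>[\<dots>[[v\<^sub>1, v\<^sub>2], v\<^sub>3], \<dots>, v\<^sub>n]\<close> of the letters of
  \<open>v\<close>: bracketing with a last letter \<open>y\<close> appends \<open>y\<close> to each word and subtracts the same word with \<open>y\<close>
  in front.
\<close>

function lie_coeff :: "'a list \<Rightarrow> 'a list \<Rightarrow> 'f :: field" where
  "lie_coeff w v =
     (if length w \<le> 1 then (if v = w then 1 else 0)
      else if v = [] then 0
      else (if last w = last v then lie_coeff (butlast w) (butlast v) else 0)
         - (if hd w = last v then lie_coeff (tl w) (butlast v) else 0))"
  by pat_completeness auto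
termination by (relation "measure (\<lambda>(w, v). length w)") auto

declare lie_coeff.simps [simp del]

lemma lie_coeff_short: "length w \<le> 1 \<Longrightarrow> lie_coeff w v = (if v = w then 1 else 0)"
  by (subst lie_coeff.simps) simp

lemma lie_coeff_Nil: "length w \<ge> 2 \<Longrightarrow> lie_coeff w [] = 0"
  by (subst lie_coeff.simps) simp

lemma lie_coeff_snoc:
  "length w \<ge> 2 \<Longrightarrow> lie_coeff w (z @ [y]) =
    (if last w = y then lie_coeff (butlast w) z else 0) - (if hd w = y then lie_coeff (tl w) z else 0)"
  by (subst lie_coeff.simps) simp

lemma mset_eq_if_lie_coeff_nonzero: "lie_coeff w v \<noteq> (0 :: 'f :: field) \<Longrightarrow> mset v = mset w"
proof (induction "length w" arbitrary: w v rule: less_induct)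
  case less
  show ?case
  proof (cases "length w \<le> 1")
    case True
    then show ?thesis using less.prems lie_coeff_short[OF True, of v] by (auto split: if_splits)
  next
    case False
    then have w2: "length w \<ge> 2" by simp
    have "v \<noteq> []" using less.prems lie_coeff_Nil[OF w2] by auto
    then obtain z y where v: "v = z @ [y]" by (cases v rule: rev_cases) auto
    have "w \<noteq> []" using w2 by auto
    from less.prems consider "last w = y" "lie_coeff (butlast w) z \<noteq> (0 :: 'f)" | "hd w = y" "lie_coeff (tl w) z \<noteq> (0 :: 'f)"
      unfolding v lie_coeff_snoc[OF w2] by (cases "lie_coeff (butlast w) z = (0 :: 'f)") (auto split: if_splits)
    then show ?thesis
    proof cases
      case 1
      then have "mset z = mset (butlast w)" using less.hyps[of "butlast w" z] w2 by simp
      moreover have "mset w = mset (butlast w @ [last w])" using \<open>w \<noteq> []\<close> by simp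
      ultimately show ?thesis using 1 v by simp
    next
      case 2
      then have "mset z = mset (tl w)" using less.hyps[of "tl w" z] w2 by simp
      moreover have "mset w = mset (hd w # tl w)" using \<open>w \<noteq> []\<close> by simp
      ultimately show ?thesis using 2 v by simp
    qed
  qed
qed

lemma lie_coeff_map: "inj h \<Longrightarrow> lie_coeff (map h w) (map h v) = (lie_coeff w v :: 'f :: field)"
proof (induction "length w" arbitrary: w v rule: less_induct)
  case less
  show ?case
  proof (cases "length w \<le> 1")
    case True
    then show ?thesis using less.prems by (simp add: lie_coeff_short inj_map_eq_map)
  next
    case False
    then have w2: "length w \<ge> 2" "length (map h w) \<ge> 2" "w \<noteq> []" by auto
    show ?thesis
    proof (cases v rule: rev_cases)
      case Nil
      then show ?thesis using w2 by (simp add: lie_coeff_Nil)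
    next
      case (snoc z y)
      have "lie_coeff (butlast (map h w)) (map h z) = (lie_coeff (butlast w) z :: 'f)"
        "lie_coeff (tl (map h w)) (map h z) = (lie_coeff (tl w) z :: 'f)"
        using less.hyps[of "butlast w" z] less.hyps[of "tl w" z] less.prems w2
        by (simp_all add: map_butlast map_tl)
      then show ?thesis
        using w2 less.prems by (simp add: snoc lie_coeff_snoc last_map hd_map inj_eq)
    qed
  qed
qed

text \<open>
  Among the words in the expansion of the bracket of \<open>x # t\<close>, only the one that arises by appending all
  letters starts with \<open>x\<close>.
\<close>

lemma lie_coeff_same_head:
  "distinct (x # s) \<Longrightarrow> distinct (x # t) \<Longrightarrow> lie_coeff (x # s) (x # t) = (if s = t then 1 else 0 :: 'f :: field)"
proof (induction s arbitrary: t rule: rev_induct)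
  case Nil
  then show ?case by (simp add: lie_coeff_short)
next
  case (snoc a s)
  have w2: "length (x # s @ [a]) \<ge> 2" by simp
  show ?case
  proof (cases t rule: rev_cases)
    case Nil
    have "lie_coeff (x # s @ [a]) [x] = (0 :: 'f)"
      using mset_eq_if_lie_coeff_nonzero[of "x # s @ [a]" "[x]"] by auto
    then show ?thesis using Nil by simp
  next
    case t: (snoc t' y)
    have "lie_coeff (x # s) (x # t') = (if s = t' then 1 else 0 :: 'f)"
      using snoc.IH[of t'] snoc.prems t by simp
    moreover have "x \<noteq> y" using snoc.prems t by auto
    moreover have "butlast (x # s @ [a]) = x # s" "last (x # s @ [a]) = a"
      using butlast_snoc[of "x # s" a] last_snoc[of "x # s" a] by auto
    ultimately show ?thesis
      using lie_coeff_snoc[OF w2, of "x # t'" y] t by auto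
  qed
qed

lemma snoc_in_shuffles: "w \<in> shuffles u v \<Longrightarrow> w @ [a] \<in> shuffles (u @ [a]) v"
proof (induction w arbitrary: u v)
  case (Cons x w)
  then consider "u \<noteq> []" "hd u = x" "w \<in> shuffles (tl u) v" | "v \<noteq> []" "hd v = x" "w \<in> shuffles u (tl v)"
    by (auto simp: Cons_in_shuffles_iff)
  then show ?case using Cons.IH by cases (auto simp: Cons_in_shuffles_iff)
qed auto

lemma rev_in_shuffles: "w \<in> shuffles u v \<Longrightarrow> rev w \<in> shuffles (rev u) (rev v)"
proof (induction w arbitrary: u v)
  case (Cons x w)
  then consider u' where "u = x # u'" "w \<in> shuffles u' v" | v' where "v = x # v'" "w \<in> shuffles u v'"
    by (cases u; cases v) (auto simp: Cons_in_shuffles_iff)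
  then show ?case
  proof cases
    case 1
    then have "rev w @ [x] \<in> shuffles (rev u' @ [x]) (rev v)"
      using Cons.IH[of u' v] snoc_in_shuffles[of "rev w" "rev u'" "rev v" x] by simp
    then show ?thesis using 1 by simp
  next
    case 2
    then have "rev w @ [x] \<in> shuffles (rev v' @ [x]) (rev u)"
      using Cons.IH[of u v'] snoc_in_shuffles[of "rev w" "rev v'" "rev u" x] shuffles_commutes[of "rev u"] by simp
    then show ?thesis using 2 shuffles_commutes[of "rev u"] by simp
  qed
qed auto

lemma sum_shuffles_rev: "(\<Sum>w\<in>shuffles u v. f w) = (\<Sum>w\<in>shuffles (rev u) (rev v). f (rev w))"
  using rev_in_shuffles[of _ u v] rev_in_shuffles[of _ "rev u" "rev v"]
  by (intro sum.reindex_bij_witness[where i = rev and j = rev]) auto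

lemma sum_shuffles_head:
  fixes f :: "'a list \<Rightarrow> 'f :: field"
  assumes "u \<noteq> []" "v \<noteq> []" "hd u \<noteq> hd v"
  shows "(\<Sum>w\<in>shuffles u v. if hd w = y then f (tl w) else 0) =
    (if hd u = y then \<Sum>w\<in>shuffles (tl u) v. f w else 0) + (if hd v = y then \<Sum>w\<in>shuffles u (tl v). f w else 0)"
proof -
  obtain a u' b v' where uv: "u = a # u'" "v = b # v'" "a \<noteq> b" using assms by (cases u; cases v) auto
  have "(\<Sum>w\<in>shuffles u v. if hd w = y then f (tl w) else 0) =
    (\<Sum>w\<in>(#) a ` shuffles u' v. if hd w = y then f (tl w) else 0) + (\<Sum>w\<in>(#) b ` shuffles u v'. if hd w = y then f (tl w) else 0)"
    unfolding uv shuffles.simps by (rule sum.union_disjoint) (use uv in auto)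
  then show ?thesis by (simp add: sum.reindex uv)
qed

lemma sum_shuffles_last:
  fixes f :: "'a list \<Rightarrow> 'f :: field"
  assumes "u \<noteq> []" "v \<noteq> []" "last u \<noteq> last v"
  shows "(\<Sum>w\<in>shuffles u v. if last w = y then f (butlast w) else 0) =
    (if last u = y then \<Sum>w\<in>shuffles (butlast u) v. f w else 0) + (if last v = y then \<Sum>w\<in>shuffles u (butlast v). f w else 0)"
proof -
  have ne: "rev u \<noteq> []" "rev v \<noteq> []" "hd (rev u) \<noteq> hd (rev v)" using assms by (auto simp: hd_rev)
  have wne: "w \<noteq> []" if "w \<in> shuffles (rev u) (rev v)" for w using that assms by auto
  have "(\<Sum>w\<in>shuffles u v. if last w = y then f (butlast w) else 0) =
    (\<Sum>w\<in>shuffles (rev u) (rev v). if hd w = y then (f \<circ> rev) (tl w) else 0)"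
    by (subst sum_shuffles_rev, intro sum.cong refl) (auto simp: last_rev wne butlast_rev)
  also have "\<dots> = (if last u = y then \<Sum>w\<in>shuffles (rev (butlast u)) (rev v). f (rev w) else 0)
      + (if last v = y then \<Sum>w\<in>shuffles (rev u) (rev (butlast v)). f (rev w) else 0)"
  proof -
    have "tl (rev u) = rev (butlast u)" "tl (rev v) = rev (butlast v)"
      using butlast_rev[of "rev u"] butlast_rev[of "rev v"] by auto
    then show ?thesis using sum_shuffles_head[OF ne, of y "f \<circ> rev"] assms by (simp add: hd_rev)
  qed
  finally show ?thesis by (simp add: sum_shuffles_rev[of f "butlast u" v] sum_shuffles_rev[of f u "butlast v"])
qed

text \<open>
  This is the orthogonality of Lie elements and proper shuffles. Separating the last letter \<open>y\<close> of \<open>z\<close>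
  leaves sums over the shuffles in which one of the two words has lost its last or its first letter
  \<open>y\<close>. These vanish by induction, unless the shortened word is empty; but then \<open>y\<close> was both the first
  and the last letter, and the two remaining terms cancel.
\<close>

theorem lie_coeff_shuffle:
  "u \<noteq> [] \<Longrightarrow> v \<noteq> [] \<Longrightarrow> distinct (u @ v) \<Longrightarrow> (\<Sum>w\<in>shuffles u v. lie_coeff w z) = (0 :: 'f :: field)"
proof (induction "length u + length v" arbitrary: u v z rule: less_induct)
  case less
  have len: "length w \<ge> 2" if "w \<in> shuffles u v" for w
    using length_shuffles[OF that] less.prems(1,2) by (cases u; cases v) auto
  show ?case
  proof (cases z rule: rev_cases)
    case Nil
    then show ?thesis using len by (simp add: lie_coeff_Nil)
  next
    case (snoc z' y)
    have hl: "hd u \<in> set u" "hd v \<in> set v" "last u \<in> set u" "last v \<in> set v" "set u \<inter> set v = {}"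
      using less.prems by auto
    then have hd: "hd u \<noteq> hd v" and last: "last u \<noteq> last v" and cross: "hd u \<noteq> last v" "hd v \<noteq> last u"
      by (metis disjoint_iff)+
    have IH: "(\<Sum>w\<in>shuffles u' v'. lie_coeff w z') = (0 :: 'f)"
      if "length u' + length v' < length u + length v" "distinct (u' @ v')" "u' \<noteq> []" "v' \<noteq> []" for u' v'
      using less.hyps[of u' v' z'] that by blast
    \<comment> \<open>The induction hypothesis applies unless the shortened word is empty.\<close>
    have B: "(\<Sum>w\<in>shuffles (butlast u) v. lie_coeff w z') = (if butlast u = [] then lie_coeff v z' else 0 :: 'f)"
      "(\<Sum>w\<in>shuffles (tl u) v. lie_coeff w z') = (if tl u = [] then lie_coeff v z' else 0 :: 'f)"
      "(\<Sum>w\<in>shuffles u (butlast v). lie_coeff w z') = (if butlast v = [] then lie_coeff u z' else 0 :: 'f)"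
      "(\<Sum>w\<in>shuffles u (tl v). lie_coeff w z') = (if tl v = [] then lie_coeff u z' else 0 :: 'f)"
    proof -
      have sub: "set (butlast u) \<subseteq> set u" "set (tl u) \<subseteq> set u" "set (butlast v) \<subseteq> set v" "set (tl v) \<subseteq> set v"
        by (auto dest: in_set_butlastD) (cases u; cases v; auto)+
      have d: "distinct (butlast u @ v)" "distinct (tl u @ v)" "distinct (u @ butlast v)" "distinct (u @ tl v)"
        using less.prems sub by (simp_all add: distinct_butlast distinct_tl; blast)+
      have l: "0 < length u" "0 < length v" using less.prems by auto
      show "(\<Sum>w\<in>shuffles (butlast u) v. lie_coeff w z') = (if butlast u = [] then lie_coeff v z' else 0 :: 'f)"
        using IH[OF _ d(1)] less.prems l by (cases "butlast u = []") simp_all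
      show "(\<Sum>w\<in>shuffles (tl u) v. lie_coeff w z') = (if tl u = [] then lie_coeff v z' else 0 :: 'f)"
        using IH[OF _ d(2)] less.prems l by (cases "tl u = []") simp_all
      show "(\<Sum>w\<in>shuffles u (butlast v). lie_coeff w z') = (if butlast v = [] then lie_coeff u z' else 0 :: 'f)"
        using IH[OF _ d(3)] less.prems l by (cases "butlast v = []") simp_all
      show "(\<Sum>w\<in>shuffles u (tl v). lie_coeff w z') = (if tl v = [] then lie_coeff u z' else 0 :: 'f)"
        using IH[OF _ d(4)] less.prems l by (cases "tl v = []") simp_all
    qed
    have "(\<Sum>w\<in>shuffles u v. lie_coeff w z) =
      (\<Sum>w\<in>shuffles u v. if last w = y then lie_coeff (butlast w) z' else 0)
      - (\<Sum>w\<in>shuffles u v. if hd w = y then lie_coeff (tl w) z' else (0 :: 'f))"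
      unfolding snoc sum_subtractf[symmetric] by (intro sum.cong refl lie_coeff_snoc len)
    also have "\<dots> = 0"
    proof -
      have "butlast u = [] \<longleftrightarrow> tl u = []" "butlast v = [] \<longleftrightarrow> tl v = []"
        "tl u = [] \<Longrightarrow> hd u = last u" "tl v = [] \<Longrightarrow> hd v = last v"
        using less.prems(1,2) by (cases u; cases v; auto)+
      then show ?thesis
        unfolding sum_shuffles_head[OF less.prems(1,2) hd, of y "\<lambda>w. lie_coeff w z'"]
          sum_shuffles_last[OF less.prems(1,2) last, of y "\<lambda>w. lie_coeff w z'"] B
        by auto
    qed
    finally show ?thesis .
  qed
qed

section \<open>Interleavings\<close>

text \<open>
  For words without common letters this is the shuffle product of all words of \<open>V\<close>.
\<close>

definition interleavings :: "'a list set \<Rightarrow> 'a list set" where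
  "interleavings V = {w. distinct w \<and> set w = (\<Union>u\<in>V. set u) \<and> (\<forall>u\<in>V. filter (\<lambda>x. x \<in> set u) w = u)}"

lemma filter_id: "filter (\<lambda>x. x \<in> set w) w = w"
  by (rule filter_True) simp

lemma interleavings_single:
  assumes "distinct w"
  shows "interleavings {w} = {w}"
proof -
  have "v = w" if "set v = set w" "filter (\<lambda>x. x \<in> set w) v = w" for v
    using that filter_id[of v] by simp
  then show ?thesis using assms by (auto simp: interleavings_def filter_id)
qed

lemma interleavings_pair:
  assumes "distinct (a @ b)"
  shows "interleavings {a, b} = shuffles a b"
proof
  show "interleavings {a, b} \<subseteq> shuffles a b"
  proof
    fix w assume w: "w \<in> interleavings {a, b}"
    then have "filter (\<lambda>x. x \<notin> set a) w = filter (\<lambda>x. x \<in> set b) w"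
      using assms by (intro filter_cong) (auto simp: interleavings_def)
    then show "w \<in> shuffles a b"
      using partition_in_shuffles[of w "\<lambda>x. x \<in> set a"] w by (auto simp: interleavings_def)
  qed
  show "shuffles a b \<subseteq> interleavings {a, b}"
    using assms distinct_disjoint_shuffles[of a b] set_shuffles[of _ a b]
      filter_shuffles_disjoint1[of a b] filter_shuffles_disjoint2[of a b]
    by (auto simp: interleavings_def)
qed

definition shuffle_sum :: "'a list set \<Rightarrow> 'a list \<Rightarrow> 'f :: field" where
  "shuffle_sum V = (\<lambda>w. if w \<in> interleavings V then 1 else 0)"

lemma finite_interleavings:
  assumes "finite V"
  shows "finite (interleavings V)"
  by (rule finite_subset[OF _ finite_subset_distinct[of "\<Union>u\<in>V. set u"]])
     (use assms in \<open>auto simp: interleavings_def\<close>)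

text \<open>
  Shuffling is associative: an interleaving of \<open>V \<union> W\<close> restricts to exactly one interleaving of \<open>V\<close>,
  and is an interleaving of this word with \<open>W\<close>.
\<close>

lemma shuffle_sum_Un:
  assumes "finite V"
  shows "shuffle_sum (V \<union> W) = (\<Sum>t\<in>interleavings V. shuffle_sum (insert t W) :: 'a list \<Rightarrow> 'f :: field)"
proof
  fix w
  let ?S = "\<Union>u\<in>V. set u"
  let ?t = "filter (\<lambda>x. x \<in> ?S) w"
  have t: "t = ?t" if "t \<in> interleavings V" "w \<in> interleavings (insert t W)" for t
    using that by (auto simp: interleavings_def)
  have ff: "filter (\<lambda>x. x \<in> set u) ?t = filter (\<lambda>x. x \<in> set u) w" if "u \<in> V" for u
    unfolding filter_filter using that by (intro filter_cong) auto
  have "w \<in> interleavings (V \<union> W) \<longleftrightarrow> ?t \<in> interleavings V \<and> w \<in> interleavings (insert ?t W)"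
  proof
    assume w: "w \<in> interleavings (V \<union> W)"
    then have set: "set w = ?S \<union> (\<Union>u\<in>W. set u)" by (auto simp: interleavings_def)
    then have st: "set ?t = ?S" by auto
    have "?t \<in> interleavings V" using w ff st by (simp add: interleavings_def)
    moreover have "w \<in> interleavings (insert ?t W)"
    proof -
      have ft: "filter (\<lambda>x. x \<in> set ?t) w = ?t" unfolding st by (rule refl)
      have w': "distinct w" "\<And>u. u \<in> W \<Longrightarrow> filter (\<lambda>x. x \<in> set u) w = u"
        using w by (auto simp: interleavings_def)
      have "set w = (\<Union>u\<in>insert ?t W. set u)" using set st by simp
      moreover have "filter (\<lambda>x. x \<in> set u) w = u" if "u \<in> insert ?t W" for u
        using that ft w'(2) by blast
      ultimately show ?thesis using w'(1) unfolding interleavings_def by blast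
    qed
    ultimately show "?t \<in> interleavings V \<and> w \<in> interleavings (insert ?t W)" by blast
  next
    assume w: "?t \<in> interleavings V \<and> w \<in> interleavings (insert ?t W)"
    then have st: "set ?t = ?S" and sw: "set w = (\<Union>u\<in>insert ?t W. set u)"
      and d: "distinct w" and fV: "\<And>u. u \<in> V \<Longrightarrow> filter (\<lambda>x. x \<in> set u) ?t = u"
      and fW: "\<And>u. u \<in> W \<Longrightarrow> filter (\<lambda>x. x \<in> set u) w = u"
      unfolding interleavings_def by blast+
    have "set w = (\<Union>u\<in>V \<union> W. set u)" unfolding sw UN_insert st by blast
    moreover have "filter (\<lambda>x. x \<in> set u) w = u" if "u \<in> V \<union> W" for u
      using that fV fW ff by (metis Un_iff)
    ultimately show "w \<in> interleavings (V \<union> W)" using d unfolding interleavings_def by blast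
  qed
  then have "shuffle_sum (V \<union> W) w = (if ?t \<in> interleavings V then shuffle_sum (insert ?t W) w else 0 :: 'f)"
    by (simp add: shuffle_sum_def)
  also have "\<dots> = (\<Sum>t\<in>interleavings V. if t = ?t then shuffle_sum (insert t W) w else 0)"
    using finite_interleavings[OF assms] by simp
  also have "\<dots> = (\<Sum>t\<in>interleavings V. shuffle_sum (insert t W) w)"
    using t by (intro sum.cong) (auto simp: shuffle_sum_def)
  finally show "shuffle_sum (V \<union> W) w = (\<Sum>t\<in>interleavings V. shuffle_sum (insert t W) :: 'a list \<Rightarrow> 'f) w"
    by (simp add: sum_fun_apply)
qed

lemma shuffle_sum_single: "distinct w \<Longrightarrow> shuffle_sum {w} = group_elem w"
  by (auto simp: shuffle_sum_def interleavings_single group_elem_def fun_eq_iff)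

text \<open>
  A shuffle of \<open>a\<close> and \<open>x # b\<close> different from \<open>a @ x # b\<close> has \<open>x\<close> in front of some letter of \<open>a\<close>. All
  rewriting of words by means of shuffles terminates for this reason.
\<close>

lemma shuffles_pos_less:
  assumes "distinct (a @ x # b)" "t \<in> shuffles a (x # b)" "t \<noteq> a @ x # b"
  shows "length (takeWhile (\<lambda>y. y \<noteq> x) t) < length a"
proof -
  have t: "filter (\<lambda>y. y \<in> set a) t = a" "filter (\<lambda>y. y \<notin> set a) t = x # b"
    using filter_shuffles_disjoint1[of a "x # b" t] assms by auto
  have "x \<in> set t" using set_shuffles[OF assms(2)] by auto
  then obtain c e where ce: "t = c @ x # e" "x \<notin> set c" by (metis split_list_first)
  have tw: "takeWhile (\<lambda>y. y \<noteq> x) t = c"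
    unfolding ce(1) using ce(2) by (subst takeWhile_append2) auto
  have "x \<notin> set a" using assms(1) by auto
  have nil: "filter (\<lambda>y. y \<notin> set a) c = []"
  proof (cases "filter (\<lambda>y. y \<notin> set a) c")
    case (Cons z zs)
    then have "z = x" using t(2) unfolding ce(1) by simp
    moreover have "z \<in> set c" using Cons by (metis filter_is_subset list.set_intros(1) subsetD)
    ultimately show ?thesis using ce(2) by simp
  qed
  then have fc: "filter (\<lambda>y. y \<in> set a) c = c" by (intro filter_True) (auto simp: filter_empty_conv)
  have a: "a = c @ filter (\<lambda>y. y \<in> set a) e" using t(1) fc \<open>x \<notin> set a\<close> unfolding ce(1) by simp
  have "filter (\<lambda>y. y \<in> set a) e \<noteq> []"
  proof
    assume e0: "filter (\<lambda>y. y \<in> set a) e = []"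
    then have "a = c" using a by simp
    moreover have "filter (\<lambda>y. y \<notin> set a) e = e" using e0 by (intro filter_True) (auto simp: filter_empty_conv)
    then have "e = b" using t(2) nil \<open>x \<notin> set a\<close> unfolding ce(1) by simp
    ultimately show False using assms(3) ce by simp
  qed
  then have "length c < length (c @ filter (\<lambda>y. y \<in> set a) e)" by simp
  then show ?thesis using tw a by simp
qed

section \<open>Cuttings of an alphabet with marked letters\<close>

text \<open>
  The transpose of the left-normed bracketing of words with letters \<open>Z\<close>.
\<close>

definition lie_map :: "'a set \<Rightarrow> ('a list \<Rightarrow> 'f :: field) \<Rightarrow> 'a list \<Rightarrow> 'f" where
  "lie_map Z f v = (\<Sum>w\<in>permutations_of_set Z. f w * lie_coeff w v)"

lemma linear_lie_map: "Vector_Spaces.linear fun_scale fun_scale (lie_map Z)"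
proof unfold_locales
  show "lie_map Z (f + g) = lie_map Z f + lie_map Z g" "lie_map Z (fun_scale c f) = fun_scale c (lie_map Z f)" for f g c
    by (auto simp: lie_map_def fun_eq_iff fun_scale_def distrib_right sum.distrib sum_distrib_left mult.assoc)
qed

interpretation lie_map: Vector_Spaces.linear fun_scale fun_scale "lie_map Z" for Z
  by (rule linear_lie_map)

lemma lie_map_indicator:
  assumes "finite Z" "S \<subseteq> permutations_of_set Z"
  shows "lie_map Z (\<lambda>w. if w \<in> S then 1 else 0) v = (\<Sum>w\<in>S. lie_coeff w v)"
proof -
  have "lie_map Z (\<lambda>w. if w \<in> S then 1 else 0) v = (\<Sum>w\<in>permutations_of_set Z. if w \<in> S then lie_coeff w v else 0)"
    unfolding lie_map_def by (intro sum.cong) auto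
  also have "\<dots> = (\<Sum>w\<in>permutations_of_set Z \<inter> S. lie_coeff w v)"
    using assms by (simp add: sum.inter_restrict)
  finally show ?thesis using assms(2) by (simp add: Int_absorb1)
qed

lemma lie_map_group_elem:
  assumes "finite Z" "w \<in> permutations_of_set Z"
  shows "lie_map Z (group_elem w) = (lie_coeff w :: 'a list \<Rightarrow> 'f :: field)"
proof
  fix v
  show "lie_map Z (group_elem w) v = (lie_coeff w v :: 'f)"
    using lie_map_indicator[OF assms(1), of "{w}" v, where ?'b = 'f] assms(2) by (simp add: group_elem_def)
qed

lemma append_in_shuffles: "a @ b \<in> shuffles a b"
  by (induction a) (auto simp: Cons_in_shuffles_iff)

lemma shuffles_subset_permutations:
  assumes "distinct (a @ b)" "set a \<union> set b = Z"
  shows "shuffles a b \<subseteq> permutations_of_set Z"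
  using assms distinct_disjoint_shuffles[of a b] set_shuffles[of _ a b] by (auto simp: permutations_of_set_def)

text \<open>
  For \<open>w = a @ x # b\<close> with \<open>a\<close> nonempty, \<open>lie_coeff_shuffle\<close> expresses \<open>lie_coeff w\<close> by the other
  shuffles of \<open>a\<close> and \<open>x # b\<close>, in which \<open>x\<close> is nearer to the front.
\<close>

lemma lie_coeff_in_span:
  assumes "finite Z" "x \<in> Z" "w \<in> permutations_of_set Z"
  shows "lie_coeff w \<in> fun_space.span ((lie_coeff :: _ \<Rightarrow> _ \<Rightarrow> 'f :: field) ` {w \<in> permutations_of_set Z. hd w = x})"
    (is "_ \<in> ?S")
  using assms(3)
proof (induction "length (takeWhile (\<lambda>y. y \<noteq> x) w)" arbitrary: w rule: less_induct)
  case less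
  have w: "distinct w" "set w = Z" using less.prems by (auto simp: permutations_of_set_def)
  then obtain a b where ab: "w = a @ x # b" "x \<notin> set a" using assms(2) by (metis split_list_first)
  show ?case
  proof (cases "a = []")
    case True
    then show ?thesis using less.prems ab by (intro fun_space.span_base) auto
  next
    case False
    have dist: "distinct (a @ x # b)" using w ab by simp
    have tw: "length (takeWhile (\<lambda>y. y \<noteq> x) w) = length a"
      unfolding ab(1) using ab(2) by (subst takeWhile_append2) auto
    have win: "w \<in> shuffles a (x # b)"
      using append_in_shuffles[of a "x # b"] ab(1) by simp
    have "(\<Sum>t\<in>shuffles a (x # b). (lie_coeff t :: _ \<Rightarrow> 'f)) = 0"
      using lie_coeff_shuffle[OF False _ dist] by (auto simp: fun_eq_iff sum_fun_apply)
    then have "lie_coeff w + (\<Sum>t\<in>shuffles a (x # b) - {w}. (lie_coeff t :: _ \<Rightarrow> 'f)) = 0"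
      using win by (simp add: sum.remove[of _ w])
    then have eq: "lie_coeff w = - (\<Sum>t\<in>shuffles a (x # b) - {w}. (lie_coeff t :: _ \<Rightarrow> 'f))"
      by (simp add: eq_neg_iff_add_eq_0)
    have "lie_coeff t \<in> ?S" if "t \<in> shuffles a (x # b) - {w}" for t
    proof (rule less.hyps)
      show "length (takeWhile (\<lambda>y. y \<noteq> x) t) < length (takeWhile (\<lambda>y. y \<noteq> x) w)"
        using shuffles_pos_less[OF dist, of t] that ab tw by auto
      show "t \<in> permutations_of_set Z"
        using shuffles_subset_permutations[OF dist, of Z] that ab w by auto
    qed
    then show ?thesis unfolding eq by (intro fun_space.span_neg fun_space.span_sum)
  qed
qed

lemma card_permutations_with_head:
  assumes "finite Z" "x \<in> Z"
  shows "card {w \<in> permutations_of_set Z. hd w = x} = fact (card Z - 1)"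
proof -
  have "{w \<in> permutations_of_set Z. hd w = x} = (#) x ` permutations_of_set (Z - {x})"
  proof
    show "{w \<in> permutations_of_set Z. hd w = x} \<subseteq> (#) x ` permutations_of_set (Z - {x})"
    proof
      fix w assume w: "w \<in> {w \<in> permutations_of_set Z. hd w = x}"
      then obtain w' where "w = x # w'" using assms(2) by (cases w) (auto simp: permutations_of_set_def)
      then show "w \<in> (#) x ` permutations_of_set (Z - {x})" using w by (auto simp: permutations_of_set_def)
    qed
    show "(#) x ` permutations_of_set (Z - {x}) \<subseteq> {w \<in> permutations_of_set Z. hd w = x}"
    proof (rule image_subsetI)
      fix w assume "w \<in> permutations_of_set (Z - {x})"
      then have w: "set w = Z - {x}" "distinct w" by (auto simp: permutations_of_set_def)
      have "set (x # w) = Z" using w(1) assms(2) by (simp add: insert_absorb)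
      moreover have "distinct (x # w)" using w by simp
      ultimately show "x # w \<in> {w \<in> permutations_of_set Z. hd w = x}" by (simp only: permutations_of_set_def mem_Collect_eq list.sel simp_thms)
    qed
  qed
  then show ?thesis using assms by (simp add: card_image)
qed

text \<open>
  On the words that start with \<open>x\<close>, the values of \<open>lie_map Z f\<close> are those of \<open>f\<close>, by
  \<open>lie_coeff_same_head\<close>.
\<close>

lemma lie_map_inj_on_head:
  assumes "finite Z" "f \<in> supported {w \<in> permutations_of_set Z. hd w = x}" "lie_map Z f = 0"
  shows "f = 0"
proof -
  have "f v = 0" if v: "v \<in> permutations_of_set Z" "hd v = x" "Z \<noteq> {}" for v
  proof -
    have ne: "w \<noteq> []" if "w \<in> permutations_of_set Z" for w using that v(3) by (auto simp: permutations_of_set_def)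
    have "f w * lie_coeff w v = (if w = v then f w else 0)" if w: "w \<in> permutations_of_set Z" for w
    proof (cases "hd w = x")
      case True
      then obtain s t where "w = x # s" "v = x # t" using ne[OF w] ne[OF v(1)] v(2) by (cases w; cases v) auto
      then show ?thesis
        using lie_coeff_same_head[of x s t, where ?'f = 'b] w v(1) by (simp add: permutations_of_set_def)
    next
      case False
      then show ?thesis using assms(2) by (auto simp: supported_def)
    qed
    then have "lie_map Z f v = f v" using v by (simp add: lie_map_def assms(1) cong: sum.cong)
    then show ?thesis using assms(3) by simp
  qed
  moreover have "f v = 0" if v: "Z = {}" for v
  proof -
    have "lie_map Z f [] = f []" by (simp add: lie_map_def v lie_coeff_short)
    then show ?thesis using assms(2,3) v by (cases "v = []") (auto simp: supported_def)
  qed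
  ultimately show ?thesis using assms(2) by (auto simp: supported_def fun_eq_iff)
qed

text \<open>
  Words have to start with a letter of \<open>Y\<close>, and \<open>d\<close> selects the letter with which a word that contains a
  given set of letters of \<open>Y\<close> starts when it belongs to a basic cutting.
\<close>

locale marked_alphabet =
  fixes Z Y :: "'a set" and d :: "'a set \<Rightarrow> 'a"
  assumes finite_Z: "finite Z" and Y: "Y \<subseteq> Z" "Y \<noteq> {}"
    and d: "B \<subseteq> Y \<Longrightarrow> B \<noteq> {} \<Longrightarrow> d B \<in> B"
begin

definition cutting :: "'a set \<Rightarrow> 'a list set \<Rightarrow> bool" where
  "cutting S U \<longleftrightarrow> (\<Union>u\<in>U. set u) = S \<and> (\<forall>u\<in>U. distinct u \<and> u \<noteq> [] \<and> hd u \<in> Y) \<and>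
     (\<forall>u\<in>U. \<forall>v\<in>U. u \<noteq> v \<longrightarrow> set u \<inter> set v = {})"

definition basis :: "'a set \<Rightarrow> 'a list set set" where
  "basis S = {U. cutting S U \<and> (\<forall>u\<in>U. hd u = d (Y \<inter> set u))}"

lemma cutting_finite:
  assumes "finite S" "cutting S U"
  shows "finite U" "card U \<le> card S" "U \<subseteq> {u. set u \<subseteq> S \<and> distinct u}"
proof -
  show sub: "U \<subseteq> {u. set u \<subseteq> S \<and> distinct u}" using assms(2) by (auto simp: cutting_def)
  show "finite U" using finite_subset[OF sub finite_subset_distinct[OF assms(1)]] .
  have "inj_on hd U"
  proof (rule inj_onI, rule ccontr)
    fix u v assume uv: "u \<in> U" "v \<in> U" "hd u = hd v" "u \<noteq> v"
    then have "u \<noteq> []" "v \<noteq> []" "set u \<inter> set v = {}" using assms(2) unfolding cutting_def by blast+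
    then show False using uv(3) hd_in_set[of u] hd_in_set[of v] by auto
  qed
  moreover have "hd ` U \<subseteq> S" using assms(2) by (force simp: cutting_def)
  ultimately show "card U \<le> card S" using card_inj_on_le assms(1) by blast
qed

lemma finite_basis: "finite S \<Longrightarrow> finite (basis S)"
  by (rule finite_subset[of _ "Pow {u. set u \<subseteq> S \<and> distinct u}"])
     (use cutting_finite(3) finite_subset_distinct in \<open>auto simp: basis_def\<close>)

lemma cutting_replace:
  assumes U: "cutting S U" "u \<in> U" and T: "(\<Union>t\<in>T. set t) = set u"
    "\<And>t. t \<in> T \<Longrightarrow> distinct t \<and> t \<noteq> [] \<and> hd t \<in> Y"
    "\<And>t t'. t \<in> T \<Longrightarrow> t' \<in> T \<Longrightarrow> t \<noteq> t' \<Longrightarrow> set t \<inter> set t' = {}"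
  shows "cutting S (T \<union> (U - {u}))" "T \<inter> (U - {u}) = {}"
proof -
  have disj: "set t \<inter> set v = {}" if "t \<in> T" "v \<in> U - {u}" for t v
  proof -
    have "set t \<subseteq> set u" using T(1) that(1) by blast
    moreover have "set u \<inter> set v = {}" using U that(2) unfolding cutting_def by blast
    ultimately show ?thesis by blast
  qed
  show "T \<inter> (U - {u}) = {}"
  proof (rule ccontr)
    assume "T \<inter> (U - {u}) \<noteq> {}"
    then obtain t where "t \<in> T" "t \<in> U - {u}" by blast
    then have "set t = {}" using disj by fastforce
    then show False using T(2)[OF \<open>t \<in> T\<close>] by simp
  qed
  have "(\<Union>v\<in>T \<union> (U - {u}). set v) = set u \<union> (\<Union>v\<in>U - {u}. set v)" using T(1) by auto
  also have "\<dots> = S" using U unfolding cutting_def by blast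
  finally have union: "(\<Union>v\<in>T \<union> (U - {u}). set v) = S" .
  have "set v \<inter> set w = {}" if "v \<in> T \<union> (U - {u})" "w \<in> T \<union> (U - {u})" "v \<noteq> w" for v w
    using that disj[of v w] disj[of w v] T(3)[of v w] U(1) unfolding cutting_def by blast
  moreover have "distinct v \<and> v \<noteq> [] \<and> hd v \<in> Y" if "v \<in> T \<union> (U - {u})" for v
    using that T(2)[of v] U(1) unfolding cutting_def by blast
  ultimately show "cutting S (T \<union> (U - {u}))" using union unfolding cutting_def by blast
qed

lemma d_in: "u \<noteq> [] \<Longrightarrow> hd u \<in> Y \<Longrightarrow> d (Y \<inter> set u) \<in> Y \<inter> set u"
  using d[of "Y \<inter> set u"] hd_in_set[of u] by blast

lemma hd_shuffles: "t \<in> shuffles a b \<Longrightarrow> a \<noteq> [] \<Longrightarrow> b \<noteq> [] \<Longrightarrow> hd t = hd a \<or> hd t = hd b"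
  by (cases a; cases b) auto

definition pos :: "'a list \<Rightarrow> nat" where
  "pos u = length (takeWhile (\<lambda>y. y \<noteq> d (Y \<inter> set u)) u)"

text \<open>
  Suppose that the word \<open>u\<close> of the cutting does not start with its selected letter \<open>x\<close>, and write
  \<open>u = a @ x # b\<close>. Replacing \<open>u\<close> by each of the shuffles of \<open>a\<close> and \<open>x # b\<close> and adding up gives the
  shuffle sum of the cutting in which \<open>u\<close> is replaced by the two words \<open>a\<close> and \<open>x # b\<close>. This cutting has
  more words, and in the shuffles other than \<open>u\<close> itself the letter \<open>x\<close> is nearer to the front. So the
  rewriting terminates for the lexicographic measure.
\<close>

theorem shuffle_sum_in_span:
  "cutting Z U \<Longrightarrow> (shuffle_sum U :: 'a list \<Rightarrow> 'f :: field) \<in> fun_space.span (shuffle_sum ` basis Z)"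
proof (induction U rule: wf_induct_rule[OF wf_measures[of "[\<lambda>U. card Z - card U, \<lambda>U. \<Sum>u\<in>U. pos u]"]])
  case (1 U)
  note fin = cutting_finite[OF finite_Z]
  show ?case
  proof (cases "\<forall>u\<in>U. hd u = d (Y \<inter> set u)")
    case True
    then show ?thesis using 1(2) by (intro fun_space.span_base) (auto simp: basis_def)
  next
    case False
    then obtain u where u: "u \<in> U" "hd u \<noteq> d (Y \<inter> set u)" by blast
    have uU: "distinct u" "u \<noteq> []" "hd u \<in> Y" using 1(2) u(1) by (auto simp: cutting_def)
    define x where "x = d (Y \<inter> set u)"
    have x: "x \<in> Y" "x \<in> set u" using d_in[OF uU(2,3)] by (auto simp: x_def)
    then obtain a b where ab: "u = a @ x # b" "x \<notin> set a" by (metis split_list_first)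
    have "hd u \<noteq> x" using u(2) unfolding x_def .
    then have a: "a \<noteq> []" "hd a = hd u" using ab by (cases a; simp)+
    have dist: "distinct (a @ x # b)" using uU ab by simp
    define U' where "U' = U - {u}"
    have finU: "finite U" using fin(1)[OF 1(2)] .
    have cardU: "card U = Suc (card U')" using card.remove[OF finU u(1)] by (simp add: U'_def)
    have U1: "cutting Z ({a, x # b} \<union> U')" "{a, x # b} \<inter> U' = {}"
      unfolding U'_def by (rule cutting_replace[OF 1(2) u(1)]; use ab dist a uU x in auto)+
    have "a \<noteq> x # b" using ab(2) by auto
    then have card1: "card ({a, x # b} \<union> U') = Suc (card U)"
      using U1(2) finU cardU by (subst card_Un_disjoint) (auto simp: U'_def)
    have win: "u \<in> shuffles a (x # b)"
      using append_in_shuffles[of a "x # b"] ab(1) by simp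
    have t: "cutting Z (insert t U')" "t \<notin> U'" "set t = set u" if "t \<in> shuffles a (x # b)" for t
    proof -
      show st: "set t = set u" using set_shuffles[OF that] ab by auto
      have "hd t \<in> Y" using hd_shuffles[OF that] a x uU by auto
      moreover have "distinct t" using distinct_disjoint_shuffles[OF _ _ _ that] dist by auto
      moreover have "t \<noteq> []" using that by auto
      ultimately show "cutting Z (insert t U')" "t \<notin> U'"
        using cutting_replace[OF 1(2) u(1), of "{t}"] st by (auto simp: U'_def)
    qed
    let ?S = "fun_space.span (shuffle_sum ` basis Z) :: ('a list \<Rightarrow> 'f) set"
    have in1: "shuffle_sum ({a, x # b} \<union> U') \<in> ?S"
    proof (rule 1(1)[OF _ U1(1)])
      have "card Z - card ({a, x # b} \<union> U') < card Z - card U" using card1 fin(2)[OF U1(1)] by linarith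
      then show "({a, x # b} \<union> U', U) \<in> measures [\<lambda>U. card Z - card U, \<lambda>U. \<Sum>u\<in>U. pos u]"
        by (simp only: in_measures disj_ac) simp
    qed
    have int: "shuffle_sum (insert t U') \<in> ?S" if "t \<in> shuffles a (x # b) - {u}" for t
    proof -
      have tt: "t \<in> shuffles a (x # b)" "t \<noteq> a @ x # b" using that ab by auto
      have "card (insert t U') = card U" using t(2)[OF tt(1)] finU cardU by (simp add: U'_def)
      moreover have "(\<Sum>v\<in>insert t U'. pos v) < (\<Sum>v\<in>U. pos v)"
      proof -
        have "pos u = length a" unfolding pos_def x_def[symmetric]
          unfolding ab(1) using ab(2) by (subst takeWhile_append2) auto
        moreover have "pos t < length a"
          unfolding pos_def t(3)[OF tt(1)] x_def[symmetric] by (rule shuffles_pos_less[OF dist tt])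
        ultimately have "pos t < pos u" by simp
        moreover have "(\<Sum>v\<in>U. pos v) = pos u + (\<Sum>v\<in>U'. pos v)"
          using sum.remove[OF finU u(1)] by (simp add: U'_def)
        ultimately show ?thesis using t(2)[OF tt(1)] finU by (simp add: U'_def)
      qed
      ultimately show ?thesis using 1(1)[of "insert t U'"] t(1)[OF tt(1)] by simp
    qed
    have "shuffle_sum ({a, x # b} \<union> U') = (\<Sum>t\<in>shuffles a (x # b). shuffle_sum (insert t U') :: 'a list \<Rightarrow> 'f)"
      using shuffle_sum_Un[of "{a, x # b}" U'] interleavings_pair[OF dist] by simp
    also have "\<dots> = shuffle_sum (insert u U') + (\<Sum>t\<in>shuffles a (x # b) - {u}. shuffle_sum (insert t U'))"
      using win by (simp add: sum.remove[of _ u])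
    also have "insert u U' = U" using u(1) by (auto simp: U'_def)
    finally have "shuffle_sum U = shuffle_sum ({a, x # b} \<union> U') - (\<Sum>t\<in>shuffles a (x # b) - {u}. shuffle_sum (insert t U') :: 'a list \<Rightarrow> 'f)"
      by (simp only: add_diff_cancel_right')
    also have "\<dots> \<in> ?S" using in1 int by (intro fun_space.span_diff fun_space.span_sum)
    finally show ?thesis .
  qed
qed

text \<open>
  A map from the words that start in \<open>Y\<close> onto the basic cuttings, which bounds their number. It cuts \<open>l\<close>
  in front of the letter \<open>d (Y \<inter> set l)\<close>, rotates the second part so that it starts with its own
  selected letter, and continues with the first part.
\<close>

function decompose :: "'a list \<Rightarrow> 'a list set" where
  "decompose l = (if Y \<inter> set l = {} then {} else
     let a = takeWhile (\<lambda>y. y \<noteq> d (Y \<inter> set l)) l; b = dropWhile (\<lambda>y. y \<noteq> d (Y \<inter> set l)) l; y = d (Y \<inter> set b)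
     in insert (dropWhile (\<lambda>z. z \<noteq> y) b @ takeWhile (\<lambda>z. z \<noteq> y) b) (decompose a))"
  by pat_completeness auto
termination
proof (relation "measure length", goal_cases)
  case (2 l)
  then have "d (Y \<inter> set l) \<in> set l" using d[of "Y \<inter> set l"] by auto
  then have "length (takeWhile (\<lambda>y. y \<noteq> d (Y \<inter> set l)) l) \<noteq> length l"
    by (metis (mono_tags, lifting) length_takeWhile_le set_takeWhileD takeWhile_eq_take take_all_iff order_refl)
  then show ?case using 2 length_takeWhile_le[of "\<lambda>y. y \<noteq> d (Y \<inter> set l)" l] by simp
qed simp

declare decompose.simps [simp del]

text \<open>
  The word \<open>u\<close> of the cutting that contains \<open>x = d (Y \<inter> S)\<close> is the one that was cut off last; rotated
  so that it starts with \<open>x\<close>, it is appended to a word that decomposes into the remaining words.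
\<close>

lemma decompose_surj:
  "finite S \<Longrightarrow> U \<in> basis S \<Longrightarrow> \<exists>l. distinct l \<and> set l = S \<and> (l = [] \<or> hd l \<in> Y) \<and> decompose l = U"
proof (induction "card U" arbitrary: U S)
  case 0
  then have "U = {}" using cutting_finite(1)[OF 0(2)] by (auto simp: basis_def)
  then have "S = {}" using 0 by (auto simp: basis_def cutting_def)
  then show ?case using \<open>U = {}\<close> by (intro exI[of _ "[]"]) (simp add: decompose.simps)
next
  case (Suc n)
  have cut: "cutting S U" and hdU: "\<And>u. u \<in> U \<Longrightarrow> hd u = d (Y \<inter> set u)" using Suc.prems by (auto simp: basis_def)
  have finU: "finite U" using cutting_finite(1)[OF Suc.prems(1) cut] .
  have "U \<noteq> {}" using Suc.hyps(2) by auto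
  then obtain v where v: "v \<in> U" by auto
  then have "hd v \<in> Y \<inter> S" using cut hd_in_set[of v] by (auto simp: cutting_def)
  define x where "x = d (Y \<inter> S)"
  have x: "x \<in> Y" "x \<in> S" using d[of "Y \<inter> S"] \<open>hd v \<in> Y \<inter> S\<close> by (auto simp: x_def)
  then obtain u where u: "u \<in> U" "x \<in> set u" using cut by (auto simp: cutting_def)
  then obtain c e where ce: "u = c @ x # e" "x \<notin> set c" by (metis split_list_first)
  have uU: "distinct u" "u \<noteq> []" "hd u \<in> Y" using cut u(1) by (auto simp: cutting_def)
  define U' where "U' = U - {u}"
  have disj: "set u \<inter> set w = {}" if "w \<in> U'" for w
    using that cut u(1) unfolding cutting_def U'_def by blast
  have un: "(\<Union>w\<in>U'. set w) = S - set u"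
  proof -
    have "(\<Union>w\<in>U. set w) = set u \<union> (\<Union>w\<in>U'. set w)" using u(1) by (auto simp: U'_def)
    then show ?thesis using cut disj unfolding cutting_def by blast
  qed
  have "\<forall>w\<in>U'. distinct w \<and> w \<noteq> [] \<and> hd w \<in> Y" "\<forall>v\<in>U'. \<forall>w\<in>U'. v \<noteq> w \<longrightarrow> set v \<inter> set w = {}"
    using cut by (simp_all add: cutting_def U'_def)
  then have "cutting (S - set u) U'" using un by (simp add: cutting_def)
  moreover have "\<forall>w\<in>U'. hd w = d (Y \<inter> set w)" using hdU by (simp add: U'_def)
  ultimately have "U' \<in> basis (S - set u)" by (simp add: basis_def)
  moreover have "card U' = n" using Suc.hyps(2) card.remove[OF finU u(1)] by (simp add: U'_def)
  ultimately obtain l' where l': "distinct l'" "set l' = S - set u" "l' = [] \<or> hd l' \<in> Y" "decompose l' = U'"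
    using Suc.hyps(1)[of U' "S - set u"] Suc.prems(1) by auto
  let ?l = "l' @ x # e @ c"
  have uS: "set u \<subseteq> S" using cut u(1) by (auto simp: cutting_def)
  have setl: "set ?l = S" using l'(2) ce(1) uS by auto
  have "x \<notin> set l'" using l'(2) u(2) by auto
  then have tw: "takeWhile (\<lambda>y. y \<noteq> x) ?l = l'" "dropWhile (\<lambda>y. y \<noteq> x) ?l = x # e @ c"
    by (subst takeWhile_append2 dropWhile_append2; auto)+
  have rot: "dropWhile (\<lambda>z. z \<noteq> hd u) (x # e @ c) @ takeWhile (\<lambda>z. z \<noteq> hd u) (x # e @ c) = u"
  proof (cases c)
    case Nil
    then show ?thesis using ce by simp
  next
    case (Cons y c')
    then have "hd u = y" "y \<noteq> x" "y \<notin> set e" using ce uU(1) by auto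
    then have "dropWhile (\<lambda>z. z \<noteq> hd u) ((x # e) @ c) = c" "takeWhile (\<lambda>z. z \<noteq> hd u) ((x # e) @ c) = x # e"
      using Cons by (subst dropWhile_append2 takeWhile_append2; auto)+
    then show ?thesis using ce by simp
  qed
  have "decompose ?l = U"
  proof -
    have ne: "Y \<inter> S \<noteq> {}" using x by auto
    have "set (x # e @ c) = set u" using ce by auto
    then have "d (Y \<inter> set (x # e @ c)) = hd u" using hdU[OF u(1)] by simp
    then have "decompose ?l = insert u (decompose l')"
      unfolding decompose.simps[of ?l] setl x_def[symmetric] tw Let_def using ne rot by simp
    then show ?thesis using l'(4) u(1) by (auto simp: U'_def)
  qed
  moreover have "distinct ?l" using l' uU(1) ce by auto
  moreover have "hd ?l \<in> Y" using l'(3) x by (cases l') auto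
  ultimately show ?case using setl by blast
qed

definition start_words :: "'a list set" where
  "start_words = {w \<in> permutations_of_set Z. hd w \<in> Y}"

lemma finite_start_words: "finite start_words"
  using finite_Z by (simp add: start_words_def)

lemma Z_nonempty: "Z \<noteq> {}" using Y by auto

lemma word_nonempty: "w \<in> permutations_of_set Z \<Longrightarrow> w \<noteq> []"
  using Z_nonempty by (auto simp: permutations_of_set_def)

lemma card_basis_le: "card (basis Z) \<le> card start_words"
proof -
  have "basis Z \<subseteq> decompose ` start_words"
  proof
    fix U assume "U \<in> basis Z"
    then obtain l where l: "distinct l" "set l = Z" "l = [] \<or> hd l \<in> Y" "decompose l = U"
      using decompose_surj[OF finite_Z] by blast
    then have "l \<in> start_words" using Z_nonempty by (auto simp: start_words_def permutations_of_set_def)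
    then show "U \<in> decompose ` start_words" using l(4) by auto
  qed
  then show ?thesis using finite_start_words by (rule surj_card_le[rotated])
qed

lemma shuffle_sum_supported: "cutting Z V \<Longrightarrow> shuffle_sum V \<in> supported start_words"
proof -
  assume V: "cutting Z V"
  have "w \<in> start_words" if w: "w \<in> interleavings V" for w
  proof -
    have wZ: "w \<in> permutations_of_set Z" using w V by (auto simp: interleavings_def cutting_def permutations_of_set_def)
    then have "hd w \<in> Z" using word_nonempty[OF wZ] hd_in_set[of w] by (auto simp: permutations_of_set_def)
    then obtain u where u: "u \<in> V" "hd w \<in> set u" using V by (auto simp: cutting_def)
    have "u = filter (\<lambda>x. x \<in> set u) w" using w u(1) by (simp add: interleavings_def)
    also have "w = hd w # tl w" using word_nonempty[OF wZ] by simp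
    also have "filter (\<lambda>x. x \<in> set u) (hd w # tl w) = hd w # filter (\<lambda>x. x \<in> set u) (tl w)" using u(2) by simp
    finally have "hd u = hd w" by (metis list.sel(1))
    then show ?thesis using V u(1) wZ by (auto simp: cutting_def start_words_def)
  qed
  then show ?thesis by (auto simp: supported_def shuffle_sum_def)
qed

text \<open>
  A single word is a cutting, so that by \<open>shuffle_sum_in_span\<close> the shuffle sums of basic cuttings span a
  space whose dimension is the number of words starting in \<open>Y\<close>; and \<open>decompose\<close> shows that there
  are no more basic cuttings than such words.
\<close>

theorem shuffle_sum_basis:
  shows "independent_family fun_scale (shuffle_sum :: _ \<Rightarrow> 'a list \<Rightarrow> 'f :: field) (basis Z)"
    and "card (basis Z) = card start_words"
proof -
  let ?s = "shuffle_sum :: _ \<Rightarrow> 'a list \<Rightarrow> 'f"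
  have "group_elem ` start_words \<subseteq> fun_space.span (?s ` basis Z)"
  proof
    fix f :: "'a list \<Rightarrow> 'f" assume "f \<in> group_elem ` start_words"
    then obtain w where w: "w \<in> start_words" "f = group_elem w" by auto
    then have wZ: "w \<in> permutations_of_set Z" "distinct w" "set w = Z" by (auto simp: start_words_def permutations_of_set_def)
    then have "cutting Z {w}" using w word_nonempty[OF wZ(1)] by (auto simp: cutting_def start_words_def)
    then have "?s {w} \<in> fun_space.span (?s ` basis Z)" by (rule shuffle_sum_in_span)
    moreover have "f = ?s {w}" using w(2) by (simp only: shuffle_sum_single[OF wZ(2)])
    ultimately show "f \<in> fun_space.span (?s ` basis Z)" by blast
  qed
  then have sup: "supported start_words \<subseteq> fun_space.span (?s ` basis Z)"
    unfolding span_group_elem[OF finite_start_words, symmetric]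
    by (rule fun_space.span_minimal[OF _ fun_space.subspace_span])
  have sub: "?s ` basis Z \<subseteq> supported start_words" using shuffle_sum_supported by (auto simp: basis_def)
  have fin: "finite (?s ` basis Z)" using finite_basis[OF finite_Z] by simp
  have 1: "card start_words \<le> card (?s ` basis Z)"
    using fun_space.dim_le_card[OF sup fin] dim_supported[OF finite_start_words, where ?'b = 'f] by simp
  have 2: "card (?s ` basis Z) \<le> card (basis Z)" by (rule card_image_le[OF finite_basis[OF finite_Z]])
  show c: "card (basis Z) = card start_words" using 1 2 card_basis_le by simp
  have "inj_on ?s (basis Z)" by (rule eq_card_imp_inj_on[OF finite_basis[OF finite_Z]]) (use 1 2 c in simp)
  moreover have "fun_space.independent (?s ` basis Z)"
    using 2 c dim_supported[OF finite_start_words, where ?'b = 'f]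
    by (intro fun_space.independent_if_spans[OF fin _ sup sub]) simp
  ultimately show "independent_family fun_scale ?s (basis Z)"
    using fun_space.independent_family_iff[OF finite_basis[OF finite_Z]] by blast
qed

definition multi_basis :: "'a list set set" where
  "multi_basis = {V \<in> basis Z. 2 \<le> card V}"

lemma finite_multi_basis: "finite multi_basis"
  using finite_basis[OF finite_Z] by (simp add: multi_basis_def)

text \<open>
  A basic cutting with only one word is a word that starts with \<open>d Y\<close>.
\<close>

lemma card_multi_basis: "card multi_basis + fact (card Z - 1) = card start_words"
proof -
  have dY: "d Y \<in> Y" using d[of Y] Y by simp
  have "basis Z - multi_basis = (\<lambda>w. {w}) ` {w \<in> permutations_of_set Z. hd w = d Y}"
  proof
    show "basis Z - multi_basis \<subseteq> (\<lambda>w. {w}) ` {w \<in> permutations_of_set Z. hd w = d Y}"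
    proof
      fix V assume V: "V \<in> basis Z - multi_basis"
      then have cut: "cutting Z V" and "card V \<le> 1" by (auto simp: basis_def multi_basis_def)
      moreover have "V \<noteq> {}" using cut Z_nonempty by (auto simp: cutting_def)
      ultimately have "card V = 1" using cutting_finite(1)[OF finite_Z cut] by (simp add: Suc_le_eq le_Suc_eq)
      then obtain w where w: "V = {w}" by (auto simp: card_1_singleton_iff)
      then have "set w = Z" "distinct w" "hd w = d (Y \<inter> Z)" using V cut by (auto simp: basis_def cutting_def)
      then show "V \<in> (\<lambda>w. {w}) ` {w \<in> permutations_of_set Z. hd w = d Y}"
        using w Y by (auto simp: permutations_of_set_def Int_absorb2)
    qed
    show "(\<lambda>w. {w}) ` {w \<in> permutations_of_set Z. hd w = d Y} \<subseteq> basis Z - multi_basis"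
      using dY Y word_nonempty by (auto simp: basis_def multi_basis_def cutting_def permutations_of_set_def Int_absorb2)
  qed
  then have "card (basis Z - multi_basis) = card {w \<in> permutations_of_set Z. hd w = d Y}"
    by (simp add: card_image)
  also have "\<dots> = fact (card Z - 1)" using dY Y by (intro card_permutations_with_head[OF finite_Z]) auto
  finally have "card (basis Z - multi_basis) = fact (card Z - 1)" .
  moreover have "card (basis Z) = card multi_basis + card (basis Z - multi_basis)"
    using card_Un_disjoint[of multi_basis "basis Z - multi_basis"] finite_basis[OF finite_Z]
    by (simp add: multi_basis_def Un_absorb1)
  ultimately show ?thesis using shuffle_sum_basis(2) by simp
qed

text \<open>
  Interleaving first all words of \<open>V\<close> but one writes \<open>shuffle_sum V\<close> as a sum of shuffle sums of two
  nonempty words.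
\<close>

lemma lie_map_shuffle_sum:
  assumes V: "cutting Z V" "2 \<le> card V"
  shows "lie_map Z (shuffle_sum V :: 'a list \<Rightarrow> 'f :: field) = 0"
proof -
  have finV: "finite V" using cutting_finite(1)[OF finite_Z V(1)] .
  obtain u where u: "u \<in> V" using V(2) by (metis all_not_in_conv card.empty not_numeral_le_zero)
  define V' where "V' = V - {u}"
  have "V' \<noteq> {}" using V(2) card_mono[of "{u}" V] by (auto simp: V'_def)
  have V: "V = V' \<union> {u}" and finV': "finite V'" using u finV by (auto simp: V'_def)
  have uV: "distinct u" "u \<noteq> []" using V(1) assms(1) u by (auto simp: cutting_def)
  have dis: "set u \<inter> (\<Union>v\<in>V'. set v) = {}" using assms(1) u unfolding cutting_def V'_def by blast
  have Zu: "set u \<union> (\<Union>v\<in>V'. set v) = Z" using assms(1) V unfolding cutting_def by auto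
  have "lie_map Z (shuffle_sum {t, u} :: 'a list \<Rightarrow> 'f) = 0" if t: "t \<in> interleavings V'" for t
  proof
    fix z
    have st: "set t = (\<Union>v\<in>V'. set v)" "distinct t" using t by (auto simp: interleavings_def)
    obtain v where v: "v \<in> V'" using \<open>V' \<noteq> {}\<close> by auto
    then have "v \<noteq> []" using assms(1) by (auto simp: cutting_def V'_def)
    then have tne: "t \<noteq> []" using st(1) v by (cases v) auto
    have dist: "distinct (t @ u)" using st uV dis by auto
    have "lie_map Z (shuffle_sum {t, u} :: 'a list \<Rightarrow> 'f) z = (\<Sum>w\<in>shuffles t u. lie_coeff w z)"
      unfolding shuffle_sum_def interleavings_pair[OF dist]
      by (rule lie_map_indicator[OF finite_Z shuffles_subset_permutations[OF dist]]) (use st Zu in auto)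
    then show "lie_map Z (shuffle_sum {t, u} :: 'a list \<Rightarrow> 'f) z = 0 z"
      using lie_coeff_shuffle[OF tne uV(2) dist] by simp
  qed
  moreover have "shuffle_sum V = (\<Sum>t\<in>interleavings V'. shuffle_sum {t, u} :: 'a list \<Rightarrow> 'f)"
    unfolding V using shuffle_sum_Un[OF finV', of "{u}"] by simp
  ultimately show ?thesis by (simp add: lie_map.sum)
qed

lemma lie_map_image:
  fixes S :: "'a list set"
  assumes S: "{w \<in> permutations_of_set Z. hd w = x} \<subseteq> S" "S \<subseteq> permutations_of_set Z" and x: "x \<in> Z"
  shows "lie_map Z ` (supported S :: ('a list \<Rightarrow> 'f :: field) set) = lie_map Z ` supported {w \<in> permutations_of_set Z. hd w = x}"
    (is "_ = lie_map Z ` supported ?H")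
proof
  show "lie_map Z ` supported ?H \<subseteq> lie_map Z ` (supported S :: ('a list \<Rightarrow> 'f) set)"
    using S(1) by (intro image_mono) (auto simp: supported_def)
  have fin: "finite S" "finite ?H" using finite_subset[OF S(2)] finite_Z by auto
  have "lie_map Z ` group_elem ` S \<subseteq> lie_map Z ` (supported ?H :: ('a list \<Rightarrow> 'f) set)"
  proof -
    have "lie_map Z ` group_elem ` S = (lie_coeff :: _ \<Rightarrow> _ \<Rightarrow> 'f) ` S"
      using lie_map_group_elem[OF finite_Z] S(2) by (force simp: image_image)
    also have "\<dots> \<subseteq> fun_space.span ((lie_coeff :: _ \<Rightarrow> _ \<Rightarrow> 'f) ` ?H)"
      using lie_coeff_in_span[OF finite_Z x] S(2) by auto
    also have "(lie_coeff :: _ \<Rightarrow> _ \<Rightarrow> 'f) ` ?H = lie_map Z ` group_elem ` ?H"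
      using lie_map_group_elem[OF finite_Z] by (force simp: image_image)
    also have "fun_space.span \<dots> = lie_map Z ` fun_space.span (group_elem ` ?H)" by (rule lie_map.span_image)
    finally show ?thesis using span_group_elem[OF fin(2), where ?'b = 'f] by simp
  qed
  then have "fun_space.span (lie_map Z ` group_elem ` S) \<subseteq> lie_map Z ` (supported ?H :: ('a list \<Rightarrow> 'f) set)"
    by (intro fun_space.span_minimal lie_map.subspace_image subspace_supported)
  then show "lie_map Z ` (supported S :: ('a list \<Rightarrow> 'f) set) \<subseteq> lie_map Z ` supported ?H"
    using lie_map.span_image[of Z "group_elem ` S :: ('a list \<Rightarrow> 'f) set"] span_group_elem[OF fin(1), where ?'b = 'f] by simp
qed

lemma lie_map_image_start_words:
  "lie_map Z ` (supported (permutations_of_set Z) :: ('a list \<Rightarrow> 'f :: field) set) = lie_map Z ` supported start_words"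
proof -
  obtain x where x: "x \<in> Y" using Y by auto
  then have xZ: "x \<in> Z" using Y by auto
  have 1: "{w \<in> permutations_of_set Z. hd w = x} \<subseteq> start_words" "start_words \<subseteq> permutations_of_set Z"
    using x by (auto simp: start_words_def)
  show ?thesis
    unfolding lie_map_image[OF 1 xZ] by (rule lie_map_image[OF _ subset_refl xZ]) blast
qed

lemma rank_nullity_lie_map:
  assumes "fun_space.subspace S" "S \<subseteq> supported (permutations_of_set Z)"
  shows "fun_dim S = fun_dim (lie_map Z ` S) + fun_dim {f \<in> S. lie_map Z f = (0 :: 'a list \<Rightarrow> 'f :: field)}"
proof (rule vector_space_pair.rank_nullity[OF _ linear_lie_map assms(1)])
  show "vector_space_pair (fun_scale :: 'f \<Rightarrow> _) fun_scale" by unfold_locales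
  show "finite (group_elem ` permutations_of_set Z)" using finite_Z by simp
  show "S \<subseteq> fun_space.span (group_elem ` permutations_of_set Z)"
    using span_group_elem[of "permutations_of_set Z", where ?'b = 'f] finite_Z assms(2) by simp
qed

lemma dim_lie_map_image:
  "fun_dim (lie_map Z ` (supported (permutations_of_set Z) :: ('a list \<Rightarrow> 'f :: field) set)) = fact (card Z - 1)"
proof -
  obtain x where x: "x \<in> Z" using Z_nonempty by auto
  let ?H = "{w \<in> permutations_of_set Z. hd w = x}"
  have finH: "finite ?H" using finite_Z by simp
  have "{f \<in> supported ?H. lie_map Z f = (0 :: 'a list \<Rightarrow> 'f)} \<subseteq> fun_space.span {}"
    using lie_map_inj_on_head[OF finite_Z, of _ x] by auto
  then have "fun_dim {f \<in> supported ?H. lie_map Z f = (0 :: 'a list \<Rightarrow> 'f)} \<le> card ({} :: ('a list \<Rightarrow> 'f) set)"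
    by (rule fun_space.dim_le_card) simp
  then have "fun_dim {f \<in> supported ?H. lie_map Z f = (0 :: 'a list \<Rightarrow> 'f)} = 0" by simp
  moreover have "fun_dim (supported ?H :: ('a list \<Rightarrow> 'f) set) =
      fun_dim (lie_map Z ` (supported ?H :: ('a list \<Rightarrow> 'f) set)) + fun_dim {f \<in> supported ?H. lie_map Z f = (0 :: 'a list \<Rightarrow> 'f)}"
    by (rule rank_nullity_lie_map[OF subspace_supported]) (auto simp: supported_def)
  ultimately have "fun_dim (lie_map Z ` (supported ?H :: ('a list \<Rightarrow> 'f) set)) = card ?H"
    using dim_supported[OF finH, where ?'b = 'f] by simp
  then show ?thesis
    using lie_map_image[of x "permutations_of_set Z", where ?'f = 'f] x card_permutations_with_head[OF finite_Z x] by simp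
qed

text \<open>
  The shuffle sums on the right lie in the kernel and are independent; by \<open>card_multi_basis\<close> their
  number is the dimension of the kernel.
\<close>

theorem kernel_lie_map:
  "{f \<in> supported start_words. lie_map Z f = (0 :: 'a list \<Rightarrow> 'f :: field)} = fun_space.span (shuffle_sum ` multi_basis)"
proof (rule sym, rule fun_space.subspace_eq_dim_finite)
  let ?K = "{f \<in> supported start_words. lie_map Z f = (0 :: 'a list \<Rightarrow> 'f)}"
  show "fun_space.subspace (fun_space.span (shuffle_sum ` multi_basis))" by (rule fun_space.subspace_span)
  have subK: "fun_space.subspace ?K"
    using subspace_supported[of start_words] unfolding fun_space.subspace_def
    by (auto simp: lie_map.add lie_map.scale lie_map.zero)
  show "fun_space.span (shuffle_sum ` multi_basis) \<subseteq> ?K"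
    using lie_map_shuffle_sum shuffle_sum_supported
    by (intro fun_space.span_minimal[OF _ subK]) (auto simp: multi_basis_def basis_def)
  show "finite (group_elem ` start_words :: ('a list \<Rightarrow> 'f) set)" using finite_start_words by simp
  show "?K \<subseteq> fun_space.span (group_elem ` start_words)"
    using span_group_elem[OF finite_start_words, where ?'b = 'f] by auto
  have ind: "independent_family fun_scale (shuffle_sum :: _ \<Rightarrow> 'a list \<Rightarrow> 'f) multi_basis"
    by (rule fun_space.independent_family_subset[OF shuffle_sum_basis(1) _ finite_basis[OF finite_Z]])
      (simp add: multi_basis_def)
  have "fun_dim (supported start_words :: ('a list \<Rightarrow> 'f) set)
      = fun_dim (lie_map Z ` (supported start_words :: ('a list \<Rightarrow> 'f) set)) + fun_dim ?K"
    by (rule rank_nullity_lie_map[OF subspace_supported]) (auto simp: supported_def start_words_def)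
  then have "card start_words = fact (card Z - 1) + fun_dim ?K"
    using dim_lie_map_image[where ?'f = 'f] lie_map_image_start_words[where ?'f = 'f]
      dim_supported[OF finite_start_words, where ?'b = 'f] by simp
  then show "fun_dim ?K \<le> fun_dim (fun_space.span (shuffle_sum ` multi_basis :: ('a list \<Rightarrow> 'f) set))"
    using card_multi_basis fun_space.dim_span_family[OF finite_multi_basis ind] by simp
qed

end

section \<open>Substitution of letters\<close>

definition word_act :: "('a list \<Rightarrow> 'f :: field) \<Rightarrow> ('a \<Rightarrow> 'a) \<Rightarrow> 'a list \<Rightarrow> 'f" where
  "word_act f h = (\<lambda>w. f (map (inv_into UNIV h) w))"

lemma map_inv_eq_iff: "bij h \<Longrightarrow> map (inv_into UNIV h) v = w \<longleftrightarrow> v = map h w"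
  by (auto simp: bij_def surj_iff inj_iff)

lemma word_act_group_elem: "bij h \<Longrightarrow> word_act (group_elem w) h = group_elem (map h w)"
  by (auto simp: word_act_def group_elem_def map_inv_eq_iff)

lemma interleavings_map:
  assumes "bij h"
  shows "map h w \<in> interleavings (map h ` V) \<longleftrightarrow> w \<in> interleavings V"
proof -
  have inj: "inj h" using assms by (rule bij_is_inj)
  have "filter (\<lambda>x. x \<in> set (map h u)) (map h w) = map h (filter (\<lambda>x. x \<in> set u) w)" for u
    unfolding filter_map by (rule arg_cong[of _ _ "map h"], rule filter_cong) (auto simp: inj_image_mem_iff[OF inj])
  then have "filter (\<lambda>x. x \<in> set (map h u)) (map h w) = map h u \<longleftrightarrow> filter (\<lambda>x. x \<in> set u) w = u" for u
    using inj by (simp add: inj_map_eq_map)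
  moreover have "set (map h w) = (\<Union>u\<in>map h ` V. set u) \<longleftrightarrow> set w = (\<Union>u\<in>V. set u)"
  proof -
    have "(\<Union>u\<in>map h ` V. set u) = h ` (\<Union>u\<in>V. set u)" by auto
    then show ?thesis using inj by (simp only: set_map inj_image_eq_iff)
  qed
  moreover have "distinct (map h w) \<longleftrightarrow> distinct w" using inj by (simp add: distinct_map inj_on_subset[OF inj])
  ultimately show ?thesis unfolding interleavings_def mem_Collect_eq by (simp only: ball_simps)
qed

lemma word_act_shuffle_sum:
  assumes "bij h"
  shows "word_act (shuffle_sum V) h = shuffle_sum (map h ` V)"
proof
  fix w
  have "map h (map (inv_into UNIV h) w) = w" using assms by (simp add: bij_def surj_iff)
  then have "w \<in> interleavings (map h ` V) \<longleftrightarrow> map (inv_into UNIV h) w \<in> interleavings V"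
    using interleavings_map[OF assms, of "map (inv_into UNIV h) w" V] by simp
  then show "word_act (shuffle_sum V) h w = shuffle_sum (map h ` V) w"
    by (simp add: word_act_def shuffle_sum_def)
qed

lemma map_permutes_permutations:
  assumes "h permutes Z" "w \<in> permutations_of_set Z"
  shows "map h w \<in> permutations_of_set Z"
  using assms permutes_inj_on[OF assms(1)] by (auto simp: permutations_of_set_def permutes_image distinct_map)

lemma lie_map_word_act:
  fixes f :: "'a list \<Rightarrow> 'f :: field"
  assumes "h permutes Z"
  shows "lie_map Z (word_act f h) = word_act (lie_map Z f) h"
proof
  fix v
  have bij: "bij h" and bij': "bij (inv_into UNIV h)" using permutes_bij[OF assms] permutes_bij[OF permutes_inv[OF assms]] by auto
  have 1: "map (inv_into UNIV h) (map h w) = w" "map h (map (inv_into UNIV h) w) = w" for w :: "'a list"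
    using bij by (auto simp: bij_def surj_iff inj_iff)
  have "lie_map Z (word_act f h) v = (\<Sum>w\<in>permutations_of_set Z. f w * lie_coeff (map h w) v)"
    unfolding lie_map_def word_act_def
    by (rule sum.reindex_bij_witness[where i = "map h" and j = "map (inv_into UNIV h)"])
       (use map_permutes_permutations[OF assms] map_permutes_permutations[OF permutes_inv[OF assms]] 1 in auto)
  also have "\<dots> = (\<Sum>w\<in>permutations_of_set Z. f w * lie_coeff w (map (inv_into UNIV h) v))"
  proof -
    have "lie_coeff (map h w) v = (lie_coeff w (map (inv_into UNIV h) v) :: 'f)" for w
      using lie_coeff_map[OF bij_is_inj[OF bij], of w "map (inv_into UNIV h) v"] unfolding 1 .
    then show ?thesis by simp
  qed
  finally show "lie_map Z (word_act f h) v = word_act (lie_map Z f) h v"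
    by (simp add: lie_map_def word_act_def)
qed

text \<open>
  Equivariance of \<open>d\<close> is asked for at proper subsets of \<open>Y\<close> only: an equivariant value at \<open>Y\<close> would be a
  letter fixed by the whole group, whereas the words of a cutting into at least two words contain proper
  subsets of \<open>Y\<close>.
\<close>

locale letter_substitution = marked_alphabet Z Y d + group G
  for Z Y :: "'a set" and d :: "'a set \<Rightarrow> 'a" and G :: "('a \<Rightarrow> 'a) monoid" (structure) +
  assumes permutes: "h \<in> carrier G \<Longrightarrow> h permutes Z"
    and mult: "g \<otimes> h = h \<circ> g" and one: "\<one> = id"
    and Y_invariant: "h \<in> carrier G \<Longrightarrow> h ` Y = Y"
    and d_equivariant: "h \<in> carrier G \<Longrightarrow> B \<subset> Y \<Longrightarrow> B \<noteq> {} \<Longrightarrow> d (h ` B) = h (d B)"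
begin

lemma bij: "h \<in> carrier G \<Longrightarrow> bij h"
  using permutes permutes_bij by blast

lemma fin_carrier: "finite (carrier G)"
  by (rule finite_subset[OF _ finite_permutations[OF finite_Z]]) (use permutes in auto)

sublocale words: right_representation fun_scale G "word_act :: ('a list \<Rightarrow> 'f :: field) \<Rightarrow> _"
proof unfold_locales
  show "finite (carrier G)" by (rule fin_carrier)
  show "word_act (u + v) g = word_act u g + word_act v g" "word_act (fun_scale c v) g = fun_scale c (word_act v g)" for u v :: "'a list \<Rightarrow> 'f" and c g
    by (auto simp: word_act_def fun_scale_def)
  show "word_act v \<one> = v" for v :: "'a list \<Rightarrow> 'f" by (simp add: word_act_def one)
  show "word_act (word_act v g) h = word_act v (g \<otimes> h)" if "g \<in> carrier G" "h \<in> carrier G" for v :: "'a list \<Rightarrow> 'f" and g h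
    using bij[OF that(1)] bij[OF that(2)] by (simp add: word_act_def mult o_inv_distrib)
qed

lemma word_action: "right_action G start_words (\<lambda>w h. map h w)"
proof unfold_locales
  show "finite (carrier G)" by (rule fin_carrier)
  show "finite start_words" by (rule finite_start_words)
  show "map h w \<in> start_words" if "w \<in> start_words" "h \<in> carrier G" for w h
    using that map_permutes_permutations[OF permutes[OF that(2)], of w] Y_invariant[OF that(2)] word_nonempty[of w]
    by (auto simp: start_words_def hd_map)
qed (auto simp: one mult)

lemma fixes_word: "h \<in> carrier G \<Longrightarrow> w \<in> permutations_of_set Z \<Longrightarrow> map h w = w \<Longrightarrow> h = \<one>"
proof -
  assume h: "h \<in> carrier G" and w: "w \<in> permutations_of_set Z" "map h w = w"
  have "h x = x" for x
  proof (cases "x \<in> Z")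
    case True
    then have "x \<in> set w" using w(1) by (simp add: permutations_of_set_def)
    then show ?thesis using w(2) map_eq_conv[of h w id] by simp
  next
    case False
    then show ?thesis using permutes[OF h] permutes_not_in by metis
  qed
  then show "h = \<one>" by (auto simp: one)
qed

lemma proper_block:
  assumes V: "cutting Z V" "2 \<le> card V" and u: "u \<in> V"
  shows "Y \<inter> set u \<subset> Y" "Y \<inter> set u \<noteq> {}"
proof -
  have ne: "w \<noteq> []" "hd w \<in> Y" if "w \<in> V" for w using V(1) that by (auto simp: cutting_def)
  show "Y \<inter> set u \<noteq> {}" using ne[OF u] hd_in_set[of u] by auto
  have "\<not> V \<subseteq> {u}" using V(2) card_mono[of "{u}" V] by auto
  then obtain v where v: "v \<in> V" "v \<noteq> u" by auto
  then have "set v \<inter> set u = {}" using V(1) u unfolding cutting_def by blast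
  then have "hd v \<notin> set u" using hd_in_set[OF ne(1)[OF v(1)]] by blast
  then show "Y \<inter> set u \<subset> Y" using ne(2)[OF v(1)] by auto
qed

lemma map_multi_basis:
  assumes V: "V \<in> multi_basis" and h: "h \<in> carrier G"
  shows "map h ` V \<in> multi_basis"
proof -
  have cut: "cutting Z V" and hd: "\<And>u. u \<in> V \<Longrightarrow> hd u = d (Y \<inter> set u)" and card: "2 \<le> card V"
    using V by (auto simp: multi_basis_def basis_def)
  have inj: "inj h" using bij[OF h] by (rule bij_is_inj)
  have u: "distinct u" "u \<noteq> []" "hd u \<in> Y" if "u \<in> V" for u using cut that by (auto simp: cutting_def)
  have "(\<Union>u\<in>map h ` V. set u) = h ` (\<Union>u\<in>V. set u)" by auto
  also have "\<dots> = Z" using cut permutes_image[OF permutes[OF h]] by (simp add: cutting_def)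
  finally have union: "(\<Union>u\<in>map h ` V. set u) = Z" .
  have each: "distinct (map h u) \<and> map h u \<noteq> [] \<and> hd (map h u) \<in> Y" if "u \<in> V" for u
    using u[OF that] inj_on_subset[OF inj] Y_invariant[OF h] by (auto simp: distinct_map hd_map)
  have disj: "set (map h u) \<inter> set (map h v) = {}" if "u \<in> V" "v \<in> V" "map h u \<noteq> map h v" for u v
  proof -
    have "u \<noteq> v" using that(3) by blast
    then have "set u \<inter> set v = {}" using that(1,2) cut by (simp add: cutting_def)
    then show ?thesis unfolding set_map image_Int[OF inj, symmetric] by simp
  qed
  have "cutting Z (map h ` V)"
    unfolding cutting_def
  proof (intro conjI ballI impI)
    fix v w assume "v \<in> map h ` V" "w \<in> map h ` V" "v \<noteq> w"
    then show "set v \<inter> set w = {}" using disj by (elim imageE) blast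
  qed (use union each in auto)
  moreover have "hd (map h u) = d (Y \<inter> set (map h u))" if "u \<in> V" for u
  proof -
    have "Y \<inter> set (map h u) = h ` (Y \<inter> set u)"
      using Y_invariant[OF h] by (metis image_Int inj set_map)
    then show ?thesis
      using d_equivariant[OF h proper_block[OF cut card that]] hd[OF that] u(2)[OF that] by (simp add: hd_map)
  qed
  moreover have "card (map h ` V) = card V"
    by (rule card_image) (use inj in \<open>auto simp: inj_on_def inj_map_eq_map\<close>)
  ultimately show ?thesis using card by (auto simp: multi_basis_def basis_def)
qed

lemma cutting_action: "right_action G multi_basis (\<lambda>V h. map h ` V)"
proof unfold_locales
  show "finite (carrier G)" by (rule fin_carrier)
  show "finite multi_basis" by (rule finite_multi_basis)
  show "map \<one> ` V = V" for V by (simp add: one)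
  show "map h ` map g ` V = map (g \<otimes> h) ` V" for V g h by (simp add: mult image_image)
qed (rule map_multi_basis)

text \<open>
  The group acts freely on words that contain all letters, so that each orbit sum is the norm of a word.
\<close>

lemma norm_start_words:
  "words.norm ` supported start_words = {f \<in> supported start_words. words.fixed (f :: 'a list \<Rightarrow> 'f :: field)}"
proof
  interpret norm: Vector_Spaces.linear fun_scale fun_scale "words.norm :: ('a list \<Rightarrow> 'f) \<Rightarrow> _" by (rule words.linear_norm)
  interpret W: right_action G start_words "\<lambda>w h. map h w" by (rule word_action)
  have act: "word_act (group_elem w :: 'a list \<Rightarrow> 'f) h = group_elem (map h w)" if "h \<in> carrier G" for w h
    using word_act_group_elem[OF bij[OF that]] .
  have "words.invariant (supported start_words :: ('a list \<Rightarrow> 'f) set)"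
    unfolding words.invariant_def
  proof (intro conjI ballI)
    show "fun_space.subspace (supported start_words :: ('a list \<Rightarrow> 'f) set)" by (rule subspace_supported)
    fix f :: "'a list \<Rightarrow> 'f" and h assume f: "f \<in> supported start_words" "h \<in> carrier G"
    have "w \<in> start_words" if "map (inv_into UNIV h) w \<in> start_words" for w
    proof -
      have "map h (map (inv_into UNIV h) w) = w" using bij[OF f(2)] by (simp add: bij_def surj_iff)
      then show ?thesis using W.act_closed[OF that f(2)] by simp
    qed
    then show "word_act f h \<in> supported start_words" using f(1) unfolding supported_def word_act_def by blast
  qed
  then show "words.norm ` supported start_words \<subseteq> {f \<in> supported start_words. words.fixed (f :: 'a list \<Rightarrow> 'f)}"
    using words.norm_in_invariant words.fixed_norm by blast
  have "{f \<in> supported start_words. words.fixed (f :: 'a list \<Rightarrow> 'f)} =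
      fun_space.span ((\<lambda>Q. \<Sum>w\<in>Q. group_elem w) ` W.orb ` start_words)"
    using words.fixed_permutation_basis(1)[OF word_action independent_group_elem[OF finite_start_words] act]
      span_group_elem[OF finite_start_words, where ?'b = 'f] by simp
  also have "\<dots> \<subseteq> words.norm ` supported start_words"
  proof (rule fun_space.span_minimal)
    show "fun_space.subspace (words.norm ` (supported start_words :: ('a list \<Rightarrow> 'f) set))"
      by (rule norm.subspace_image[OF subspace_supported])
    show "(\<lambda>Q. \<Sum>w\<in>Q. group_elem w) ` W.orb ` start_words \<subseteq> words.norm ` (supported start_words :: ('a list \<Rightarrow> 'f) set)"
    proof clarify
      fix w assume w: "w \<in> start_words"
      have wZ: "w \<in> permutations_of_set Z" using w by (simp add: start_words_def)
      have "inj_on (\<lambda>h. map h w) (carrier G)"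
      proof (rule inj_onI)
        fix g h assume gh: "g \<in> carrier G" "h \<in> carrier G" "map g w = map h w"
        have "map (g \<otimes> inv\<^bsub>G\<^esub> h) w = map (inv\<^bsub>G\<^esub> h) (map g w)" by (simp add: mult)
        also have "\<dots> = map (h \<otimes> inv\<^bsub>G\<^esub> h) w" unfolding gh(3) by (simp only: mult map_map)
        also have "\<dots> = w" using gh(2) by (simp add: one)
        finally have "g \<otimes> inv\<^bsub>G\<^esub> h = \<one>" using fixes_word[OF _ wZ] gh by simp
        then show "g = h" using gh by (metis inv_equality inv_inv inv_closed)
      qed
      then have "(\<Sum>v\<in>W.orb w. group_elem v) = words.norm (group_elem w :: 'a list \<Rightarrow> 'f)"
        unfolding words.norm_def W.orb_def Setcompr_eq_image by (simp add: sum.reindex act)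
      moreover have "group_elem w \<in> (supported start_words :: ('a list \<Rightarrow> 'f) set)"
        using w by (auto simp: supported_def group_elem_def)
      ultimately show "(\<Sum>v\<in>W.orb w. group_elem v) \<in> words.norm ` (supported start_words :: ('a list \<Rightarrow> 'f) set)" by auto
    qed
  qed
  finally show "{f \<in> supported start_words. words.fixed (f :: 'a list \<Rightarrow> 'f)} \<subseteq> words.norm ` supported start_words" .
qed

lemma norm_lie_map: "words.norm (lie_map Z f) = lie_map Z (words.norm f)"
  unfolding words.norm_def by (simp add: lie_map.sum lie_map_word_act[OF permutes])

text \<open>
  The norms of the image of \<open>lie_map\<close> are the images of the norms, which by \<open>norm_start_words\<close> are the
  images of the fixed vectors supported on \<open>start_words\<close>. Within the space of these fixed vectors, the
  kernel of \<open>lie_map\<close> consists of the fixed vectors in the span of a permuted basis. So both dimensions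
  count orbits, on \<open>start_words\<close> and on \<open>multi_basis\<close>. Multiplication by the order of the group turns
  them into sums of the orders of stabilizers, which are trivial on \<open>start_words\<close>.
\<close>

theorem rank_norm_lie:
  "order G * fun_dim (words.norm ` lie_map Z ` (supported (permutations_of_set Z) :: ('a list \<Rightarrow> 'f :: field) set))
     + (\<Sum>V\<in>multi_basis. card {h \<in> carrier G. map h ` V = V}) = card start_words"
proof -
  interpret W: right_action G start_words "\<lambda>w h. map h w" by (rule word_action)
  interpret C: right_action G multi_basis "\<lambda>V h. map h ` V" by (rule cutting_action)
  let ?A = "supported start_words :: ('a list \<Rightarrow> 'f) set"
  let ?F = "{f \<in> ?A. words.fixed f}"
  have "words.norm ` lie_map Z ` (supported (permutations_of_set Z) :: ('a list \<Rightarrow> 'f) set) = lie_map Z ` ?F"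
    unfolding lie_map_image_start_words norm_start_words[symmetric] by (simp add: image_image norm_lie_map)
  moreover have "fun_dim ?F = fun_dim (lie_map Z ` ?F) + fun_dim {f \<in> ?F. lie_map Z f = 0}"
  proof (rule rank_nullity_lie_map)
    show "fun_space.subspace ?F"
      using subspace_supported[of start_words] unfolding fun_space.subspace_def words.fixed_def
      by (auto simp: words.act_zero words.act_add words.act_scale)
    show "?F \<subseteq> supported (permutations_of_set Z)" by (auto simp: supported_def start_words_def)
  qed
  moreover have "fun_dim ?F = card (W.orb ` start_words)"
    unfolding span_group_elem[OF finite_start_words, symmetric]
    by (rule words.fixed_permutation_basis(2)[OF word_action independent_group_elem[OF finite_start_words]])
      (rule word_act_group_elem[OF bij])
  moreover have "fun_dim {f \<in> ?F. lie_map Z f = 0} = card (C.orb ` multi_basis)"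
  proof -
    have "{f \<in> ?F. lie_map Z f = 0} = {f \<in> fun_space.span (shuffle_sum ` multi_basis). words.fixed f}"
      unfolding kernel_lie_map[symmetric] by auto
    moreover have "independent_family fun_scale (shuffle_sum :: _ \<Rightarrow> 'a list \<Rightarrow> 'f) multi_basis"
      by (rule fun_space.independent_family_subset[OF shuffle_sum_basis(1) _ finite_basis[OF finite_Z]])
        (simp add: multi_basis_def)
    ultimately show ?thesis
      by (simp only:) (rule words.fixed_permutation_basis(2)[OF cutting_action _ word_act_shuffle_sum[OF bij]])
  qed
  moreover have "card (W.orb ` start_words) * order G = card start_words"
  proof -
    have "W.stab w = {\<one>}" if "w \<in> start_words" for w
      using that fixes_word[of _ w] one_closed by (auto simp: W.stab_def start_words_def one)
    then show ?thesis using W.sum_card_stab by simp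
  qed
  moreover have "card (C.orb ` multi_basis) * order G = (\<Sum>V\<in>multi_basis. card {h \<in> carrier G. map h ` V = V})"
    using C.sum_card_stab by (simp add: C.stab_def)
  ultimately have "card start_words = order G * (fun_dim (words.norm ` lie_map Z ` (supported (permutations_of_set Z) :: ('a list \<Rightarrow> 'f) set))
      + card (C.orb ` multi_basis))"
    and "(\<Sum>V\<in>multi_basis. card {h \<in> carrier G. map h ` V = V}) = order G * card (C.orb ` multi_basis)"
    by (simp_all only: mult.commute)
  then show ?thesis by (simp only: distrib_left)
qed

end

section \<open>p-groups of permutations with an invariant set of p letters\<close>

text \<open>
  The binomial coefficient is \<open>k\<close> times \<open>(k * p - 1) choose (p - 1)\<close>, and the numerator of the latter is
  the product of the numbers strictly between \<open>(k - 1) * p\<close> and \<open>k * p\<close>, none of which is divisible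
  by \<open>p\<close>.
\<close>

lemma not_dvd_binomial:
  fixes p k :: nat
  assumes p: "Factorial_Ring.prime p" and k: "1 \<le> k" "\<not> p dvd k"
  shows "\<not> p dvd (k * p choose p)"
proof
  assume dvd: "p dvd (k * p choose p)"
  have p0: "0 < p" using prime_gt_0_nat[OF p] .
  have "p * (k * p choose p) = k * p * ((k * p - 1) choose (p - 1))"
    by (rule times_binomial_minus1_eq[OF p0])
  then have "k * p choose p = k * ((k * p - 1) choose (p - 1))" using p0 by simp
  then have C: "p dvd ((k * p - 1) choose (p - 1))" using dvd k(2) prime_dvd_mult_iff[OF p] by metis
  have le: "p - 1 \<le> k * p - 1" using k(1) by (intro diff_le_mono) simp
  have kp: "k * p - 1 - (p - 1) = (k - 1) * p" using p0 k(1) by (simp add: diff_mult_distrib)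
  have "fact (p - 1) * fact ((k - 1) * p) * ((k * p - 1) choose (p - 1)) = (fact (k * p - 1) :: nat)"
    using binomial_fact_lemma[OF le] unfolding kp .
  also have "\<dots> = fact ((k - 1) * p) * \<Prod>{Suc ((k - 1) * p)..k * p - 1}"
  proof -
    have "(k - 1) * p \<le> k * p - 1" using p0 k(1) kp le by linarith
    then have "fact (k * p - 1) div fact ((k - 1) * p) = \<Prod>{Suc ((k - 1) * p)..k * p - 1}"
      using fact_div_fact[of "(k - 1) * p" "k * p - 1"] by simp
    moreover have "(fact ((k - 1) * p) :: nat) dvd fact (k * p - 1)" by (rule fact_dvd) fact
    ultimately show ?thesis by (metis dvd_mult_div_cancel)
  qed
  finally have "fact (p - 1) * ((k * p - 1) choose (p - 1)) = \<Prod>{Suc ((k - 1) * p)..k * p - 1}"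
    by (simp add: mult.commute mult.left_commute)
  then have "p dvd \<Prod>{Suc ((k - 1) * p)..k * p - 1}" using C by (metis dvd_mult)
  then obtain i where i: "i \<in> {Suc ((k - 1) * p)..k * p - 1}" "p dvd i"
    using prime_dvd_prod_iff[OF _ p, of "{Suc ((k - 1) * p)..k * p - 1}" "\<lambda>i. i"] by auto
  then obtain c where c: "i = p * c" by auto
  have "0 < k * p" using p0 k(1) by simp
  then have "(k - 1) * p < i" "i < k * p" using i(1) by auto
  then have "k - 1 < c" "c < k" unfolding c mult.commute[of p] mult_less_cancel2 by simp_all
  then show False by simp
qed

text \<open>
  The group acts on the \<open>p\<close>-element subsets of \<open>Z\<close>, whose number is not divisible by \<open>p\<close>.
\<close>

lemma ex_invariant_subset:
  fixes G :: "('a \<Rightarrow> 'a) monoid" (structure)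
  assumes G: "Group.group G" and fin: "finite Z" and card: "card Z = k * p"
    and p: "Factorial_Ring.prime p" and k: "1 \<le> k" "\<not> p dvd k" and order: "Coset.order G = p ^ m"
    and permutes: "\<And>h. h \<in> carrier G \<Longrightarrow> h permutes Z"
    and mult: "\<And>g h. g \<otimes> h = h \<circ> g" and one: "\<one> = id"
  obtains Y where "Y \<subseteq> Z" "card Y = p" "\<And>h. h \<in> carrier G \<Longrightarrow> h ` Y = Y"
proof -
  let ?E = "{Y. Y \<subseteq> Z \<and> card Y = p}"
  interpret A: right_action G ?E "\<lambda>Y h. h ` Y"
  proof (intro right_action.intro right_action_axioms.intro)
    show "Group.group G" by (rule G)
    show "finite (carrier G)" by (rule finite_subset[OF _ finite_permutations[OF fin]]) (use permutes in auto)
    show "finite ?E" by (rule finite_subset[of _ "Pow Z"]) (use fin in auto)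
    show "h ` Y \<in> ?E" if "Y \<in> ?E" "h \<in> carrier G" for Y h
      using that permutes_image[OF permutes[OF that(2)]] card_image[OF inj_on_subset[OF permutes_inj[OF permutes[OF that(2)]]], of Y]
      by (auto dest: image_mono)
    show "\<one> ` Y = Y" for Y by (simp add: one)
    show "h ` g ` Y = (g \<otimes> h) ` Y" for Y g h by (simp only: mult image_comp)
  qed
  have "card ?E = (k * p choose p)" using n_subsets[OF fin, of p] card by simp
  then have "card ?E mod p \<noteq> 0" using not_dvd_binomial[OF p k] by (simp add: dvd_eq_mod_eq_0)
  then have "card A.fixed_points \<noteq> 0" using A.card_fixed_points_mod[OF p order] by (metis mod_0)
  then have "A.fixed_points \<noteq> {}" by (rule contrapos_nn) (simp only: card.empty)
  then obtain Y where "Y \<in> A.fixed_points" by blast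
  then show thesis using that unfolding A.fixed_points_def by blast
qed

locale p_letter_group = group G for G :: "('a \<Rightarrow> 'a) monoid" (structure) +
  fixes Z Y :: "'a set" and p m :: nat
  assumes fin_Z: "finite Z" and YZ: "Y \<subseteq> Z" and card_Y: "card Y = p"
    and prime: "Factorial_Ring.prime p" and order: "order G = p ^ m"
    and permutes: "h \<in> carrier G \<Longrightarrow> h permutes Z"
    and mult: "g \<otimes> h = h \<circ> g" and one: "\<one> = id"
    and Y_inv: "h \<in> carrier G \<Longrightarrow> h ` Y = Y"
begin

lemma fin_carrier: "finite (carrier G)"
  by (rule finite_subset[OF _ finite_permutations[OF fin_Z]]) (use permutes in auto)

lemma fin_Y: "finite Y" and Y_nonempty: "Y \<noteq> {}"
  using finite_subset[OF YZ fin_Z] card_Y prime_gt_0_nat[OF prime] by auto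

lemma inj: "h \<in> carrier G \<Longrightarrow> inj h"
  using permutes permutes_inj by blast

lemma inv_apply: "h \<in> carrier G \<Longrightarrow> (inv h) (h x) = x" "h \<in> carrier G \<Longrightarrow> h ((inv h) x) = x"
  using r_inv[of h] l_inv[of h] unfolding mult one by (auto simp: fun_eq_iff)

lemma subgroup_action:
  assumes S: "subgroup S G" and T: "finite T" "\<And>h t. h \<in> S \<Longrightarrow> t \<in> T \<Longrightarrow> h t \<in> T"
  shows "right_action (G\<lparr>carrier := S\<rparr>) T (\<lambda>t h. h t)"
proof (intro right_action.intro right_action_axioms.intro)
  show "Group.group (G\<lparr>carrier := S\<rparr>)" using S by (rule subgroup_imp_group)
  show "finite (carrier (G\<lparr>carrier := S\<rparr>))" using finite_subset[OF subgroup.subset[OF S] fin_carrier] by simp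
qed (use T in \<open>auto simp: mult one\<close>)

lemma subgroup_card:
  assumes "subgroup S G"
  obtains i where "card S = p ^ i"
proof -
  have "card S dvd p ^ m" using lagrange_finite[OF fin_carrier assms] order by (metis dvd_triv_right)
  then show thesis using that divides_primepow_nat[OF prime] by auto
qed

lemma subgroup_fixed_points_mod:
  assumes S: "subgroup S G" and T: "finite T" "\<And>h t. h \<in> S \<Longrightarrow> t \<in> T \<Longrightarrow> h t \<in> T"
  shows "card {t \<in> T. \<forall>h\<in>S. h t = t} mod p = card T mod p"
proof -
  interpret A: right_action "G\<lparr>carrier := S\<rparr>" T "\<lambda>t h. h t" by (rule subgroup_action[OF S]) (use T in auto)
  obtain i where "card S = p ^ i" using subgroup_card[OF S] .
  then have "Coset.order (G\<lparr>carrier := S\<rparr>) = p ^ i" by (simp add: order_def)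
  from A.card_fixed_points_mod[OF prime this] show ?thesis by (simp add: A.fixed_points_def)
qed

lemma stabilizer_is_subgroup:
  assumes "\<And>g h. g \<in> carrier G \<Longrightarrow> h \<in> carrier G \<Longrightarrow> P g \<Longrightarrow> P h \<Longrightarrow> P (h \<circ> g)" "P id"
    "\<And>h. h \<in> carrier G \<Longrightarrow> P h \<Longrightarrow> P (inv h)"
  shows "subgroup {h \<in> carrier G. P h} G"
  by (rule subgroup.intro) (use assms one_closed in \<open>auto simp: one simp flip: mult\<close>)

text \<open>
  The number of letters of \<open>B\<close> that are fixed by \<open>S\<close> is divisible by \<open>p\<close>, at least \<open>1\<close> because of \<open>z\<close>, and
  at most \<open>p\<close>.
\<close>

lemma subgroup_fixing_letter:
  assumes S: "subgroup S G" and B: "finite B" "card B = p" "\<And>h b. h \<in> S \<Longrightarrow> b \<in> B \<Longrightarrow> h b \<in> B"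
    and z: "z \<in> B" "\<And>h. h \<in> S \<Longrightarrow> h z = z" and h: "h \<in> S" "b \<in> B"
  shows "h b = b"
proof -
  let ?F = "{t \<in> B. \<forall>h\<in>S. h t = t}"
  have "card ?F mod p = card B mod p"
    by (rule subgroup_fixed_points_mod[OF S B(1)]) (use B(3) in auto)
  then have "p dvd card ?F" using B(2) by auto
  moreover have "?F \<noteq> {}" using z by auto
  then have "card ?F > 0" using B(1) by (auto simp: card_gt_0_iff)
  ultimately have "card B \<le> card ?F" using B(2) dvd_imp_le by blast
  then have "?F = B" by (intro card_seteq[OF B(1)]) auto
  then show ?thesis using h by blast
qed

lemma funpow_in_subgroup:
  assumes S: "subgroup S G" and h: "h \<in> S"
  shows "h ^^ j \<in> S"
proof (induction j)
  case 0
  then show ?case using subgroup.one_closed[OF S] unfolding one funpow.simps .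
next
  case (Suc j)
  then show ?case using subgroup.m_closed[OF S Suc h] by (simp only: mult funpow.simps)
qed

lemma semiregular_inj:
  assumes S: "subgroup S G" and semi: "\<And>h. h \<in> S \<Longrightarrow> h y = y \<Longrightarrow> h = \<one>"
  shows "inj_on (\<lambda>h. h y) S"
proof (rule inj_onI)
  fix g h assume gh: "g \<in> S" "h \<in> S" "g y = h y"
  have G: "g \<in> carrier G" "h \<in> carrier G" using gh subgroup.mem_carrier[OF S] by auto
  have "g \<otimes> inv h \<in> S" using subgroup.m_closed[OF S gh(1) subgroup.m_inv_closed[OF S gh(2)]] .
  moreover have "(g \<otimes> inv h) y = y" using gh(3) inv_apply(1)[OF G(2)] by (simp add: mult)
  ultimately have "g \<otimes> inv h = \<one>" using semi by blast
  then show "g = h" using G by (metis inv_equality inv_inv inv_closed)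
qed

text \<open>
  The group elements are distinguished by their values at \<open>y\<close>, which lie in \<open>Y\<close>; so a nontrivial \<open>p\<close>-group
  \<open>S\<close> has order \<open>p\<close>.
\<close>

lemma semiregular_transitive:
  assumes S: "subgroup S G" "S \<noteq> {\<one>}" and semi: "\<And>h. h \<in> S \<Longrightarrow> h y = y \<Longrightarrow> h = \<one>" and y: "y \<in> Y"
  shows "card S = p" "(\<lambda>h. h y) ` S = Y"
proof -
  have inj: "inj_on (\<lambda>h. h y) S" by (rule semiregular_inj[OF S(1) semi])
  have sub: "(\<lambda>h. h y) ` S \<subseteq> Y" using Y_inv subgroup.mem_carrier[OF S(1)] y by blast
  have le: "card S \<le> p" using card_inj_on_le[OF inj sub fin_Y] card_Y by simp
  obtain i where i: "card S = p ^ i" using subgroup_card[OF S(1)] .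
  have "i \<noteq> 0"
  proof
    assume "i = 0"
    then have "card S = 1" using i by simp
    then show False using S(2) subgroup.one_closed[OF S(1)] by (auto simp: card_1_singleton_iff)
  qed
  moreover have "\<not> 1 < i"
  proof
    assume "1 < i"
    then have "p ^ 1 < p ^ i" using prime_gt_1_nat[OF prime] by (intro power_strict_increasing) auto
    then show False using le i by simp
  qed
  ultimately show card: "card S = p" using i by (cases i) auto
  have "card ((\<lambda>h. h y) ` S) = card Y" using card_image[OF inj] card card_Y by simp
  then show "(\<lambda>h. h y) ` S = Y" using card_subset_eq[OF fin_Y sub] by blast
qed

text \<open>
  As \<open>S\<close> has order \<open>p\<close>, it consists of the powers of \<open>h\<close>.
\<close>

lemma semiregular_cyclic:
  assumes S: "subgroup S G" and semi: "\<And>h. h \<in> S \<Longrightarrow> h y = y \<Longrightarrow> h = \<one>" and y: "y \<in> Y"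
    and h: "h \<in> S" "h \<noteq> \<one>"
  shows "h ^^ p = id" "inj_on (\<lambda>j. (h ^^ j) y) {0..<p}" "(\<lambda>j. (h ^^ j) y) ` {0..<p} = Y"
proof -
  have hG: "h \<in> carrier G" using h(1) subgroup.mem_carrier[OF S] by auto
  have pow: "h [^] j = h ^^ j" for j :: nat
    by (induction j) (simp_all add: one mult)
  have "S \<noteq> {\<one>}" using h by auto
  then have cardS: "card S = p" using semiregular_transitive[OF S _ semi y] by blast
  interpret SG: Group.group "G\<lparr>carrier := S\<rparr>" by (rule subgroup_imp_group[OF S])
  have "h [^]\<^bsub>G\<lparr>carrier := S\<rparr>\<^esub> Coset.order (G\<lparr>carrier := S\<rparr>) = \<one>\<^bsub>G\<lparr>carrier := S\<rparr>\<^esub>"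
    by (rule SG.pow_order_eq_1) (use h in simp)
  moreover have "h [^]\<^bsub>G\<lparr>carrier := S\<rparr>\<^esub> j = h [^] j" for j :: nat
    by (simp add: nat_pow_def)
  ultimately have "h [^] p = \<one>" using cardS by (simp add: order_def)
  then show hp: "h ^^ p = id" unfolding pow by (simp add: one)
  have ne: "(h ^^ i) y \<noteq> (h ^^ j) y" if ij: "i < j" "j < p" for i j
  proof
    assume eq: "(h ^^ i) y = (h ^^ j) y"
    have "h ^^ i = h ^^ j"
      using semiregular_inj[OF S semi] funpow_in_subgroup[OF S h(1)] eq by (auto simp: inj_on_def)
    moreover have "h ^^ j = h ^^ (j - i) \<circ> h ^^ i" using ij funpow_add[of "j - i" i h] by simp
    ultimately have "h ^^ (j - i) = id"
    proof -
      assume "h ^^ i = h ^^ j" "h ^^ j = h ^^ (j - i) \<circ> h ^^ i"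
      then have 1: "(h ^^ (j - i)) ((h ^^ i) x) = (h ^^ i) x" for x by (metis comp_apply)
      have "surj (h ^^ i)"
        using permutes[of "h ^^ i"] funpow_in_subgroup[OF S h(1), of i] subgroup.mem_carrier[OF S] permutes_surj by blast
      then show ?thesis using 1 by (metis eq_id_iff surjD)
    qed
    then have "h [^] (j - i) = \<one>" unfolding pow by (simp add: one)
    then have "ord h dvd j - i" using pow_eq_id[OF hG] by blast
    moreover have "ord h dvd p" using pow_eq_id[OF hG] \<open>h [^] p = \<one>\<close> by blast
    then have "ord h = 1 \<or> ord h = p" using prime by (simp add: prime_nat_iff)
    moreover have "ord h \<noteq> 1" using ord_eq_1[OF hG] h(2) by simp
    ultimately have "p dvd j - i" by auto
    then show False using ij dvd_imp_le[of p "j - i"] by simp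
  qed
  show inj: "inj_on (\<lambda>j. (h ^^ j) y) {0..<p}"
  proof (rule inj_onI)
    fix i j assume ij: "i \<in> {0..<p}" "j \<in> {0..<p}" "(h ^^ i) y = (h ^^ j) y"
    consider "i < j" | "j < i" | "i = j" by linarith
    then show "i = j" using ne[of i j] ne[of j i] ij by cases auto
  qed
  have "(\<lambda>j. (h ^^ j) y) ` {0..<p} \<subseteq> Y"
    using Y_inv subgroup.mem_carrier[OF S funpow_in_subgroup[OF S h(1)]] y by blast
  moreover have "card ((\<lambda>j. (h ^^ j) y) ` {0..<p}) = card Y" using card_image[OF inj] card_Y by simp
  ultimately show "(\<lambda>j. (h ^^ j) y) ` {0..<p} = Y" using card_subset_eq[OF fin_Y] by blast
qed

lemma fixes_letter_imp_fixes_Y: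
  assumes h: "h \<in> carrier G" and y: "y \<in> Y" "h y = y" and z: "z \<in> Y"
  shows "h z = z"
proof -
  have S: "subgroup {h \<in> carrier G. h y = y} G"
    by (rule stabilizer_is_subgroup) (auto, metis inv_apply(1))
  show ?thesis
    by (rule subgroup_fixing_letter[OF S fin_Y card_Y _ y(1)]) (use Y_inv h y(2) z in auto)
qed

text \<open>
  A \<open>p\<close>-group that stabilizes \<open>C\<close> fixes some letter of \<open>C\<close>, because the size of \<open>C\<close> is not divisible by
  \<open>p\<close>. Apply this to the stabilizer of \<open>C\<close> and then \<open>fixes_letter_imp_fixes_Y\<close>.
\<close>

lemma stabilizes_block_imp_fixes_Y:
  assumes h: "h \<in> carrier G" and C: "C \<subset> Y" "C \<noteq> {}" "h ` C = C" and z: "z \<in> Y"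
  shows "h z = z"
proof -
  let ?S = "{h \<in> carrier G. h ` C = C}"
  have finC: "finite C" using C(1) fin_Y finite_subset by blast
  have S: "subgroup ?S G"
  proof (rule stabilizer_is_subgroup)
    fix h assume h: "h \<in> carrier G" "h ` C = C"
    have "(inv h) ` C = (inv h) ` h ` C" using h(2) by simp
    also have "\<dots> = C" using inv_apply(1)[OF h(1)] by (simp add: image_image)
    finally show "(inv h) ` C = C" .
  qed (simp_all only: image_comp[symmetric] image_id id_apply)
  have "card {t \<in> C. \<forall>h\<in>?S. h t = t} mod p = card C mod p"
    by (rule subgroup_fixed_points_mod[OF S finC]) auto
  moreover have "0 < card C" "card C < p" using C finC psubset_card_mono[OF fin_Y C(1)] card_Y by (auto simp: card_gt_0_iff)
  ultimately have "card {t \<in> C. \<forall>h\<in>?S. h t = t} \<noteq> 0" by (metis mod_0 mod_less less_irrefl)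
  then have "{t \<in> C. \<forall>h\<in>?S. h t = t} \<noteq> {}" by (rule contrapos_nn) (simp only: card.empty)
  then obtain t where "t \<in> C" "\<forall>h\<in>?S. h t = t" by blast
  then show ?thesis using fixes_letter_imp_fixes_Y[OF h, of t] C z h by auto
qed

text \<open>
  Choose a representative in every orbit of proper nonempty subsets and a letter in it, and transport
  this letter to the other members of the orbit. The result is independent of the transporting group
  elements, because two of them differ by an element of the stabilizer of a proper nonempty subset, and
  such an element fixes \<open>Y\<close> pointwise.
\<close>

lemma ex_equivariant_choice:
  obtains d where "\<And>B. B \<subseteq> Y \<Longrightarrow> B \<noteq> {} \<Longrightarrow> d B \<in> B"
    "\<And>h B. h \<in> carrier G \<Longrightarrow> B \<subset> Y \<Longrightarrow> B \<noteq> {} \<Longrightarrow> d (h ` B) = h (d B)"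
proof -
  define orb where "orb B = {h ` B |h. h \<in> carrier G}" for B :: "'a set"
  define rep where "rep B = (SOME C. C \<in> orb B)" for B
  define k where "k B = (SOME h. h \<in> carrier G \<and> h ` rep B = B)" for B
  define c where "c C = (SOME x. x \<in> C)" for C :: "'a set"
  define d where "d B = (if B = Y then c Y else k B (c (rep B)))" for B
  have repB: "rep B \<in> orb B" for B
  proof -
    have "id ` B \<in> orb B" using one_closed unfolding orb_def one by blast
    then show ?thesis unfolding rep_def by (rule someI)
  qed
  have kB: "k B \<in> carrier G \<and> k B ` rep B = B" for B
  proof -
    obtain h where h: "h \<in> carrier G" "rep B = h ` B" using repB[of B] unfolding orb_def by blast
    then have "inv h \<in> carrier G \<and> (inv h) ` rep B = B" using inv_apply(1)[OF h(1)] by (simp add: image_image)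
    then show ?thesis unfolding k_def by (rule someI[of "\<lambda>h. h \<in> carrier G \<and> h ` rep B = B"])
  qed
  have orb_eq: "orb (h ` B) = orb B" if h: "h \<in> carrier G" for h B
  proof
    show "orb (h ` B) \<subseteq> orb B"
    proof
      fix C assume "C \<in> orb (h ` B)"
      then obtain g where g: "g \<in> carrier G" "C = g ` h ` B" by (auto simp: orb_def)
      then have "C = (h \<otimes> g) ` B" by (simp add: mult image_comp)
      then show "C \<in> orb B" using g h unfolding orb_def by blast
    qed
    show "orb B \<subseteq> orb (h ` B)"
    proof
      fix C assume "C \<in> orb B"
      then obtain g where g: "g \<in> carrier G" "C = g ` B" by (auto simp: orb_def)
      have "(inv h \<otimes> g) ` h ` B = g ` (inv h) ` h ` B" by (simp add: mult image_comp)
      also have "\<dots> = C" using inv_apply(1)[OF h] g(2) by (simp add: image_image)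
      finally show "C \<in> orb (h ` B)" using g h unfolding orb_def by blast
    qed
  qed
  have card_rep: "rep B \<subset> Y" "rep B \<noteq> {}" if B: "B \<subset> Y" "B \<noteq> {}" for B
  proof -
    obtain h where h: "h \<in> carrier G" "rep B = h ` B" using repB[of B] unfolding orb_def by blast
    show "rep B \<noteq> {}" using h(2) B by simp
    have "h ` B \<subset> h ` Y" using B(1) inj_image_subset_iff[OF inj[OF h(1)]] by (simp add: psubset_eq inj_image_eq_iff[OF inj[OF h(1)]])
    then show "rep B \<subset> Y" using h Y_inv by simp
  qed
  have c_in: "c C \<in> C" if "C \<noteq> {}" for C unfolding c_def using that some_in_eq by blast
  show thesis
  proof
    fix B assume B: "B \<subseteq> Y" "B \<noteq> {}"
    show "d B \<in> B"
    proof (cases "B = Y")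
      case True
      then show ?thesis using c_in[OF B(2)] by (simp add: d_def)
    next
      case False
      then have "rep B \<noteq> {}" using card_rep(2)[of B] B by blast
      then have "k B (c (rep B)) \<in> k B ` rep B" using c_in by blast
      then show ?thesis using kB False by (simp add: d_def)
    qed
  next
    fix h B assume h: "h \<in> carrier G" and B: "B \<subset> Y" "B \<noteq> {}"
    have rep: "rep (h ` B) = rep B" unfolding rep_def orb_eq[OF h] ..
    let ?g = "k B" and ?g' = "k (h ` B)" and ?C = "rep B"
    have g: "?g \<in> carrier G" "?g ` ?C = B" "?g' \<in> carrier G" "?g' ` ?C = h ` B" using kB[of B] kB[of "h ` B"] rep by auto
    \<comment> \<open>Both \<open>h \<circ> ?g\<close> and \<open>?g'\<close> carry the representative \<open>?C\<close> to \<open>h ` B\<close>, so \<open>?r\<close> stabilizes \<open>?C\<close>.\<close>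
    let ?r = "(?g \<otimes> h) \<otimes> inv ?g'"
    have r: "?r \<in> carrier G" using g h by simp
    have r_apply: "?r x = (inv ?g') (h (?g x))" for x by (simp add: mult)
    have "?r ` ?C = (inv ?g') ` (h ` (?g ` ?C))" by (simp add: mult image_comp comp_assoc)
    also have "\<dots> = (inv ?g') ` ?g' ` ?C" using g by simp
    also have "\<dots> = ?C" using inv_apply(1)[OF g(3)] by (simp add: image_image)
    finally have "?r ` ?C = ?C" .
    moreover have "c ?C \<in> Y" using c_in card_rep[OF B] by blast
    ultimately have "?r (c ?C) = c ?C"
      using stabilizes_block_imp_fixes_Y[OF r card_rep[OF B]] by blast
    then have "h (?g (c ?C)) = ?g' (c ?C)" using inv_apply(2)[OF g(3)] r_apply by metis
    moreover have "h ` B \<noteq> Y" using B(1) Y_inv[OF h] inj_image_eq_iff[OF inj[OF h], of B Y] by auto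
    ultimately show "d (h ` B) = h (d B)" using B(1) rep by (auto simp: d_def)
  qed
qed

end

locale p_letter_substitution = p_letter_group G Z Y p m + letter_substitution Z Y d G
  for G :: "('a \<Rightarrow> 'a) monoid" (structure) and Z Y p m d
begin

definition cut_stab :: "'a list set \<Rightarrow> ('a \<Rightarrow> 'a) set" where
  "cut_stab V = {h \<in> carrier G. map h ` V = V}"

lemma cut_stab_subgroup: "subgroup (cut_stab V) G"
  unfolding cut_stab_def
proof (rule stabilizer_is_subgroup)
  fix h assume h: "h \<in> carrier G" "map h ` V = V"
  have "map (inv h) ` map h ` V = V" using inv_apply(1)[OF h(1)] by (simp add: image_image comp_def)
  then show "map (inv h) ` V = V" using h(2) by simp
qed (simp_all only: map_comp_map[symmetric] image_comp[symmetric] list.map_id0 image_id id_apply)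

lemma common_letter:
  "cutting Z V \<Longrightarrow> u \<in> V \<Longrightarrow> v \<in> V \<Longrightarrow> x \<in> set u \<Longrightarrow> x \<in> set v \<Longrightarrow> u = v"
  unfolding cutting_def by blast

text \<open>
  By \<open>fixes_letter_imp_fixes_Y\<close>, \<open>h\<close> fixes the first letter of every word of the cutting. So it maps every
  word to itself.
\<close>

lemma cut_stab_semiregular:
  assumes V: "cutting Z V" and h: "h \<in> cut_stab V" "h y = y" "y \<in> Y"
  shows "h = \<one>"
proof -
  have hG: "h \<in> carrier G" and hV: "map h ` V = V" using h(1) by (auto simp: cut_stab_def)
  have fixY: "h z = z" if "z \<in> Y" for z using fixes_letter_imp_fixes_Y[OF hG h(3,2) that] .
  have "h x = x" if x: "x \<in> Z" for x
  proof -
    obtain u where u: "u \<in> V" "x \<in> set u" using V x by (auto simp: cutting_def)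
    have "u \<noteq> []" "hd u \<in> Y" using V u(1) by (auto simp: cutting_def)
    then have "hd u \<in> set u" "hd u \<in> set (map h u)" using fixY[of "hd u"] hd_in_set[of u] by (auto, metis imageI)
    moreover have "map h u \<in> V" using hV u(1) by blast
    ultimately have "map h u = u" using common_letter[OF V] u(1) by blast
    then show ?thesis using u(2) map_eq_conv[of h u id] by simp
  qed
  then have "h x = x" for x using permutes_not_in[OF permutes[OF hG]] by (cases "x \<in> Z") auto
  then show ?thesis by (auto simp: one)
qed

lemma cut_stab_inj:
  assumes V: "cutting Z V" and y: "y \<in> Y"
  shows "inj_on (\<lambda>h. h y) (cut_stab V)"
  by (rule semiregular_inj[OF cut_stab_subgroup]) (rule cut_stab_semiregular[OF V _ _ y])

lemma card_cut_stab:
  assumes V: "cutting Z V" and nontrivial: "cut_stab V \<noteq> {\<one>}"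
  shows "card (cut_stab V) = p"
proof -
  obtain y where y: "y \<in> Y" using Y_nonempty by auto
  show ?thesis
    by (rule semiregular_transitive(1)[OF cut_stab_subgroup nontrivial _ y]) (rule cut_stab_semiregular[OF V _ _ y])
qed

definition symmetric_cuts :: "'a list set set" where
  "symmetric_cuts = {V \<in> multi_basis. cut_stab V \<noteq> {\<one>}}"

text \<open>
  In \<open>rank_norm_lie\<close>, a cutting of \<open>multi_basis\<close> contributes \<open>p\<close> to the sum if it is symmetric and \<open>1\<close>
  otherwise, and the contributions of \<open>1\<close> are absorbed by \<open>card_multi_basis\<close>.
\<close>

theorem rank_norm_lie_p:
  "order G * fun_dim (words.norm ` lie_map Z ` (supported (permutations_of_set Z) :: ('a list \<Rightarrow> 'f :: field) set))
     + (p - 1) * card symmetric_cuts = fact (card Z - 1)"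
proof -
  have p0: "0 < p" using prime_gt_0_nat[OF prime] .
  have "card (cut_stab V) = 1 + (if V \<in> symmetric_cuts then p - 1 else 0)" if "V \<in> multi_basis" for V
  proof -
    have cut: "cutting Z V" using that by (auto simp: multi_basis_def basis_def)
    show ?thesis using card_cut_stab[OF cut] that p0 by (cases "cut_stab V = {\<one>}") (auto simp: symmetric_cuts_def)
  qed
  then have "(\<Sum>V\<in>multi_basis. card (cut_stab V)) = (\<Sum>V\<in>multi_basis. 1 + (if V \<in> symmetric_cuts then p - 1 else 0))"
    by (intro sum.cong) auto
  also have "\<dots> = card multi_basis + (p - 1) * card symmetric_cuts"
  proof -
    have "multi_basis \<inter> symmetric_cuts = symmetric_cuts" by (auto simp: symmetric_cuts_def)
    then show ?thesis
      using finite_multi_basis unfolding sum.distrib by (simp add: sum.inter_restrict[symmetric])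
  qed
  finally have s: "(\<Sum>V\<in>multi_basis. card {h \<in> carrier G. map h ` V = V}) = card multi_basis + (p - 1) * card symmetric_cuts"
    by (simp add: cut_stab_def)
  show ?thesis
    using rank_norm_lie[where ?'f = 'f] card_multi_basis unfolding s by linarith
qed

end

section \<open>Counting symmetric cuttings\<close>

lemma position_cases:
  fixes q k p :: nat
  assumes "q \<in> {1..k * p}"
  obtains i j where "i < k" "j \<in> {1..p}" "q = i * p + j"
proof
  have p: "0 < p" using assms by (cases p) auto
  have "q - 1 < k * p" using assms by auto
  then show "(q - 1) div p < k" by (simp add: less_mult_imp_div_less)
  show "(q - 1) mod p + 1 \<in> {1..p}" using p by (simp add: Suc_leI)
  show "q = (q - 1) div p * p + ((q - 1) mod p + 1)" using assms div_mult_mod_eq[of "q - 1" p] by simp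
qed

lemma position_in:
  fixes i j k p :: nat
  assumes "i < k" "j \<in> {1..p}"
  shows "i * p + j \<in> {1..k * p}"
proof -
  have "Suc i * p \<le> k * p" using assms(1) by (intro mult_le_mono1) auto
  then show ?thesis using assms(2) by auto
qed

lemma position_div:
  fixes i j p :: nat
  assumes "j \<in> {1..p}"
  shows "(i * p + j - 1) div p = i" "(i * p + j - 1) mod p = j - 1"
proof -
  have "i * p + j - 1 = (j - 1) + i * p" "j - 1 < p" using assms by auto
  then show "(i * p + j - 1) div p = i" "(i * p + j - 1) mod p = j - 1"
    by (simp_all only: div_mult_self3 mod_mult_self3) auto
qed

lemma position_inj:
  fixes i i' j j' p :: nat
  assumes "j \<in> {1..p}" "j' \<in> {1..p}" "i * p + j = i' * p + j'"
  shows "i = i'" "j = j'"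
proof -
  show "i = i'" using position_div(1)[OF assms(1), of i] position_div(1)[OF assms(2), of i'] assms(3) by simp
  then show "j = j'" using assms(3) by simp
qed

lemma diag_perm_at: "i < k \<Longrightarrow> j \<in> {1..p} \<Longrightarrow> diag_perm p k \<tau> (i * p + j) = i * p + \<tau> j"
  using diag_perm_apply[of "Suc i" k j p \<tau>] by simp

lemma block_perm_at: "i < k \<Longrightarrow> j \<in> {1..p} \<Longrightarrow> block_perm p k \<sigma> (i * p + j) = (\<sigma> (Suc i) - 1) * p + j"
  using block_perm_apply[of "Suc i" k j p \<sigma>] by simp

lemma diag_perm_outside: "q \<notin> {1..k * p} \<Longrightarrow> diag_perm p k \<tau> q = q"
  and block_perm_outside: "q \<notin> {1..k * p} \<Longrightarrow> block_perm p k \<sigma> q = q"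
  by (auto simp: diag_perm_def block_perm_def)

lemma eq_on_positions:
  fixes k p :: nat
  assumes "\<And>i j. i < k \<Longrightarrow> j \<in> {1..p} \<Longrightarrow> f (i * p + j) = g (i * p + j)" "\<And>q. q \<notin> {1..k * p} \<Longrightarrow> f q = g q"
  shows "f = g"
proof
  fix q show "f q = g q"
  proof (cases "q \<in> {1..k * p}")
    case True
    obtain i j where "i < k" "j \<in> {1..p}" "q = i * p + j" by (rule position_cases[OF True])
    then show ?thesis using assms(1) by simp
  qed (rule assms(2))
qed

definition cycle_shift :: "nat \<Rightarrow> nat \<Rightarrow> nat" where
  "cycle_shift p j = (if j \<in> {1..<p} then Suc j else if j = p then 1 else j)"

lemma cycle_shift_permutes:
  assumes "0 < p"
  shows "cycle_shift p permutes {1..p}"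
proof -
  have "bij_betw (cycle_shift p) {1..p} {1..p}"
    by (rule bij_betwI[where g = "\<lambda>j. if j = 1 then p else j - 1"]) (use assms in \<open>auto simp: cycle_shift_def\<close>)
  then show ?thesis by (rule bij_imp_permutes) (use assms in \<open>auto simp: cycle_shift_def\<close>)
qed

lemma cycle_shift_in: "j \<in> {1..p} \<Longrightarrow> cycle_shift p j \<in> {1..p}"
  using permutes_in_image[OF cycle_shift_permutes, of p j] by simp

definition shift :: "nat \<Rightarrow> nat \<Rightarrow> nat \<Rightarrow> nat" where
  "shift p k = diag_perm p k (cycle_shift p)"

lemma shift_at: "i < k \<Longrightarrow> j \<in> {1..p} \<Longrightarrow> shift p k (i * p + j) = i * p + cycle_shift p j"
  unfolding shift_def by (rule diag_perm_at)

text \<open>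
  Iterating the shift runs through each block, so that \<open>x\<close> is determined by \<open>h\<close> and by its values at the
  starts of the blocks.
\<close>

lemma shift_orbit:
  assumes "\<And>q. q \<in> {1..k * p} \<Longrightarrow> x (shift p k q) = h (x q)" "i < k" "j < p"
  shows "x (i * p + Suc j) = (h ^^ j) (x (i * p + 1))"
  using assms(3)
proof (induction j)
  case (Suc j)
  have j: "Suc j \<in> {1..p}" "cycle_shift p (Suc j) = Suc (Suc j)" using Suc.prems by (auto simp: cycle_shift_def)
  have "x (i * p + Suc (Suc j)) = x (shift p k (i * p + Suc j))"
    using shift_at[OF assms(2) j(1)] j(2) by simp
  also have "\<dots> = h (x (i * p + Suc j))" using assms(1) position_in[OF assms(2) j(1)] by simp
  finally show ?case using Suc by simp
qed simp

locale block_letters = p_letter_substitution G "{1..k * p}" Y p m d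
  for G :: "(nat \<Rightarrow> nat) monoid" (structure) and k Y p m d +
  fixes y0 y1 :: nat
  assumes k1: "1 \<le> k" and y01: "y0 \<in> Y" "y1 \<in> Y" "y0 \<noteq> y1"
begin

lemma p2: "2 \<le> p" using prime_ge_2_nat[OF prime] .

lemma p0: "0 < p" using p2 by simp

text \<open>
  Write the values of \<open>x\<close> into an array with \<open>k\<close> rows, one for each block of \<open>p\<close> positions. The words of
  \<open>cut_of x\<close> are the \<open>p\<close> columns.
\<close>

definition word_of :: "(nat \<Rightarrow> nat) \<Rightarrow> nat \<Rightarrow> nat list" where
  "word_of x j = map (\<lambda>i. x (i * p + j)) [0..<k]"

definition cut_of :: "(nat \<Rightarrow> nat) \<Rightarrow> nat list set" where
  "cut_of x = word_of x ` {1..p}"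

text \<open>
  A symmetric cutting determines such an array up to the choice of the first column and of the nontrivial
  element \<open>h\<close> of the stabilizer that moves each column to the next one. The two conditions \<open>x 1 = y0\<close> and
  \<open>x 2 = y1\<close> fix both, as \<open>h y0 = y1\<close>.
\<close>

definition intertwiners :: "(nat \<Rightarrow> nat) set" where
  "intertwiners = {x. x permutes {1..k * p} \<and> x 1 = y0 \<and> x 2 = y1 \<and>
     (\<exists>h\<in>carrier G. h \<circ> x = x \<circ> shift p k)}"

lemma set_word_of: "set (word_of x j) = {x (i * p + j) |i. i < k}"
  by (auto simp: word_of_def)

lemma hd_word_of: "hd (word_of x j) = x j" "word_of x j \<noteq> []"
  using k1 by (auto simp: word_of_def upt_conv_Cons)

lemma length_word_of: "length (word_of x j) = k"
  by (simp add: word_of_def)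

lemma nth_word_of: "i < k \<Longrightarrow> word_of x j ! i = x (i * p + j)"
  by (simp add: word_of_def)

lemma intertwiner_orbit:
  assumes "h \<circ> x = x \<circ> shift p k" "i < k" "j < p"
  shows "x (i * p + Suc j) = (h ^^ j) (x (i * p + 1))"
  by (rule shift_orbit[of k p x h i j]) (use assms in \<open>auto simp: fun_eq_iff\<close>)

text \<open>
  The first row of the array is \<open>Y\<close>, so that each column contains exactly one letter of \<open>Y\<close>, its first,
  and has to be selected by \<open>d\<close>; and \<open>h\<close> permutes the columns cyclically.
\<close>

lemma intertwiner_cut:
  assumes x: "x permutes {1..k * p}" "x 1 = y0" "x 2 = y1" and h: "h \<in> carrier G" "h \<circ> x = x \<circ> shift p k"
  shows "cut_of x \<in> symmetric_cuts" "h \<in> cut_stab (cut_of x)" "h y0 = y1"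
proof -
  have inj: "inj x" using permutes_inj[OF x(1)] .
  have start: "x j \<in> Y" if j: "j \<in> {1..p}" for j
  proof -
    obtain i where i: "j = Suc i" "i < p" using j by (cases j) auto
    have "x j = (h ^^ i) y0" using intertwiner_orbit[OF h(2), of 0 i] k1 i x(2) by simp
    moreover have "h ^^ i \<in> carrier G" by (rule funpow_in_subgroup[OF subgroup_self h(1)])
    ultimately show ?thesis using Y_inv y01(1) by blast
  qed
  have "x ` {1..p} = Y"
  proof (rule card_subset_eq[OF fin_Y])
    show "x ` {1..p} \<subseteq> Y" using start by auto
    show "card (x ` {1..p}) = card Y" using card_image[OF inj_on_subset[OF inj]] card_Y by simp
  qed
  have block: "Y \<inter> set (word_of x j) = {x j}" if j: "j \<in> {1..p}" for j
  proof
    show "{x j} \<subseteq> Y \<inter> set (word_of x j)" using start[OF j] hd_word_of[of x j] hd_in_set by fastforce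
    show "Y \<inter> set (word_of x j) \<subseteq> {x j}"
    proof
      fix z assume "z \<in> Y \<inter> set (word_of x j)"
      then obtain j' i where z: "j' \<in> {1..p}" "z = x j'" "i < k" "z = x (i * p + j)"
        using \<open>x ` {1..p} = Y\<close> unfolding set_word_of by blast
      then have "0 * p + j' = i * p + j" using inj by (simp add: inj_eq)
      then have "j' = j" using position_inj(2)[OF z(1) j] by blast
      then show "z \<in> {x j}" using z by simp
    qed
  qed
  have cut: "cutting {1..k * p} (cut_of x)"
    unfolding cutting_def
  proof (intro conjI ballI impI)
    show "(\<Union>u\<in>cut_of x. set u) = {1..k * p}"
    proof
      show "(\<Union>u\<in>cut_of x. set u) \<subseteq> {1..k * p}"
        unfolding cut_of_def set_word_of using permutes_in_image[OF x(1)] position_in[of _ k _ p] set_word_of by fastforce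
      show "{1..k * p} \<subseteq> (\<Union>u\<in>cut_of x. set u)"
      proof
        fix z assume "z \<in> {1..k * p}"
        then obtain q where q: "q \<in> {1..k * p}" "z = x q" using permutes_image[OF x(1)] by blast
        obtain i j where "i < k" "j \<in> {1..p}" "q = i * p + j" by (rule position_cases[OF q(1)])
        then show "z \<in> (\<Union>u\<in>cut_of x. set u)" using q unfolding cut_of_def by (auto simp: set_word_of)
      qed
    qed
    fix u assume "u \<in> cut_of x"
    then obtain j where j: "j \<in> {1..p}" "u = word_of x j" by (auto simp: cut_of_def)
    show "u \<noteq> []" "hd u \<in> Y" using hd_word_of j start by auto
    have "inj_on (\<lambda>i. x (i * p + j)) (set [0..<k])"
      by (rule inj_onI) (use inj p2 in \<open>auto simp: inj_eq\<close>)
    then show "distinct u" unfolding j(2) word_of_def by (simp add: distinct_map)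
    fix v assume "v \<in> cut_of x" "u \<noteq> v"
    then obtain j' where j': "j' \<in> {1..p}" "v = word_of x j'" by (auto simp: cut_of_def)
    show "set u \<inter> set v = {}"
    proof (rule ccontr)
      assume "set u \<inter> set v \<noteq> {}"
      then obtain i i' where "x (i * p + j) = x (i' * p + j')" unfolding j j' set_word_of by blast
      then have "j = j'" using position_inj(2)[OF j(1) j'(1)] inj by (simp add: inj_eq)
      then show False using \<open>u \<noteq> v\<close> j j' by simp
    qed
  qed
  have inj_w: "inj_on (word_of x) {1..p}"
  proof (rule inj_onI)
    fix j j' assume "j \<in> {1..p}" "j' \<in> {1..p}" "word_of x j = word_of x j'"
    then have "x j = x j'" using hd_word_of(1) by metis
    then show "j = j'" using inj by (simp add: inj_eq)
  qed
  have "card (cut_of x) = p" unfolding cut_of_def using card_image[OF inj_w] by simp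
  moreover have "hd u = d (Y \<inter> set u)" if u: "u \<in> cut_of x" for u
  proof -
    obtain j where j: "j \<in> {1..p}" "u = word_of x j" using u by (auto simp: cut_of_def)
    have "d {x j} \<in> {x j}" using start[OF j(1)] by (intro d) auto
    then show ?thesis using block[OF j(1)] j(2) hd_word_of by simp
  qed
  ultimately have multi: "cut_of x \<in> multi_basis"
    using cut p2 unfolding multi_basis_def basis_def mem_Collect_eq by (simp del: One_nat_def)
  have "map h (word_of x j) = word_of x (cycle_shift p j)" if "j \<in> {1..p}" for j
  proof -
    have "h (x (i * p + j)) = x (i * p + cycle_shift p j)" if "i < k" for i
      using fun_cong[OF h(2), of "i * p + j"] shift_at[OF that \<open>j \<in> {1..p}\<close>] by simp
    then show ?thesis by (simp add: word_of_def)
  qed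
  then have "map h ` cut_of x = word_of x ` cycle_shift p ` {1..p}"
    unfolding cut_of_def image_image by (intro image_cong) auto
  then have "map h ` cut_of x = cut_of x" unfolding permutes_image[OF cycle_shift_permutes[OF p0]] cut_of_def .
  then show stab: "h \<in> cut_stab (cut_of x)" using h(1) by (simp add: cut_stab_def)
  show h01: "h y0 = y1"
    using intertwiner_orbit[OF h(2), of 0 1] k1 p2 x by (simp add: numeral_2_eq_2)
  then have "h \<noteq> \<one>" using y01(3) by (auto simp: one)
  then show "cut_of x \<in> symmetric_cuts" using multi stab unfolding symmetric_cuts_def by blast
qed

text \<open>
  As \<open>h\<close> belongs to the stabilizer of the cutting, it is determined by \<open>h y0 = y1\<close>; and the first column is
  the word that contains \<open>y0\<close>.
\<close>

lemma cut_of_inj: "inj_on cut_of intertwiners"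
proof (rule inj_onI)
  fix x x' assume X: "x \<in> intertwiners" "x' \<in> intertwiners" "cut_of x = cut_of x'"
  obtain h where x: "x permutes {1..k * p}" "x 1 = y0" "x 2 = y1" "h \<in> carrier G" "h \<circ> x = x \<circ> shift p k"
    using X(1) by (auto simp: intertwiners_def)
  obtain h' where x': "x' permutes {1..k * p}" "x' 1 = y0" "x' 2 = y1" "h' \<in> carrier G" "h' \<circ> x' = x' \<circ> shift p k"
    using X(2) by (auto simp: intertwiners_def)
  note c = intertwiner_cut[OF x] and c' = intertwiner_cut[OF x']
  have cut: "cutting {1..k * p} (cut_of x)" using c(1) unfolding symmetric_cuts_def multi_basis_def basis_def by blast
  have "h = h'"
    using cut_stab_inj[OF cut y01(1)] c(2,3) c'(2,3) X(3) by (auto simp: inj_on_def)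
  have "word_of x 1 = word_of x' 1"
  proof (rule common_letter[OF cut])
    show "word_of x 1 \<in> cut_of x" "word_of x' 1 \<in> cut_of x" using X(3) p2 by (auto simp: cut_of_def)
    show "y0 \<in> set (word_of x 1)" "y0 \<in> set (word_of x' 1)"
      using hd_word_of[of x 1] hd_word_of[of x' 1] x x' hd_in_set by metis+
  qed
  then have start: "x (i * p + 1) = x' (i * p + 1)" if "i < k" for i
    using nth_word_of[OF that, of x 1] nth_word_of[OF that, of x' 1] by simp
  show "x = x'"
  proof (rule eq_on_positions[of k p])
    fix i j assume ij: "i < k" "j \<in> {1..p}"
    then obtain j' where "j = Suc j'" "j' < p" by (cases j) auto
    then show "x (i * p + j) = x' (i * p + j)"
      using intertwiner_orbit[OF x(5) ij(1)] intertwiner_orbit[OF x'(5) ij(1)] start[OF ij(1)] \<open>h = h'\<close> by simp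
  next
    fix q assume "q \<notin> {1..k * p}"
    then show "x q = x' q" using permutes_not_in[OF x(1)] permutes_not_in[OF x'(1)] by simp
  qed
qed

text \<open>
  The stabilizer of a symmetric cutting is cyclic of order \<open>p\<close> and transitive on \<open>Y\<close>, and it contains an
  \<open>h\<close> with \<open>h y0 = y1\<close>. The word \<open>u\<close> that contains \<open>y0\<close> contains no other letter of \<open>Y\<close>, because a
  group element carrying \<open>y0\<close> to such a letter would map \<open>u\<close> to itself. Hence the cutting consists of
  the images of \<open>u\<close> under the \<open>p\<close> powers of \<open>h\<close>, and \<open>u\<close> has length \<open>k\<close>.
\<close>

lemma cut_of_surj: "symmetric_cuts \<subseteq> cut_of ` intertwiners"
proof
  fix V assume V: "V \<in> symmetric_cuts"
  then have cut: "cutting {1..k * p} V" and nontriv: "cut_stab V \<noteq> {\<one>}"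
    unfolding symmetric_cuts_def multi_basis_def basis_def by blast+
  note S = cut_stab_subgroup[of V]
  have semi: "h = \<one>" if "h \<in> cut_stab V" "h y = y" "y \<in> Y" for h y
    using cut_stab_semiregular[OF cut that] .
  have trans: "(\<lambda>h. h y0) ` cut_stab V = Y"
    by (rule semiregular_transitive(2)[OF S nontriv semi y01(1)]) (use y01 in auto)
  then obtain h where h: "h \<in> cut_stab V" "h y0 = y1" using y01(2) by blast
  have hG: "h \<in> carrier G" using h(1) by (simp add: cut_stab_def)
  have h1: "h \<noteq> \<one>" using h(2) y01(3) by (auto simp: one)
  have cyc: "h ^^ p = id" "inj_on (\<lambda>j. (h ^^ j) y0) {0..<p}" "(\<lambda>j. (h ^^ j) y0) ` {0..<p} = Y"
    using semiregular_cyclic[OF S semi y01(1) h(1) h1] y01(1) by auto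
  have V_word: "distinct u" "u \<noteq> []" "hd u \<in> Y" "set u \<subseteq> {1..k * p}" if "u \<in> V" for u
    using cut that by (auto simp: cutting_def)
  have "y0 \<in> {1..k * p}" using y01(1) YZ by auto
  then obtain u where u: "u \<in> V" "y0 \<in> set u" using cut unfolding cutting_def by blast
  have mapV: "map g v \<in> V" if "g \<in> cut_stab V" "v \<in> V" for g v
    using that by (auto simp: cut_stab_def)
  have pow: "h ^^ j \<in> cut_stab V" for j using funpow_in_subgroup[OF S h(1)] .
  have powu: "map (h ^^ j) u \<in> V" for j using mapV[OF pow u(1)] .
  have "z = y0" if z: "z \<in> Y" "z \<in> set u" for z
  proof -
    obtain g where g: "g \<in> cut_stab V" "g y0 = z" using trans z(1) by blast
    have "z \<in> set (map g u)" using g(2) u(2) by auto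
    then have "map g u = u" using common_letter[OF cut mapV[OF g(1) u(1)] u(1)] z(2) by blast
    then have "g y0 = y0" using u(2) map_eq_conv[of g u id] by simp
    then show ?thesis using g(2) by simp
  qed
  then have hdu: "hd u = y0" using V_word[OF u(1)] hd_in_set by blast
  have V_eq: "V = (\<lambda>j. map (h ^^ j) u) ` {0..<p}"
  proof
    show "(\<lambda>j. map (h ^^ j) u) ` {0..<p} \<subseteq> V" using powu by auto
    show "V \<subseteq> (\<lambda>j. map (h ^^ j) u) ` {0..<p}"
    proof
      fix v assume v: "v \<in> V"
      then obtain j where j: "j < p" "hd v = (h ^^ j) y0" using V_word(3)[OF v] cyc(3) by force
      have "hd v \<in> set (map (h ^^ j) u)" using j(2) u(2) by auto
      then have "v = map (h ^^ j) u" using common_letter[OF cut v powu, of "hd v" j] V_word(2)[OF v] by simp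
      then show "v \<in> (\<lambda>j. map (h ^^ j) u) ` {0..<p}" using j(1) by auto
    qed
  qed
  have lenu: "length u = k"
  proof -
    have inj: "inj_on (\<lambda>j. map (h ^^ j) u) {0..<p}"
    proof (rule inj_onI)
      fix i j assume ij: "i \<in> {0..<p}" "j \<in> {0..<p}" "map (h ^^ i) u = map (h ^^ j) u"
      then have "(h ^^ i) y0 = (h ^^ j) y0" using u(2) by auto
      then show "i = j" using cyc(2) ij by (auto simp: inj_on_def)
    qed
    have "card {1..k * p} = card (\<Union>v\<in>V. set v)" using cut by (simp add: cutting_def)
    also have "\<dots> = (\<Sum>v\<in>V. card (set v))"
      by (rule card_UN_disjoint) (use cutting_finite(1)[OF _ cut] cut in \<open>auto simp: cutting_def\<close>)
    also have "\<dots> = (\<Sum>v\<in>V. length v)" using V_word(1) by (intro sum.cong refl distinct_card) auto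
    also have "\<dots> = p * length u" unfolding V_eq by (simp add: sum.reindex[OF inj])
    finally show ?thesis using p2 by simp
  qed
  \<comment> \<open>The array with columns \<open>u\<close>, \<open>map h u\<close>, \<open>map (h ^^ 2) u\<close> and so on.\<close>
  define x where "x q = (if q \<in> {1..k * p} then (h ^^ ((q - 1) mod p)) (u ! ((q - 1) div p)) else q)" for q
  have x_at: "x (i * p + j) = (h ^^ (j - 1)) (u ! i)" if "i < k" "j \<in> {1..p}" for i j
    using position_in[OF that] position_div[OF that(2), of i] unfolding x_def by simp
  have "{1..k * p} \<subseteq> x ` {1..k * p}"
  proof
    fix z assume "z \<in> {1..k * p}"
    then obtain v where "v \<in> V" "z \<in> set v" using cut unfolding cutting_def by blast
    then obtain j where j: "j < p" "z \<in> set (map (h ^^ j) u)" unfolding V_eq by auto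
    then obtain i where i: "i < k" "z = (h ^^ j) (u ! i)" using lenu by (auto simp: in_set_conv_nth)
    have "z = x (i * p + Suc j)" using x_at[OF i(1), of "Suc j"] i j by simp
    then show "z \<in> x ` {1..k * p}" using position_in[OF i(1), of "Suc j" p] j(1) by auto
  qed
  moreover have "x ` {1..k * p} \<subseteq> {1..k * p}"
  proof
    fix z assume "z \<in> x ` {1..k * p}"
    then obtain q where q: "q \<in> {1..k * p}" "z = x q" by auto
    obtain i j where ij: "i < k" "j \<in> {1..p}" "q = i * p + j" by (rule position_cases[OF q(1)])
    then have "z \<in> set (map (h ^^ (j - 1)) u)" using q x_at lenu by auto
    then show "z \<in> {1..k * p}" using V_word(4)[OF powu[of "j - 1"]] by blast
  qed
  ultimately have img: "x ` {1..k * p} = {1..k * p}" by blast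
  then have "bij_betw x {1..k * p} {1..k * p}" using eq_card_imp_inj_on[of "{1..k * p}" x] by (simp add: bij_betw_def)
  then have xperm: "x permutes {1..k * p}" by (rule bij_imp_permutes) (simp only: x_def if_False)
  have x1: "x 1 = y0"
    using x_at[of 0 1] k1 p2 hdu V_word(2)[OF u(1)] by (simp add: hd_conv_nth)
  have x2: "x 2 = y1"
    using x_at[of 0 2] k1 p2 hdu V_word(2)[OF u(1)] h(2) by (simp add: hd_conv_nth numeral_2_eq_2)
  have comm: "h \<circ> x = x \<circ> shift p k"
  proof (rule eq_on_positions[of k p])
    fix i j assume ij: "i < k" "j \<in> {1..p}"
    show "(h \<circ> x) (i * p + j) = (x \<circ> shift p k) (i * p + j)"
    proof (cases "j = p")
      case True
      then have "(h \<circ> x) (i * p + j) = (h ^^ Suc (p - 1)) (u ! i)" using x_at[OF ij] by simp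
      also have "\<dots> = u ! i" using cyc(1) p2 by simp
      finally show ?thesis using shift_at[OF ij] x_at[OF ij(1), of 1] True p2 by (simp add: cycle_shift_def)
    next
      case False
      then have "cycle_shift p j = Suc j" "Suc j \<in> {1..p}" "j = Suc (j - 1)" using ij by (auto simp: cycle_shift_def)
      then show ?thesis using shift_at[OF ij] x_at[OF ij] x_at[OF ij(1), of "Suc j"]
        by (metis comp_apply diff_Suc_1 funpow.simps(2))
    qed
  next
    fix q assume "q \<notin> {1..k * p}"
    then show "(h \<circ> x) q = (x \<circ> shift p k) q"
      using permutes_not_in[OF permutes[OF hG]] permutes_not_in[OF xperm] by (simp add: shift_def diag_perm_outside)
  qed
  have "word_of x j = map (h ^^ (j - 1)) u" if "j \<in> {1..p}" for j
    by (rule nth_equalityI) (use that lenu x_at in \<open>auto simp: length_word_of nth_word_of\<close>)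
  then have "cut_of x = (\<lambda>j. map (h ^^ (j - 1)) u) ` {1..p}" unfolding cut_of_def by (intro image_cong) auto
  also have "\<dots> = (\<lambda>j. map (h ^^ j) u) ` (\<lambda>j. j - 1) ` {1..p}" by (simp add: image_image)
  also have "(\<lambda>j. j - 1) ` {1..p} = {0..<p}"
    by (rule antisym) (auto intro!: image_eqI[where x = "Suc _"])
  finally have "cut_of x = V" using V_eq by simp
  then show "V \<in> cut_of ` intertwiners" using xperm x1 x2 comm hG unfolding intertwiners_def by blast
qed

theorem card_symmetric_cuts: "card symmetric_cuts = card intertwiners"
proof -
  have "cut_of ` intertwiners = symmetric_cuts"
    using cut_of_surj intertwiner_cut(1) by (auto simp: intertwiners_def)
  then show ?thesis using card_image[OF cut_of_inj] by simp
qed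

end

section \<open>Counting cosets\<close>

lemma group_sym_group_r: "Group.group (sym_group_r n)"
proof (rule groupI)
  fix x assume "x \<in> carrier (sym_group_r n)"
  then have x: "x permutes {1..n}" by (simp add: sym_group_r_def)
  show "\<exists>y\<in>carrier (sym_group_r n). y \<otimes>\<^bsub>sym_group_r n\<^esub> x = \<one>\<^bsub>sym_group_r n\<^esub>"
    by (rule bexI[of _ "inv_into UNIV x"]) (use permutes_inv[OF x] permutes_inv_o[OF x] in \<open>auto simp: sym_group_r_def\<close>)
qed (auto simp: sym_group_r_def permutes_compose permutes_id comp_assoc)

lemma inv_sym_group_r:
  assumes "x permutes {1..n}"
  shows "inv\<^bsub>sym_group_r n\<^esub> x = inv_into UNIV x"
  by (rule group.inv_equality[OF group_sym_group_r])
    (use permutes_inv[OF assms] permutes_inv_o[OF assms] assms in \<open>auto simp: sym_group_r_def\<close>)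

lemma permutesI_inverse:
  assumes "f \<circ> g = id" "g \<circ> f = id" "\<And>x. x \<notin> S \<Longrightarrow> f x = x"
  shows "f permutes S"
  using o_bij[OF assms(2,1)] assms(3) unfolding permutes_def bij_iff by blast

lemma diag_perm_comp:
  assumes "\<tau>' permutes {1..p}"
  shows "diag_perm p k \<tau> \<circ> diag_perm p k \<tau>' = diag_perm p k (\<tau> \<circ> \<tau>')"
proof (rule eq_on_positions[of k p])
  fix i j assume ij: "i < k" "j \<in> {1..p}"
  then have "\<tau>' j \<in> {1..p}" using permutes_in_image[OF assms] by blast
  then show "(diag_perm p k \<tau> \<circ> diag_perm p k \<tau>') (i * p + j) = diag_perm p k (\<tau> \<circ> \<tau>') (i * p + j)"
    using ij by (simp only: comp_apply diag_perm_at)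
qed (simp add: diag_perm_outside)

lemma diag_perm_id: "diag_perm p k id = id"
  by (rule eq_on_positions[of k p]) (simp_all only: diag_perm_at diag_perm_outside id_apply not_False_eq_True)

lemma diag_perm_permutes:
  assumes "\<tau> permutes {1..p}"
  shows "diag_perm p k \<tau> permutes {1..k * p}"
  by (rule permutesI_inverse[where g = "diag_perm p k (inv_into UNIV \<tau>)"])
    (simp_all only: diag_perm_comp[OF assms] diag_perm_comp[OF permutes_inv[OF assms]] permutes_inv_o[OF assms]
      diag_perm_id diag_perm_outside not_False_eq_True)

lemma block_index_in:
  assumes "\<sigma> permutes {1..k}" "i < k"
  shows "\<sigma> (Suc i) - 1 < k" "Suc (\<sigma> (Suc i) - 1) = \<sigma> (Suc i)"
proof -
  have "\<sigma> (Suc i) \<in> {1..k}" using permutes_in_image[OF assms(1), of "Suc i"] assms(2) by simp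
  then show "\<sigma> (Suc i) - 1 < k" "Suc (\<sigma> (Suc i) - 1) = \<sigma> (Suc i)" by auto
qed

lemma block_perm_comp:
  assumes "\<sigma>' permutes {1..k}"
  shows "block_perm p k \<sigma> \<circ> block_perm p k \<sigma>' = block_perm p k (\<sigma> \<circ> \<sigma>')"
proof (rule eq_on_positions[of k p])
  fix i j assume ij: "i < k" "j \<in> {1..p}"
  then show "(block_perm p k \<sigma> \<circ> block_perm p k \<sigma>') (i * p + j) = block_perm p k (\<sigma> \<circ> \<sigma>') (i * p + j)"
    using block_index_in[OF assms ij(1)] by (simp only: comp_apply block_perm_at)
qed (simp add: block_perm_outside)

lemma block_perm_id: "block_perm p k id = id"
  by (rule eq_on_positions[of k p]) (simp_all only: block_perm_at block_perm_outside id_apply diff_Suc_1 not_False_eq_True)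

lemma block_perm_permutes:
  assumes "\<sigma> permutes {1..k}"
  shows "block_perm p k \<sigma> permutes {1..k * p}"
  by (rule permutesI_inverse[where g = "block_perm p k (inv_into UNIV \<sigma>)"])
    (simp_all only: block_perm_comp[OF assms] block_perm_comp[OF permutes_inv[OF assms]] permutes_inv_o[OF assms]
      block_perm_id block_perm_outside not_False_eq_True)

lemma block_diag_at:
  assumes "\<tau> permutes {1..p}" "i < k" "j \<in> {1..p}"
  shows "(block_perm p k \<sigma> \<circ> diag_perm p k \<tau>) (i * p + j) = (\<sigma> (Suc i) - 1) * p + \<tau> j"
proof -
  have "\<tau> j \<in> {1..p}" using permutes_in_image[OF assms(1)] assms(3) by blast
  then show ?thesis using assms by (simp only: comp_apply block_perm_at diag_perm_at)
qed

lemma block_diag_commute: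
  assumes "\<tau> permutes {1..p}" "\<sigma> permutes {1..k}"
  shows "diag_perm p k \<tau> \<circ> block_perm p k \<sigma> = block_perm p k \<sigma> \<circ> diag_perm p k \<tau>"
proof (rule eq_on_positions[of k p])
  fix i j assume ij: "i < k" "j \<in> {1..p}"
  have "(diag_perm p k \<tau> \<circ> block_perm p k \<sigma>) (i * p + j) = (\<sigma> (Suc i) - 1) * p + \<tau> j"
    using ij block_index_in(1)[OF assms(2) ij(1)] by (simp only: comp_apply block_perm_at diag_perm_at)
  then show "(diag_perm p k \<tau> \<circ> block_perm p k \<sigma>) (i * p + j) = (block_perm p k \<sigma> \<circ> diag_perm p k \<tau>) (i * p + j)"
    using block_diag_at[OF assms(1) ij] by simp
qed (simp add: diag_perm_outside block_perm_outside)

lemma D_subgroup_eq: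
  "D_subgroup p k = {block_perm p k \<sigma> \<circ> diag_perm p k \<tau> |\<sigma> \<tau>. \<sigma> permutes {1..k} \<and> \<tau> permutes {1..p}}"
  unfolding D_subgroup_def set_mult_def diag_subgroup_def block_subgroup_def
  by (auto simp: sym_group_r_def)

lemma D_subgroup_comp:
  assumes "d \<in> D_subgroup p k" "e \<in> D_subgroup p k"
  shows "d \<circ> e \<in> D_subgroup p k"
proof -
  obtain \<sigma> \<tau> \<sigma>' \<tau>' where *: "d = block_perm p k \<sigma> \<circ> diag_perm p k \<tau>" "\<sigma> permutes {1..k}" "\<tau> permutes {1..p}"
    "e = block_perm p k \<sigma>' \<circ> diag_perm p k \<tau>'" "\<sigma>' permutes {1..k}" "\<tau>' permutes {1..p}"
    using assms unfolding D_subgroup_eq by blast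
  have "d \<circ> e = block_perm p k \<sigma> \<circ> (diag_perm p k \<tau> \<circ> block_perm p k \<sigma>') \<circ> diag_perm p k \<tau>'"
    using * by (simp only: comp_assoc)
  also have "\<dots> = (block_perm p k \<sigma> \<circ> block_perm p k \<sigma>') \<circ> (diag_perm p k \<tau> \<circ> diag_perm p k \<tau>')"
    using block_diag_commute[OF *(3,5)] by (simp only: comp_assoc)
  also have "\<dots> = block_perm p k (\<sigma> \<circ> \<sigma>') \<circ> diag_perm p k (\<tau> \<circ> \<tau>')"
    using block_perm_comp[OF *(5)] diag_perm_comp[OF *(6)] by simp
  finally show ?thesis
    unfolding D_subgroup_eq using permutes_compose[OF *(5,2)] permutes_compose[OF *(6,3)] by blast
qed

lemma D_subgroup_permutes: "d \<in> D_subgroup p k \<Longrightarrow> d permutes {1..k * p}"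
  unfolding D_subgroup_eq using block_perm_permutes diag_perm_permutes permutes_compose by blast

lemma finite_D_subgroup: "finite (D_subgroup p k)"
  by (rule finite_subset[OF _ finite_permutations[of "{1..k * p}"]]) (use D_subgroup_permutes in auto)

lemma D_subgroup_id: "id \<in> D_subgroup p k"
  unfolding D_subgroup_eq using permutes_id diag_perm_id block_perm_id by (metis (mono_tags, lifting) comp_id mem_Collect_eq)

lemma D_coset: "D_subgroup p k #>\<^bsub>sym_group_r n\<^esub> x = (\<lambda>d. x \<circ> d) ` D_subgroup p k"
  by (auto simp: r_coset_def sym_group_r_def)

lemma D_coset_shift:
  assumes "d \<in> D_subgroup p k"
  shows "(\<lambda>e. (x \<circ> d) \<circ> e) ` D_subgroup p k = (\<lambda>e. x \<circ> e) ` D_subgroup p k"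
proof -
  have "inj_on (\<lambda>e. d \<circ> e) (D_subgroup p k)"
    using permutes_inj[OF D_subgroup_permutes[OF assms]] by (auto intro!: inj_onI simp: fun_eq_iff inj_eq)
  then have "(\<lambda>e. d \<circ> e) ` D_subgroup p k = D_subgroup p k"
    using endo_inj_surj[OF finite_D_subgroup] D_subgroup_comp[OF assms] by blast
  then have "(\<lambda>e. x \<circ> e) ` (\<lambda>e. d \<circ> e) ` D_subgroup p k = (\<lambda>e. x \<circ> e) ` D_subgroup p k" by simp
  then show ?thesis by (simp add: image_image comp_assoc)
qed

context block_letters begin

text \<open>
  The intersection of \<open>G\<close> with the conjugate by \<open>x\<close> of the diagonal subgroup.
\<close>

definition diag_part :: "(nat \<Rightarrow> nat) \<Rightarrow> (nat \<Rightarrow> nat) set" where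
  "diag_part x = {h \<in> carrier G. \<exists>\<tau>. \<tau> permutes {1..p} \<and> h \<circ> x = x \<circ> diag_perm p k \<tau>}"

lemma diag_part_eq:
  assumes x: "x permutes {1..k * p}"
  shows "conj_set (sym_group_r (k * p)) (diag_subgroup p k) x \<inter> carrier G = diag_part x"
proof -
  have eq: "h = x \<circ> a \<circ> inv_into UNIV x \<longleftrightarrow> h \<circ> x = x \<circ> a" for h a
  proof
    assume "h = x \<circ> a \<circ> inv_into UNIV x"
    then show "h \<circ> x = x \<circ> a" by (simp add: comp_assoc permutes_inv_o[OF x])
  next
    assume "h \<circ> x = x \<circ> a"
    then have "x \<circ> a \<circ> inv_into UNIV x = h \<circ> (x \<circ> inv_into UNIV x)" by (simp only: comp_assoc[symmetric])
    then show "h = x \<circ> a \<circ> inv_into UNIV x" by (simp add: permutes_inv_o[OF x])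
  qed
  have "conj_set (sym_group_r (k * p)) (diag_subgroup p k) x
      = {x \<circ> diag_perm p k \<tau> \<circ> inv_into UNIV x |\<tau>. \<tau> permutes {1..p}}"
    unfolding conj_set_def diag_subgroup_def inv_sym_group_r[OF x]
    by (auto simp: sym_group_r_def comp_assoc)
  then show ?thesis unfolding diag_part_def using eq by auto
qed

lemma diag_part_subgroup:
  assumes x: "x permutes {1..k * p}"
  shows "subgroup (diag_part x) G"
  unfolding diag_part_def
proof (rule stabilizer_is_subgroup)
  fix g h assume "\<exists>\<tau>. \<tau> permutes {1..p} \<and> g \<circ> x = x \<circ> diag_perm p k \<tau>" "\<exists>\<tau>. \<tau> permutes {1..p} \<and> h \<circ> x = x \<circ> diag_perm p k \<tau>"
  then obtain \<tau> \<tau>' where t: "\<tau> permutes {1..p}" "g \<circ> x = x \<circ> diag_perm p k \<tau>" "\<tau>' permutes {1..p}" "h \<circ> x = x \<circ> diag_perm p k \<tau>'"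
    by blast
  have "(h \<circ> g) \<circ> x = (h \<circ> x) \<circ> diag_perm p k \<tau>" using t(2) by (simp only: comp_assoc)
  also have "\<dots> = x \<circ> diag_perm p k (\<tau>' \<circ> \<tau>)" using t(4) diag_perm_comp[OF t(1)] by (simp only: comp_assoc)
  finally show "\<exists>\<tau>. \<tau> permutes {1..p} \<and> (h \<circ> g) \<circ> x = x \<circ> diag_perm p k \<tau>" using permutes_compose[OF t(1,3)] by blast
next
  show "\<exists>\<tau>. \<tau> permutes {1..p} \<and> id \<circ> x = x \<circ> diag_perm p k \<tau>"
    using permutes_id diag_perm_id by (metis comp_id id_comp)
next
  fix h assume h: "h \<in> carrier G" "\<exists>\<tau>. \<tau> permutes {1..p} \<and> h \<circ> x = x \<circ> diag_perm p k \<tau>"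
  then obtain \<tau> where t: "\<tau> permutes {1..p}" "h \<circ> x = x \<circ> diag_perm p k \<tau>" by blast
  have "(inv h) \<circ> h = id" using inv_apply(1)[OF h(1)] by (auto simp: fun_eq_iff)
  have "x \<circ> diag_perm p k (inv_into UNIV \<tau>) = (inv h) \<circ> (h \<circ> x) \<circ> diag_perm p k (inv_into UNIV \<tau>)"
    using \<open>(inv h) \<circ> h = id\<close> by (simp add: comp_assoc[symmetric])
  also have "\<dots> = (inv h) \<circ> x \<circ> (diag_perm p k \<tau> \<circ> diag_perm p k (inv_into UNIV \<tau>))"
    unfolding t(2) by (simp only: comp_assoc)
  also have "\<dots> = (inv h) \<circ> x"
    by (simp add: diag_perm_comp[OF permutes_inv[OF t(1)]] permutes_inv_o[OF t(1)] diag_perm_id)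
  finally show "\<exists>\<tau>. \<tau> permutes {1..p} \<and> (inv h) \<circ> x = x \<circ> diag_perm p k \<tau>" using permutes_inv[OF t(1)] by metis
qed

text \<open>
  The elements of \<open>diag_part x\<close> stabilize the set of \<open>p\<close> values that \<open>x\<close> takes on the block of \<open>z\<close>. A
  \<open>p\<close>-group fixing one of these letters fixes them all, and the values in one block determine \<open>\<tau>\<close>.
\<close>

lemma diag_part_semiregular:
  assumes x: "x permutes {1..k * p}" and h: "h \<in> diag_part x" "h z = z" and z: "z \<in> {1..k * p}"
  shows "h = \<one>"
proof -
  obtain q where q: "q \<in> {1..k * p}" "z = x q" using permutes_image[OF x] z by blast
  obtain i j where ij: "i < k" "j \<in> {1..p}" "q = i * p + j" by (rule position_cases[OF q(1)])
  \<comment> \<open>The values of \<open>x\<close> on the block that contains the position of \<open>z\<close>.\<close>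
  let ?B = "(\<lambda>j. x (i * p + j)) ` {1..p}"
  let ?S = "diag_part x \<inter> {h \<in> carrier G. h z = z}"
  have inj: "inj x" by (rule permutes_inj[OF x])
  have "subgroup {h \<in> carrier G. h z = z} G"
    by (rule stabilizer_is_subgroup) (auto, metis inv_apply(1))
  then have S: "subgroup ?S G" by (rule subgroups_Inter_pair[OF diag_part_subgroup[OF x]])
  have "inj_on (\<lambda>j. x (i * p + j)) {1..p}" by (rule inj_onI) (simp add: inj_eq[OF inj])
  then have cardB: "card ?B = p" by (simp add: card_image)
  have inv: "g b \<in> ?B" if "g \<in> diag_part x" "b \<in> ?B" for g b
  proof -
    obtain \<tau> where t: "\<tau> permutes {1..p}" "g \<circ> x = x \<circ> diag_perm p k \<tau>" using \<open>g \<in> diag_part x\<close> by (auto simp: diag_part_def)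
    obtain j' where j': "j' \<in> {1..p}" "b = x (i * p + j')" using \<open>b \<in> ?B\<close> by blast
    have "g b = x (i * p + \<tau> j')" using fun_cong[OF t(2), of "i * p + j'"] diag_perm_at[OF ij(1) j'(1)] j'(2) by simp
    moreover have "\<tau> j' \<in> {1..p}" using permutes_in_image[OF t(1)] j'(1) by blast
    ultimately show ?thesis by blast
  qed
  have hS: "h \<in> ?S" using h by (auto simp: diag_part_def)
  have zB: "z \<in> ?B" using q ij by blast
  have fix_B: "h b = b" if "b \<in> ?B" for b
    by (rule subgroup_fixing_letter[OF S _ cardB _ zB _ hS that]) (use inv in auto)
  obtain \<tau> where t: "\<tau> permutes {1..p}" "h \<circ> x = x \<circ> diag_perm p k \<tau>" using h(1) by (auto simp: diag_part_def)
  have "\<tau> j' = j'" if j': "j' \<in> {1..p}" for j'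
  proof -
    have "x (i * p + \<tau> j') = x (i * p + j')"
      using fun_cong[OF t(2), of "i * p + j'"] diag_perm_at[OF ij(1) j'] fix_B j' by simp
    then show ?thesis using inj by (simp add: inj_eq)
  qed
  then have "\<tau> j' = j'" for j' using permutes_not_in[OF t(1), of j'] by (cases "j' \<in> {1..p}") auto
  then have "\<tau> = id" by auto
  then have "h \<circ> x = x" using t(2) by (simp add: diag_perm_id)
  then have "h \<circ> (x \<circ> inv_into UNIV x) = x \<circ> inv_into UNIV x" by (simp only: comp_assoc[symmetric])
  then show ?thesis by (simp add: permutes_inv_o[OF x] one)
qed

lemma Y_letters: "y \<in> Y \<Longrightarrow> y \<in> {1..k * p}" using YZ by blast

definition good_cosets :: "(nat \<Rightarrow> nat) set set" where
  "good_cosets = {D_subgroup p k #>\<^bsub>sym_group_r (k * p)\<^esub> x | x. x \<in> carrier (sym_group_r (k * p)) \<and>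
      conj_set (sym_group_r (k * p)) (diag_subgroup p k) x \<inter> carrier G \<noteq> {\<one>\<^bsub>sym_group_r (k * p)\<^esub>}}"

abbreviation coset :: "(nat \<Rightarrow> nat) \<Rightarrow> (nat \<Rightarrow> nat) set" where
  "coset x \<equiv> (\<lambda>d. x \<circ> d) ` D_subgroup p k"

lemma good_cosets_eq: "good_cosets = {coset x | x. x permutes {1..k * p} \<and> diag_part x \<noteq> {id}}"
proof -
  have "x permutes {1..k * p} \<Longrightarrow> conj_set (sym_group_r (k * p)) (diag_subgroup p k) x \<inter> carrier G = diag_part x" for x
    by (rule diag_part_eq)
  moreover have "carrier (sym_group_r (k * p)) = {x. x permutes {1..k * p}}" "\<one>\<^bsub>sym_group_r (k * p)\<^esub> = id"
    by (simp_all add: sym_group_r_def)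
  ultimately show ?thesis unfolding good_cosets_def D_coset by (metis (no_types, lifting) mem_Collect_eq)
qed

lemma intertwinersE:
  assumes "x \<in> intertwiners"
  obtains h where "x permutes {1..k * p}" "x 1 = y0" "x 2 = y1" "h \<in> diag_part x" "h \<circ> x = x \<circ> shift p k" "h y0 = y1"
proof -
  obtain h where h: "x permutes {1..k * p}" "x 1 = y0" "x 2 = y1" "h \<in> carrier G" "h \<circ> x = x \<circ> shift p k"
    using assms by (auto simp: intertwiners_def)
  have "h \<in> diag_part x" using h(4,5) cycle_shift_permutes[OF p0] unfolding diag_part_def shift_def by blast
  then show thesis using that h intertwiner_cut(3)[OF h] by blast
qed

lemma intertwiner_coset: "x \<in> intertwiners \<Longrightarrow> coset x \<in> good_cosets"
proof (erule intertwinersE)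
  fix h assume "x permutes {1..k * p}" "h \<in> diag_part x" "h y0 = y1"
  then have "h \<noteq> id" using y01(3) by auto
  then show "coset x \<in> good_cosets" using \<open>x permutes {1..k * p}\<close> \<open>h \<in> diag_part x\<close> unfolding good_cosets_eq by blast
qed

text \<open>
  Being nontrivial and semiregular, \<open>diag_part x\<close> is transitive on \<open>Y\<close> and contains an \<open>h\<close> with
  \<open>h y0 = y1\<close>, given by a permutation \<open>\<tau>\<close> of the positions in a block. Multiplication of \<open>x\<close> by an
  element of \<open>D\<close> brings the position of \<open>y0\<close> to \<open>1\<close> and turns \<open>\<tau>\<close> into the standard cycle.
\<close>

lemma good_coset_representative:
  assumes "K \<in> good_cosets"
  obtains y where "y \<in> intertwiners" "K = coset y"
proof -
  obtain x where x: "x permutes {1..k * p}" "diag_part x \<noteq> {id}" "K = coset x"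
    using assms unfolding good_cosets_eq by blast
  note S = diag_part_subgroup[OF x(1)]
  have semi: "h = \<one>" if "h \<in> diag_part x" "h y0 = y0" for h
    by (rule diag_part_semiregular[OF x(1) that Y_letters[OF y01(1)]])
  have nontriv: "diag_part x \<noteq> {\<one>}" using x(2) by (simp add: one)
  obtain h where h: "h \<in> diag_part x" "h y0 = y1"
    using semiregular_transitive(2)[OF S nontriv semi y01(1)] y01(2) by blast
  have h1: "h \<noteq> \<one>" using h(2) y01(3) by (auto simp: one)
  note cyc = semiregular_cyclic[OF S semi y01(1) h(1) h1]
  have hG: "h \<in> carrier G" using h(1) by (simp add: diag_part_def)
  obtain \<tau> where t: "\<tau> permutes {1..p}" "h \<circ> x = x \<circ> diag_perm p k \<tau>" using h(1) by (auto simp: diag_part_def)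
  obtain q where q: "q \<in> {1..k * p}" "y0 = x q" using permutes_image[OF x(1)] Y_letters[OF y01(1)] by blast
  obtain i0 j0 where ij: "i0 < k" "j0 \<in> {1..p}" "q = i0 * p + j0" by (rule position_cases[OF q(1)])
  have tau_in: "(\<tau> ^^ j) j0 \<in> {1..p}" for j
    using permutes_in_funpow_image[OF t(1) ij(2)] .
  have pow: "(h ^^ j) y0 = x (i0 * p + (\<tau> ^^ j) j0)" for j
  proof (induction j)
    case (Suc j)
    then show ?case using fun_cong[OF t(2), of "i0 * p + (\<tau> ^^ j) j0"] diag_perm_at[OF ij(1) tau_in] by simp
  qed (use q ij in simp)
  have inj: "inj x" by (rule permutes_inj[OF x(1)])
  \<comment> \<open>\<open>\<delta>\<close> conjugates \<open>\<tau>\<close>, which is a \<open>p\<close>-cycle, to the standard cycle and sends \<open>1\<close> to \<open>j0\<close>.\<close>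
  define \<delta> where "\<delta> j = (if j \<in> {1..p} then (\<tau> ^^ (j - 1)) j0 else j)" for j
  have "inj_on \<delta> {1..p}"
  proof (rule inj_onI)
    fix j j' assume jj: "j \<in> {1..p}" "j' \<in> {1..p}" "\<delta> j = \<delta> j'"
    then have "(h ^^ (j - 1)) y0 = (h ^^ (j' - 1)) y0" unfolding pow by (simp add: \<delta>_def)
    moreover have "j - 1 \<in> {0..<p}" "j' - 1 \<in> {0..<p}" using jj by auto
    ultimately have "j - 1 = j' - 1" using cyc(2) by (auto simp: inj_on_def)
    then show "j = j'" using jj by auto
  qed
  moreover have "\<delta> ` {1..p} \<subseteq> {1..p}" using tau_in by (auto simp: \<delta>_def)
  ultimately have "bij_betw \<delta> {1..p} {1..p}" using endo_inj_surj[of "{1..p}" \<delta>] by (simp add: bij_betw_def)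
  then have \<delta>: "\<delta> permutes {1..p}" by (rule bij_imp_permutes) (simp only: \<delta>_def if_False)
  have \<delta>_cyc: "\<delta> (cycle_shift p j) = \<tau> (\<delta> j)" if j: "j \<in> {1..p}" for j
  proof -
  have next_\<delta>: "\<tau> (\<delta> j) = (\<tau> ^^ j) j0" using j by (cases j) (simp_all add: \<delta>_def)
  show ?thesis
  proof (cases "j = p")
    case True
    have "x (i0 * p + (\<tau> ^^ p) j0) = x (i0 * p + j0)" using pow[of p] cyc(1) q ij by simp
    then have "(\<tau> ^^ p) j0 = j0" using inj by (simp add: inj_eq)
    then have "\<tau> (\<delta> j) = j0" using next_\<delta> True by simp
    then show ?thesis using True p2 by (simp add: \<delta>_def cycle_shift_def)
  next
    case False
    then have "cycle_shift p j = Suc j" "Suc j \<in> {1..p}" using j by (auto simp: cycle_shift_def)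
    then show ?thesis using next_\<delta> by (simp add: \<delta>_def)
  qed
  qed
  \<comment> \<open>\<open>\<sigma>\<close> moves the block that contains the position of \<open>y0\<close> to the front.\<close>
  define \<sigma> where "\<sigma> = transpose 1 (Suc i0)"
  have \<sigma>: "\<sigma> permutes {1..k}" unfolding \<sigma>_def using k1 ij(1) by (intro permutes_swap_id) auto
  define e where "e = block_perm p k \<sigma> \<circ> diag_perm p k \<delta>"
  have eD: "e \<in> D_subgroup p k" unfolding e_def D_subgroup_eq using \<sigma> \<delta> by blast
  have e_at: "e (i * p + j) = (\<sigma> (Suc i) - 1) * p + \<delta> j" if "i < k" "j \<in> {1..p}" for i j
    unfolding e_def by (rule block_diag_at[OF \<delta> that])
  have e_perm: "e permutes {1..k * p}" by (rule D_subgroup_permutes[OF eD])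
  let ?y = "x \<circ> e"
  have y_perm: "?y permutes {1..k * p}" by (rule permutes_compose[OF e_perm x(1)])
  have e_start: "e j = i0 * p + \<delta> j" if "j \<in> {1..p}" for j
    using e_at[of 0 j] k1 that by (simp add: \<sigma>_def)
  have y1': "?y 1 = y0" using e_start[of 1] p2 q ij by (simp add: \<delta>_def)
  have "?y 2 = x (i0 * p + (\<tau> ^^ 1) j0)" using e_start[of 2] p2 by (simp add: \<delta>_def numeral_2_eq_2)
  also have "\<dots> = y1" using pow[of 1] h(2) by simp
  finally have y2': "?y 2 = y1" .
  have "e \<circ> shift p k = diag_perm p k \<tau> \<circ> e"
  proof (rule eq_on_positions[of k p])
    fix i j assume ij': "i < k" "j \<in> {1..p}"
    have "\<delta> j \<in> {1..p}" using permutes_in_image[OF \<delta>] ij'(2) by blast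
    then have "diag_perm p k \<tau> (e (i * p + j)) = (\<sigma> (Suc i) - 1) * p + \<tau> (\<delta> j)"
      unfolding e_at[OF ij'] by (rule diag_perm_at[OF block_index_in(1)[OF \<sigma> ij'(1)]])
    moreover have "e (shift p k (i * p + j)) = (\<sigma> (Suc i) - 1) * p + \<delta> (cycle_shift p j)"
      unfolding shift_at[OF ij'] by (rule e_at[OF ij'(1) cycle_shift_in[OF ij'(2)]])
    ultimately show "(e \<circ> shift p k) (i * p + j) = (diag_perm p k \<tau> \<circ> e) (i * p + j)"
      using \<delta>_cyc[OF ij'(2)] by simp
  next
    fix q assume "q \<notin> {1..k * p}"
    then show "(e \<circ> shift p k) q = (diag_perm p k \<tau> \<circ> e) q"
      using permutes_not_in[OF e_perm] by (simp add: shift_def diag_perm_outside)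
  qed
  then have "?y \<circ> shift p k = x \<circ> diag_perm p k \<tau> \<circ> e" by (simp only: comp_assoc)
  also have "\<dots> = h \<circ> ?y" unfolding t(2)[symmetric] by (simp only: comp_assoc)
  finally have "?y \<in> intertwiners" using y_perm y1' y2' hG unfolding intertwiners_def by auto
  moreover have "K = coset ?y" unfolding D_coset_shift[OF eD] by (rule x(3))
  ultimately show thesis using that by blast
qed

text \<open>
  Let \<open>z = y \<circ> e\<close> with \<open>e \<in> D\<close>. The group elements that belong to \<open>y\<close> and to \<open>z\<close> both lie in the
  semiregular group \<open>diag_part y\<close> and send \<open>y0\<close> to \<open>y1\<close>, so they agree. Therefore \<open>y\<close> and \<open>z\<close> have the
  same values on the first block, that is, \<open>e\<close> fixes the first block pointwise. This leaves the
  permutations of the blocks other than the first.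
\<close>

lemma intertwiners_in_coset:
  assumes y: "y \<in> intertwiners"
  shows "{z \<in> intertwiners. coset z = coset y} = (\<lambda>\<sigma>. y \<circ> block_perm p k \<sigma>) ` {\<sigma>. \<sigma> permutes {2..k}}"
proof
  obtain h where h: "y permutes {1..k * p}" "y 1 = y0" "y 2 = y1" "h \<in> diag_part y" "h \<circ> y = y \<circ> shift p k" "h y0 = y1"
    by (rule intertwinersE[OF y])
  have inj: "inj y" by (rule permutes_inj[OF h(1)])
  show "{z \<in> intertwiners. coset z = coset y} \<subseteq> (\<lambda>\<sigma>. y \<circ> block_perm p k \<sigma>) ` {\<sigma>. \<sigma> permutes {2..k}}"
  proof
    fix z assume "z \<in> {z \<in> intertwiners. coset z = coset y}"
    then have z: "z \<in> intertwiners" "coset z = coset y" by auto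
    obtain h' where h': "z permutes {1..k * p}" "z 1 = y0" "z 2 = y1" "h' \<in> diag_part z" "h' \<circ> z = z \<circ> shift p k" "h' y0 = y1"
      by (rule intertwinersE[OF z(1)])
    have "z \<circ> id \<in> coset y" unfolding z(2)[symmetric] using D_subgroup_id by blast
    then obtain e where e: "e \<in> D_subgroup p k" "z = y \<circ> e" by auto
    obtain \<sigma> \<tau> where st: "\<sigma> permutes {1..k}" "\<tau> permutes {1..p}" "e = block_perm p k \<sigma> \<circ> diag_perm p k \<tau>"
      using e(1) unfolding D_subgroup_eq by blast
    have "h' \<in> diag_part y"
    proof -
      have e_perm: "e permutes {1..k * p}" by (rule D_subgroup_permutes[OF e(1)])
      have "diag_perm p k (\<tau> \<circ> cycle_shift p \<circ> inv_into UNIV \<tau>) \<circ> e = e \<circ> shift p k"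
      proof -
        let ?t = "diag_perm p k \<tau>" and ?ti = "diag_perm p k (inv_into UNIV \<tau>)" and ?b = "block_perm p k \<sigma>"
        have c: "diag_perm p k (\<tau> \<circ> cycle_shift p \<circ> inv_into UNIV \<tau>) = ?t \<circ> shift p k \<circ> ?ti"
          unfolding shift_def diag_perm_comp[OF cycle_shift_permutes[OF p0]] diag_perm_comp[OF permutes_inv[OF st(2)]] ..
        have "?ti \<circ> ?t = id" by (simp add: diag_perm_comp[OF st(2)] permutes_inv_o[OF st(2)] diag_perm_id)
        have "(?t \<circ> shift p k \<circ> ?ti) \<circ> (?b \<circ> ?t) = ?t \<circ> shift p k \<circ> (?ti \<circ> ?b) \<circ> ?t" by (simp only: comp_assoc)
        also have "\<dots> = ?t \<circ> shift p k \<circ> ?b \<circ> (?ti \<circ> ?t)"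
          unfolding block_diag_commute[OF permutes_inv[OF st(2)] st(1)] by (simp only: comp_assoc)
        also have "\<dots> = ?t \<circ> (shift p k \<circ> ?b)" using \<open>?ti \<circ> ?t = id\<close> by (simp add: comp_assoc)
        also have "\<dots> = (?t \<circ> ?b) \<circ> shift p k"
          unfolding shift_def block_diag_commute[OF cycle_shift_permutes[OF p0] st(1)] by (simp only: comp_assoc)
        also have "\<dots> = (?b \<circ> ?t) \<circ> shift p k" unfolding block_diag_commute[OF st(2,1)] ..
        finally show ?thesis unfolding c st(3) .
      qed
      then have "h' \<circ> y \<circ> e = y \<circ> diag_perm p k (\<tau> \<circ> cycle_shift p \<circ> inv_into UNIV \<tau>) \<circ> e"
        using h'(5) unfolding e(2) by (simp only: comp_assoc)
      then have "h' \<circ> y \<circ> (e \<circ> inv_into UNIV e) = y \<circ> diag_perm p k (\<tau> \<circ> cycle_shift p \<circ> inv_into UNIV \<tau>) \<circ> (e \<circ> inv_into UNIV e)"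
        by (simp only: comp_assoc[symmetric])
      then have "h' \<circ> y = y \<circ> diag_perm p k (\<tau> \<circ> cycle_shift p \<circ> inv_into UNIV \<tau>)"
        by (simp add: permutes_inv_o[OF e_perm])
      moreover have "\<tau> \<circ> cycle_shift p \<circ> inv_into UNIV \<tau> permutes {1..p}"
        using permutes_compose[OF permutes_inv[OF st(2)] permutes_compose[OF cycle_shift_permutes[OF p0] st(2)]] by simp
      moreover have "h' \<in> carrier G" using h'(4) by (simp add: diag_part_def)
      ultimately show ?thesis unfolding diag_part_def by blast
    qed
    moreover have "inj_on (\<lambda>h. h y0) (diag_part y)"
      by (rule semiregular_inj[OF diag_part_subgroup[OF h(1)]])
        (rule diag_part_semiregular[OF h(1) _ _ Y_letters[OF y01(1)]])
    ultimately have "h' = h" using h(4,6) h'(6) by (auto simp: inj_on_def)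
    have "e j = j" if j: "j \<in> {1..p}" for j
    proof -
      obtain j' where j': "j = Suc j'" "j' < p" using j by (cases j) auto
      have "z j = y j"
        using intertwiner_orbit[OF h(5), of 0 j'] intertwiner_orbit[OF h'(5), of 0 j'] k1 j' h(2) h'(2) \<open>h' = h\<close> by simp
      then show ?thesis unfolding e(2) using inj by (simp add: inj_eq)
    qed
    moreover have "e j = (\<sigma> 1 - 1) * p + \<tau> j" if "j \<in> {1..p}" for j
      using block_diag_at[OF st(2) _ that, of 0 k \<sigma>] k1 unfolding st(3) by simp
    ultimately have ej: "(\<sigma> 1 - 1) * p + \<tau> j = 0 * p + j" if "j \<in> {1..p}" for j using that by simp
    have \<tau>_in: "\<tau> j \<in> {1..p}" if "j \<in> {1..p}" for j using permutes_in_image[OF st(2)] that by blast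
    have "\<tau> j = j" if "j \<in> {1..p}" for j using position_inj(2)[OF \<tau>_in[OF that] that ej[OF that]] .
    then have "\<tau> j = j" for j using permutes_not_in[OF st(2), of j] by (cases "j \<in> {1..p}") auto
    then have "\<tau> = id" by auto
    have "1 \<in> {1..p}" using p2 by simp
    then have "\<sigma> 1 - 1 = 0" using position_inj(1)[OF \<tau>_in _ ej] by blast
    moreover have "\<sigma> 1 \<in> {1..k}" using permutes_in_image[OF st(1), of 1] k1 by simp
    ultimately have "\<sigma> 1 = 1" by auto
    have "\<sigma> permutes {2..k}"
    proof (rule permutes_superset[OF st(1)])
      fix a assume "a \<in> {1..k} - {2..k}"
      then have "a = 1" by auto
      then show "\<sigma> a = a" using \<open>\<sigma> 1 = 1\<close> by simp
    qed
    moreover have "z = y \<circ> block_perm p k \<sigma>" unfolding e(2) st(3) \<open>\<tau> = id\<close> by (simp add: diag_perm_id)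
    ultimately show "z \<in> (\<lambda>\<sigma>. y \<circ> block_perm p k \<sigma>) ` {\<sigma>. \<sigma> permutes {2..k}}" by blast
  qed
  show "(\<lambda>\<sigma>. y \<circ> block_perm p k \<sigma>) ` {\<sigma>. \<sigma> permutes {2..k}} \<subseteq> {z \<in> intertwiners. coset z = coset y}"
  proof
    fix z assume "z \<in> (\<lambda>\<sigma>. y \<circ> block_perm p k \<sigma>) ` {\<sigma>. \<sigma> permutes {2..k}}"
    then obtain \<sigma> where s: "\<sigma> permutes {2..k}" "z = y \<circ> block_perm p k \<sigma>" by auto
    have s1: "\<sigma> permutes {1..k}" using permutes_subset[OF s(1)] by auto
    have \<sigma>1: "\<sigma> (Suc 0) = Suc 0" using permutes_not_in[OF s(1), of "Suc 0"] by simp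
    have b: "block_perm p k \<sigma> j = j" if "j \<in> {1..p}" for j
      using block_perm_at[of 0 k j p \<sigma>] k1 that \<sigma>1 by simp
    have "z 1 = y0" "z 2 = y1" using b[of 1] b[of 2] p2 h s(2) by simp_all
    moreover have "h \<circ> z = z \<circ> shift p k"
    proof -
      have "h \<circ> z = y \<circ> (shift p k \<circ> block_perm p k \<sigma>)" unfolding s(2) comp_assoc[symmetric] h(5) ..
      also have "\<dots> = z \<circ> shift p k"
        unfolding shift_def block_diag_commute[OF cycle_shift_permutes[OF p0] s1] s(2) by (simp only: comp_assoc)
      finally show ?thesis .
    qed
    moreover have "z permutes {1..k * p}" unfolding s(2) by (rule permutes_compose[OF block_perm_permutes[OF s1] h(1)])
    moreover have "h \<in> carrier G" using h(4) by (simp add: diag_part_def)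
    ultimately have "z \<in> intertwiners" unfolding intertwiners_def by blast
    moreover have "block_perm p k \<sigma> \<in> D_subgroup p k"
    proof -
      have "block_perm p k \<sigma> = block_perm p k \<sigma> \<circ> diag_perm p k id" by (simp add: diag_perm_id)
      then show ?thesis unfolding D_subgroup_eq using s1 permutes_id by blast
    qed
    then have "coset z = coset y" unfolding s(2) by (rule D_coset_shift)
    ultimately show "z \<in> {z \<in> intertwiners. coset z = coset y}" by blast
  qed
qed

theorem card_intertwiners: "card intertwiners = fact (k - 1) * card good_cosets"
proof -
  have fin: "finite intertwiners"
    by (rule finite_subset[OF _ finite_permutations[of "{1..k * p}"]]) (auto simp: intertwiners_def)
  have gc: "good_cosets = coset ` intertwiners"
  proof
    show "coset ` intertwiners \<subseteq> good_cosets" using intertwiner_coset by (rule image_subsetI)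
    show "good_cosets \<subseteq> coset ` intertwiners"
    proof
      fix K assume "K \<in> good_cosets"
      then obtain y where y: "y \<in> intertwiners" "K = coset y" by (rule good_coset_representative)
      show "K \<in> coset ` intertwiners" by (rule image_eqI[of _ _ y]) (rule y(2), rule y(1))
    qed
  qed
  have each: "card {z \<in> intertwiners. coset z = K} = fact (k - 1)" if K: "K \<in> good_cosets" for K
  proof -
    obtain y where y: "y \<in> intertwiners" "K = coset y" by (rule good_coset_representative[OF K])
    have "inj y" using y(1) permutes_inj by (auto simp: intertwiners_def)
    have "inj_on (\<lambda>\<sigma>. y \<circ> block_perm p k \<sigma>) {\<sigma>. \<sigma> permutes {2..k}}"
    proof (rule inj_onI)
      fix \<sigma> \<sigma>' assume s: "\<sigma> \<in> {\<sigma>. \<sigma> permutes {2..k}}" "\<sigma>' \<in> {\<sigma>. \<sigma> permutes {2..k}}"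
        "y \<circ> block_perm p k \<sigma> = y \<circ> block_perm p k \<sigma>'"
      then have s1: "\<sigma> permutes {1..k}" "\<sigma>' permutes {1..k}" using permutes_subset[of _ "{2..k}" "{1..k}"] by auto
      have b: "block_perm p k \<sigma> = block_perm p k \<sigma>'"
        using s(3) \<open>inj y\<close> by (auto simp: fun_eq_iff inj_eq)
      show "\<sigma> = \<sigma>'"
      proof
        fix a show "\<sigma> a = \<sigma>' a"
        proof (cases "a \<in> {1..k}")
          case True
          then obtain i where i: "a = Suc i" "i < k" by (cases a) auto
          have "1 \<in> {1..p}" using p2 by simp
          then have "(\<sigma> a - 1) * p + 1 = (\<sigma>' a - 1) * p + 1"
            using fun_cong[OF b, of "i * p + 1"] block_perm_at[OF i(2), of 1 p] i(1) by simp
          then have "\<sigma> a - 1 = \<sigma>' a - 1" using p2 by simp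
          moreover have "\<sigma> a \<in> {1..k}" "\<sigma>' a \<in> {1..k}"
            using permutes_in_image[OF s1(1), of a] permutes_in_image[OF s1(2), of a] True by simp_all
          ultimately show ?thesis by auto
        next
          case False
          then show ?thesis using permutes_not_in[OF s1(1), of a] permutes_not_in[OF s1(2), of a] by simp
        qed
      qed
    qed
    then have "card {z \<in> intertwiners. coset z = coset y} = card {\<sigma>. \<sigma> permutes {2..k}}"
      unfolding intertwiners_in_coset[OF y(1)] by (rule card_image)
    also have "\<dots> = fact (k - 1)" using card_permutations[of "{2..k}" "k - 1"] by simp
    finally show ?thesis unfolding y(2) .
  qed
  have "card intertwiners = (\<Sum>K\<in>good_cosets. card {z \<in> intertwiners. coset z = K})"
    using sum.group[OF fin _ , of good_cosets coset "\<lambda>_. 1 :: nat"] fin gc by simp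
  also have "\<dots> = fact (k - 1) * card good_cosets" using each by simp
  finally show ?thesis .
qed

end

section \<open>The Lie module in terms of words\<close>

lemma group_algebra_assoc:
  assumes G: "Group.group G" "finite (carrier G)"
  shows "(a \<otimes>\<^bsub>group_algebra G\<^esub> b) \<otimes>\<^bsub>group_algebra G\<^esub> c = a \<otimes>\<^bsub>group_algebra G\<^esub> (b \<otimes>\<^bsub>group_algebra G\<^esub> c)"
proof
  interpret group G by fact
  fix g
  show "((a \<otimes>\<^bsub>group_algebra G\<^esub> b) \<otimes>\<^bsub>group_algebra G\<^esub> c) g = (a \<otimes>\<^bsub>group_algebra G\<^esub> (b \<otimes>\<^bsub>group_algebra G\<^esub> c)) g"
  proof (cases "g \<in> carrier G")
    case True
    have "((a \<otimes>\<^bsub>group_algebra G\<^esub> b) \<otimes>\<^bsub>group_algebra G\<^esub> c) g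
        = (\<Sum>z\<in>carrier G. \<Sum>y\<in>carrier G. a ((g \<otimes>\<^bsub>G\<^esub> inv\<^bsub>G\<^esub> z) \<otimes>\<^bsub>G\<^esub> inv\<^bsub>G\<^esub> y) * b y * c z)"
      using True by (simp add: group_algebra_mult[OF G] sum_distrib_right)
    also have "\<dots> = (\<Sum>z\<in>carrier G. \<Sum>y\<in>carrier G. a (g \<otimes>\<^bsub>G\<^esub> inv\<^bsub>G\<^esub> y) * b (y \<otimes>\<^bsub>G\<^esub> inv\<^bsub>G\<^esub> z) * c z)"
    proof (rule sum.cong[OF refl])
      fix z assume z: "z \<in> carrier G"
      show "(\<Sum>y\<in>carrier G. a ((g \<otimes>\<^bsub>G\<^esub> inv\<^bsub>G\<^esub> z) \<otimes>\<^bsub>G\<^esub> inv\<^bsub>G\<^esub> y) * b y * c z)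
        = (\<Sum>y\<in>carrier G. a (g \<otimes>\<^bsub>G\<^esub> inv\<^bsub>G\<^esub> y) * b (y \<otimes>\<^bsub>G\<^esub> inv\<^bsub>G\<^esub> z) * c z)"
        by (rule sum.reindex_bij_witness[where i = "\<lambda>y. y \<otimes>\<^bsub>G\<^esub> inv\<^bsub>G\<^esub> z" and j = "\<lambda>y. y \<otimes>\<^bsub>G\<^esub> z"])
          (use z True in \<open>auto simp: m_assoc inv_mult_group\<close>)
    qed
    also have "\<dots> = (\<Sum>y\<in>carrier G. \<Sum>z\<in>carrier G. a (g \<otimes>\<^bsub>G\<^esub> inv\<^bsub>G\<^esub> y) * b (y \<otimes>\<^bsub>G\<^esub> inv\<^bsub>G\<^esub> z) * c z)"
      by (rule sum.swap)
    also have "\<dots> = (a \<otimes>\<^bsub>group_algebra G\<^esub> (b \<otimes>\<^bsub>group_algebra G\<^esub> c)) g"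
      using True by (simp add: group_algebra_mult[OF G] sum_distrib_left mult.assoc)
    finally show ?thesis .
  qed (simp add: group_algebra_mult[OF G])
qed

lemma carrier_sym: "carrier (sym_group_r n) = {x. x permutes {1..n}}"
  by (simp add: sym_group_r_def)

lemma finite_sym: "finite (carrier (sym_group_r n))"
  unfolding carrier_sym by (rule finite_permutations) simp

lemma sym_mult: "x \<otimes>\<^bsub>sym_group_r n\<^esub> y = y \<circ> x" and sym_one: "\<one>\<^bsub>sym_group_r n\<^esub> = id"
  by (simp_all add: sym_group_r_def)

abbreviation sym_algebra :: "nat \<Rightarrow> ((nat \<Rightarrow> nat) \<Rightarrow> 'f :: field) ring" where
  "sym_algebra n \<equiv> group_algebra (sym_group_r n)"

lemma carrier_sym_algebra: "carrier (sym_algebra n) = supported {x. x permutes {1..n}}"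
  by (auto simp: group_algebra_def supported_def carrier_sym)

lemmas sym_algebra_mult = group_algebra_mult[OF group_sym_group_r finite_sym]

lemma group_algebra_a_minus:
  assumes "a \<in> carrier (group_algebra G)" "b \<in> carrier (group_algebra G)"
  shows "a \<ominus>\<^bsub>group_algebra G\<^esub> b = (\<lambda>g. a g - b g)"
proof -
  have "\<ominus>\<^bsub>group_algebra G\<^esub> b = (\<lambda>g. - b g)"
    unfolding a_inv_def m_inv_def
  proof (rule the_equality)
    show "(\<lambda>g. - b g) \<in> carrier (add_monoid (group_algebra G)) \<and>
      b \<otimes>\<^bsub>add_monoid (group_algebra G)\<^esub> (\<lambda>g. - b g) = \<one>\<^bsub>add_monoid (group_algebra G)\<^esub> \<and>
      (\<lambda>g. - b g) \<otimes>\<^bsub>add_monoid (group_algebra G)\<^esub> b = \<one>\<^bsub>add_monoid (group_algebra G)\<^esub>"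
      using assms(2) by (auto simp: group_algebra_def)
  next
    fix y assume y: "y \<in> carrier (add_monoid (group_algebra G)) \<and>
      b \<otimes>\<^bsub>add_monoid (group_algebra G)\<^esub> y = \<one>\<^bsub>add_monoid (group_algebra G)\<^esub> \<and>
      y \<otimes>\<^bsub>add_monoid (group_algebra G)\<^esub> b = \<one>\<^bsub>add_monoid (group_algebra G)\<^esub>"
    then have "\<And>g. y g + b g = 0" by (simp add: group_algebra_def fun_eq_iff)
    then show "y = (\<lambda>g. - b g)" by (auto simp: fun_eq_iff eq_neg_iff_add_eq_0)
  qed
  then show ?thesis by (simp add: a_minus_def group_algebra_def)
qed

lemma one_minus_cycle_mult:
  assumes c: "c permutes {1..n}" and a: "a \<in> carrier (sym_algebra n)" and g: "g permutes {1..n}"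
  shows "((\<one>\<^bsub>sym_algebra n\<^esub> \<ominus>\<^bsub>sym_algebra n\<^esub> group_elem c) \<otimes>\<^bsub>sym_algebra n\<^esub> a) g = a g - a (g \<circ> inv_into UNIV c)"
proof -
  let ?S = "{x. x permutes {1..n}}"
  have one: "\<one>\<^bsub>sym_algebra n\<^esub> = group_elem id" by (auto simp: group_algebra_def group_elem_def sym_one)
  have cl: "group_elem x \<in> carrier (sym_algebra n)" if "x permutes {1..n}" for x
    using that by (auto simp: carrier_sym_algebra supported_def group_elem_def)
  have "((\<one>\<^bsub>sym_algebra n\<^esub> \<ominus>\<^bsub>sym_algebra n\<^esub> group_elem c) \<otimes>\<^bsub>sym_algebra n\<^esub> a) g
      = (\<Sum>y\<in>?S. (group_elem id (inv_into UNIV y \<circ> g) - group_elem c (inv_into UNIV y \<circ> g)) * a y)"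
    unfolding one group_algebra_a_minus[OF cl[OF permutes_id] cl[OF c]] sym_algebra_mult carrier_sym
    using g by (auto simp: sym_mult inv_sym_group_r intro!: sum.cong)
  also have "\<dots> = (\<Sum>y\<in>?S. (if y = g then a g else 0) - (if y = g \<circ> inv_into UNIV c then a (g \<circ> inv_into UNIV c) else 0))"
  proof (rule sum.cong[OF refl])
    fix y assume "y \<in> ?S"
    then have y: "y permutes {1..n}" by simp
    have eq: "inv_into UNIV y \<circ> g = x \<longleftrightarrow> y \<circ> x = g" for x
    proof
      assume "inv_into UNIV y \<circ> g = x"
      then have "y \<circ> x = (y \<circ> inv_into UNIV y) \<circ> g" by (simp only: comp_assoc)
      then show "y \<circ> x = g" by (simp add: permutes_inv_o[OF y])
    next
      assume "y \<circ> x = g"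
      then have "inv_into UNIV y \<circ> g = (inv_into UNIV y \<circ> y) \<circ> x" by (simp only: comp_assoc)
      then show "inv_into UNIV y \<circ> g = x" by (simp add: permutes_inv_o[OF y])
    qed
    have "y \<circ> c = g \<longleftrightarrow> y = g \<circ> inv_into UNIV c"
    proof
      assume "y \<circ> c = g"
      then have "g \<circ> inv_into UNIV c = y \<circ> (c \<circ> inv_into UNIV c)" by (simp only: comp_assoc[symmetric])
      then show "y = g \<circ> inv_into UNIV c" by (simp add: permutes_inv_o[OF c])
    next
      assume "y = g \<circ> inv_into UNIV c"
      then show "y \<circ> c = g" by (simp add: comp_assoc permutes_inv_o[OF c])
    qed
    then show "(group_elem id (inv_into UNIV y \<circ> g) - group_elem c (inv_into UNIV y \<circ> g)) * a y
        = (if y = g then a g else 0) - (if y = g \<circ> inv_into UNIV c then a (g \<circ> inv_into UNIV c) else 0)"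
      unfolding group_elem_def eq comp_id by auto
  qed
  also have "\<dots> = a g - a (g \<circ> inv_into UNIV c)"
    using g permutes_compose[OF permutes_inv[OF c] g] finite_permutations[of "{1..n}"] by (simp add: sum_subtractf)
  finally show ?thesis .
qed

definition perm_word :: "nat \<Rightarrow> (nat \<Rightarrow> nat) \<Rightarrow> nat list" where
  "perm_word n x = map x [1..<Suc n]"

definition word_perm :: "nat \<Rightarrow> nat list \<Rightarrow> nat \<Rightarrow> nat" where
  "word_perm n w = (\<lambda>i. if i \<in> {1..n} then w ! (i - 1) else i)"

lemma set_range: "set [1..<Suc n] = {1..n}"
  by auto

lemma perm_word_in: "x permutes {1..n} \<Longrightarrow> perm_word n x \<in> permutations_of_set {1..n}"
  using permutes_image[of x "{1..n}"] permutes_inj_on[of x "{1..n}"]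
  unfolding perm_word_def permutations_of_set_def mem_Collect_eq distinct_map set_map set_range by simp

lemma word_perm_perm_word: "x permutes {1..n} \<Longrightarrow> word_perm n (perm_word n x) = x"
  using permutes_not_in[of x "{1..n}"] by (auto simp: word_perm_def perm_word_def fun_eq_iff simp del: upt_Suc)

lemma length_word: "w \<in> permutations_of_set {1..n} \<Longrightarrow> length w = n"
  using distinct_card[of w] by (auto simp: permutations_of_set_def)

lemma perm_word_word_perm: "w \<in> permutations_of_set {1..n} \<Longrightarrow> perm_word n (word_perm n w) = w"
  by (rule nth_equalityI) (auto simp: perm_word_def word_perm_def length_word simp del: upt_Suc)

lemma word_perm_permutes:
  assumes "w \<in> permutations_of_set {1..n}"
  shows "word_perm n w permutes {1..n}"
proof (rule bij_imp_permutes)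
  have len: "length w = n" by (rule length_word[OF assms])
  have w: "distinct w" "set w = {1..n}" using assms by (auto simp: permutations_of_set_def)
  have "word_perm n w ` {1..n} = set w"
  proof
    show "word_perm n w ` {1..n} \<subseteq> set w" using len by (auto simp: word_perm_def)
    show "set w \<subseteq> word_perm n w ` {1..n}"
    proof
      fix z assume "z \<in> set w"
      then obtain i where "i < n" "z = w ! i" using len by (auto simp: in_set_conv_nth)
      then show "z \<in> word_perm n w ` {1..n}" by (intro image_eqI[of _ _ "Suc i"]) (auto simp: word_perm_def)
    qed
  qed
  then show "bij_betw (word_perm n w) {1..n} {1..n}"
    using w(2) eq_card_imp_inj_on[of "{1..n}" "word_perm n w"] by (simp add: bij_betw_def)
qed (simp only: word_perm_def if_False)

lemma cycle_of_range:
  assumes "i \<in> {1..j}"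
  shows "cycle_of_list [1..<Suc j] i = (if i = j then 1 else Suc i)"
proof -
  have "map (cycle_of_list [1..<Suc j]) [1..<Suc j] = rotate1 [1..<Suc j]"
    using cyclic_rotation[of "[1..<Suc j]" 1] by (simp del: upt_Suc)
  then have "map (cycle_of_list [1..<Suc j]) [1..<Suc j] ! (i - 1) = rotate1 [1..<Suc j] ! (i - 1)" by simp
  moreover have "i - 1 < length [1..<Suc j]" using assms by auto
  moreover have "[1..<Suc j] ! (i - 1) = i" using assms by (auto simp del: upt_Suc)
  moreover have "rotate1 [1..<Suc j] ! (i - 1) = [1..<Suc j] ! (Suc (i - 1) mod j)"
    using nth_rotate1[of "i - 1" "[1..<Suc j]"] assms by (auto simp del: upt_Suc)
  moreover have "[1..<Suc j] ! (Suc (i - 1) mod j) = (if i = j then 1 else Suc i)"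
    using assms by (auto simp del: upt_Suc)
  ultimately show ?thesis by (simp del: upt_Suc)
qed

lemma cycle_of_range_permutes: "j \<le> n \<Longrightarrow> cycle_of_list [1..<Suc j] permutes {1..n}"
  by (rule permutes_subset[OF cycle_permutes]) auto

text \<open>
  Left multiplication by a group element permutes the positions in a word; the cycle
  \<open>(1,2,\<dots>,j)\<close> moves the \<open>j\<close>-th letter to the front.
\<close>

lemma word_perm_cycle:
  assumes w: "s @ y # r \<in> permutations_of_set {1..n}"
  shows "word_perm n (s @ y # r) \<circ> inv_into UNIV (cycle_of_list [1..<Suc (Suc (length s))]) = word_perm n (y # s @ r)"
proof -
  let ?c = "cycle_of_list [1..<Suc (Suc (length s))]"
  have len: "length (s @ y # r) = n" by (rule length_word[OF w])
  have c: "?c permutes {1..n}" using len by (intro cycle_of_range_permutes) simp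
  have "word_perm n (s @ y # r) = word_perm n (y # s @ r) \<circ> ?c"
  proof
    fix i
    consider "i \<in> {1..length s}" | "i = Suc (length s)" | "i \<notin> {1..Suc (length s)}" by fastforce
    then show "word_perm n (s @ y # r) i = (word_perm n (y # s @ r) \<circ> ?c) i"
    proof cases
      case 1
      then have "?c i = Suc i" using cycle_of_range[of i "Suc (length s)"] by auto
      moreover have "(s @ y # r) ! (i - 1) = (y # s @ r) ! i" using 1 by (auto simp: nth_append nth_Cons')
      ultimately show ?thesis using 1 len by (auto simp: word_perm_def)
    next
      case 2
      then have "?c i = 1" using cycle_of_range[of i "Suc (length s)"] by auto
      then show ?thesis using 2 len by (auto simp: word_perm_def nth_append)
    next
      case 3
      then have "?c i = i" using id_outside_supp[of i "[1..<Suc (Suc (length s))]"] by (auto simp del: upt_Suc)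
      moreover have "(s @ y # r) ! (i - 1) = (y # s @ r) ! (i - 1)" if "i \<noteq> 0"
        using that 3 by (auto simp: nth_append nth_Cons')
      ultimately show ?thesis using 3 by (auto simp: word_perm_def)
    qed
  qed
  then show ?thesis by (simp only: comp_assoc permutes_inv_o[OF c] comp_id)
qed

abbreviation lie_factor :: "nat \<Rightarrow> nat \<Rightarrow> (nat \<Rightarrow> nat) \<Rightarrow> 'f :: field" where
  "lie_factor n j \<equiv> \<one>\<^bsub>sym_algebra n\<^esub> \<ominus>\<^bsub>sym_algebra n\<^esub> group_elem (cycle_of_list [1..<Suc j])"

lemma mult_closed: "a \<otimes>\<^bsub>sym_algebra n\<^esub> b \<in> carrier (sym_algebra n)"
  by (simp add: carrier_sym_algebra supported_def sym_algebra_mult carrier_sym)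

lemma sum_permutations_insert:
  assumes "finite B" "y \<notin> B"
  shows "(\<Sum>u\<in>permutations_of_set (insert y B). if last u = y then f (butlast u) u else 0) = (\<Sum>s\<in>permutations_of_set B. f s (s @ [y]))"
    and "(\<Sum>u\<in>permutations_of_set (insert y B). if hd u = y then f (tl u) u else 0) = (\<Sum>s\<in>permutations_of_set B. f s (y # s))"
proof -
  have fin: "finite (permutations_of_set (insert y B))" using assms(1) by simp
  have "(\<Sum>u\<in>permutations_of_set (insert y B). if last u = y then f (butlast u) u else 0)
      = (\<Sum>u\<in>{u \<in> permutations_of_set (insert y B). last u = y}. f (butlast u) u)"
    using fin by (simp add: sum.inter_filter)
  also have "\<dots> = (\<Sum>s\<in>permutations_of_set B. f s (s @ [y]))"
  proof (rule sum.reindex_bij_witness[where i = "\<lambda>s. s @ [y]" and j = butlast])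
    fix u assume "u \<in> {u \<in> permutations_of_set (insert y B). last u = y}"
    then have u: "distinct u" "set u = insert y B" "last u = y" by (auto simp: permutations_of_set_def)
    then obtain s where s: "u = s @ [y]" by (cases u rule: rev_cases) auto
    then have "set s = B" using u assms(2) by auto
    then show "butlast u @ [y] = u" "butlast u \<in> permutations_of_set B" "f (butlast u) (butlast u @ [y]) = f (butlast u) u"
      using s u by (auto simp: permutations_of_set_def)
  qed (use assms in \<open>auto simp: permutations_of_set_def\<close>)
  finally show "(\<Sum>u\<in>permutations_of_set (insert y B). if last u = y then f (butlast u) u else 0) = (\<Sum>s\<in>permutations_of_set B. f s (s @ [y]))" .
  have "(\<Sum>u\<in>permutations_of_set (insert y B). if hd u = y then f (tl u) u else 0)
      = (\<Sum>u\<in>{u \<in> permutations_of_set (insert y B). hd u = y}. f (tl u) u)"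
    using fin by (simp add: sum.inter_filter)
  also have "\<dots> = (\<Sum>s\<in>permutations_of_set B. f s (y # s))"
  proof (rule sum.reindex_bij_witness[where i = "\<lambda>s. y # s" and j = tl])
    fix u assume "u \<in> {u \<in> permutations_of_set (insert y B). hd u = y}"
    then have u: "distinct u" "set u = insert y B" "hd u = y" by (auto simp: permutations_of_set_def)
    then obtain s where s: "u = y # s" by (cases u) auto
    then have "set s = B" using u assms(2) by auto
    then show "y # tl u = u" "tl u \<in> permutations_of_set B" "f (tl u) (y # tl u) = f (tl u) u"
      using s u by (auto simp: permutations_of_set_def)
  qed (use assms in \<open>auto simp: permutations_of_set_def\<close>)
  finally show "(\<Sum>u\<in>permutations_of_set (insert y B). if hd u = y then f (tl u) u else 0) = (\<Sum>s\<in>permutations_of_set B. f s (y # s))" .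
qed

text \<open>
  The factors up to \<open>1 - c\<^sub>m\<^sub>+\<^sub>1\<close> change the first \<open>m + 1\<close> positions only. The last of them leaves the
  letter at position \<open>m + 1\<close> at its place, or moves it to the front with the opposite sign: this is the
  recursion for \<open>lie_coeff\<close>.
\<close>

lemma partial_lie_mult:
  assumes w: "w \<in> permutations_of_set {1..n}" and m: "Suc m \<le> n"
    and a: "a \<in> carrier (sym_algebra n)"
  shows "foldr (\<lambda>j b. lie_factor n j \<otimes>\<^bsub>sym_algebra n\<^esub> b) [2..<Suc (Suc m)] a (word_perm n w) =
    (\<Sum>s\<in>permutations_of_set (set (take (Suc m) w)). lie_coeff s (take (Suc m) w) * (a (word_perm n (s @ drop (Suc m) w)) :: 'f :: field))"
  using m a
proof (induction m arbitrary: a)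
  case 0
  have "length w = n" by (rule length_word[OF w])
  then obtain y r where "w = y # r" using 0 by (cases w) auto
  then show ?case by (simp add: lie_coeff_short)
next
  case (Suc m)
  have len: "length w = n" by (rule length_word[OF w])
  define z r y where "z = take (Suc m) w" and "r = drop (Suc (Suc m)) w" and "y = w ! Suc m"
  have zy: "take (Suc (Suc m)) w = z @ [y]" "drop (Suc m) w = y # r"
    using Suc.prems(1) len by (auto simp: z_def r_def y_def take_Suc_conv_app_nth Cons_nth_drop_Suc)
  have w_eq: "w = z @ y # r" using zy append_take_drop_id[of "Suc m" w] by (simp add: z_def)
  have lz: "length z = Suc m" using Suc.prems(1) len by (simp add: z_def)
  have dw: "distinct w" "set w = {1..n}" using w by (auto simp: permutations_of_set_def)
  have yz: "y \<notin> set z" using dw(1) w_eq by auto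
  let ?c = "cycle_of_list [1..<Suc (Suc (Suc m))]"
  let ?b = "lie_factor n (Suc (Suc m)) \<otimes>\<^bsub>sym_algebra n\<^esub> a"
  have "[2..<Suc (Suc (Suc m))] = [2..<Suc (Suc m)] @ [Suc (Suc m)]" by simp
  then have "foldr (\<lambda>j b. lie_factor n j \<otimes>\<^bsub>sym_algebra n\<^esub> b) [2..<Suc (Suc (Suc m))] a (word_perm n w)
      = foldr (\<lambda>j b. lie_factor n j \<otimes>\<^bsub>sym_algebra n\<^esub> b) [2..<Suc (Suc m)] ?b (word_perm n w)"
    by (simp only: foldr_append foldr.simps comp_apply id_apply)
  also have "\<dots> = (\<Sum>s\<in>permutations_of_set (set z). lie_coeff s z * ?b (word_perm n (s @ y # r)))"
    using Suc.IH[OF _ mult_closed, of "lie_factor n (Suc (Suc m))" a] Suc.prems(1) unfolding zy(2) z_def by simp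
  also have "\<dots> = (\<Sum>s\<in>permutations_of_set (set z). lie_coeff s z * (a (word_perm n (s @ y # r)) - a (word_perm n (y # s @ r))))"
  proof (rule sum.cong[OF refl])
    fix s assume "s \<in> permutations_of_set (set z)"
    then have s: "distinct s" "set s = set z" by (auto simp: permutations_of_set_def)
    have "length s = Suc m" using distinct_card[OF s(1)] distinct_card[of z] s(2) dw(1) w_eq lz by simp
    have sw: "s @ y # r \<in> permutations_of_set {1..n}" using s dw w_eq by (auto simp: permutations_of_set_def)
    have "?b (word_perm n (s @ y # r)) = a (word_perm n (s @ y # r)) - a (word_perm n (s @ y # r) \<circ> inv_into UNIV ?c)"
      by (rule one_minus_cycle_mult[OF cycle_of_range_permutes Suc.prems(2) word_perm_permutes[OF sw]]) (use Suc.prems(1) in simp)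
    then show "lie_coeff s z * ?b (word_perm n (s @ y # r)) = lie_coeff s z * (a (word_perm n (s @ y # r)) - a (word_perm n (y # s @ r)))"
      using word_perm_cycle[OF sw] \<open>length s = Suc m\<close> by (simp del: upt_Suc)
  qed
  also have "\<dots> = (\<Sum>s\<in>permutations_of_set (set z). lie_coeff s z * a (word_perm n ((s @ [y]) @ r)))
      - (\<Sum>s\<in>permutations_of_set (set z). lie_coeff s z * a (word_perm n ((y # s) @ r)))"
    by (simp add: right_diff_distrib sum_subtractf)
  also have "\<dots> = (\<Sum>u\<in>permutations_of_set (insert y (set z)). (if last u = y then lie_coeff (butlast u) z * a (word_perm n (u @ r)) else 0)
      - (if hd u = y then lie_coeff (tl u) z * a (word_perm n (u @ r)) else 0))"
    unfolding sum_subtractf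
    using sum_permutations_insert[OF _ yz, of "\<lambda>s u. lie_coeff s z * a (word_perm n (u @ r))"] by simp
  also have "\<dots> = (\<Sum>u\<in>permutations_of_set (insert y (set z)). lie_coeff u (z @ [y]) * a (word_perm n (u @ r)))"
  proof (rule sum.cong[OF refl])
    fix u assume "u \<in> permutations_of_set (insert y (set z))"
    then have "distinct u" "set u = insert y (set z)" by (auto simp: permutations_of_set_def)
    then have "length u = Suc (Suc m)" using distinct_card[of u] distinct_card[of z] dw(1) w_eq lz yz by simp
    then show "(if last u = y then lie_coeff (butlast u) z * a (word_perm n (u @ r)) else 0)
      - (if hd u = y then lie_coeff (tl u) z * a (word_perm n (u @ r)) else 0) = lie_coeff u (z @ [y]) * a (word_perm n (u @ r))"
      by (simp add: lie_coeff_snoc left_diff_distrib)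
  qed
  finally show ?case unfolding zy(1) by (simp add: r_def)
qed

definition to_words :: "nat \<Rightarrow> ((nat \<Rightarrow> nat) \<Rightarrow> 'f :: field) \<Rightarrow> nat list \<Rightarrow> 'f" where
  "to_words n f = (\<lambda>w. if w \<in> permutations_of_set {1..n} then f (word_perm n w) else 0)"

lemma foldr_mult:
  "foldr (\<lambda>j b. x j \<otimes>\<^bsub>sym_algebra n\<^esub> b) js c \<otimes>\<^bsub>sym_algebra n\<^esub> a = foldr (\<lambda>j b. x j \<otimes>\<^bsub>sym_algebra n\<^esub> b) js (c \<otimes>\<^bsub>sym_algebra n\<^esub> a)"
  by (induction js) (simp_all add: group_algebra_assoc[OF group_sym_group_r finite_sym])

lemma one_mult:
  assumes "a \<in> carrier (sym_algebra n)"
  shows "\<one>\<^bsub>sym_algebra n\<^esub> \<otimes>\<^bsub>sym_algebra n\<^esub> a = a"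
proof
  fix g
  interpret S: Group.group "sym_group_r n" by (rule group_sym_group_r)
  show "(\<one>\<^bsub>sym_algebra n\<^esub> \<otimes>\<^bsub>sym_algebra n\<^esub> a) g = a g"
  proof (cases "g \<in> carrier (sym_group_r n)")
    case True
    have "g \<otimes>\<^bsub>sym_group_r n\<^esub> inv\<^bsub>sym_group_r n\<^esub> y = \<one>\<^bsub>sym_group_r n\<^esub> \<longleftrightarrow> y = g" if "y \<in> carrier (sym_group_r n)" for y
      using True that S.inv_equality[of g "inv\<^bsub>sym_group_r n\<^esub> y"] by auto
    then have "(\<one>\<^bsub>sym_algebra n\<^esub> \<otimes>\<^bsub>sym_algebra n\<^esub> a) g = (\<Sum>y\<in>carrier (sym_group_r n). if y = g then a y else 0)"
      unfolding sym_algebra_mult using True by (auto simp: group_algebra_def intro!: sum.cong)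
    then show ?thesis using True finite_sym by simp
  next
    case False
    then show ?thesis using assms by (simp add: sym_algebra_mult) (simp add: group_algebra_def)
  qed
qed

text \<open>
  This is the case of \<open>partial_lie_mult\<close> in which all factors are present; words that are not
  permutations of the alphabet have no coefficients because brackets are homogeneous.
\<close>

theorem to_words_lie_omega:
  assumes n: "1 \<le> n" and a: "a \<in> carrier (sym_algebra n)"
  shows "to_words n (lie_omega n \<otimes>\<^bsub>sym_algebra n\<^esub> a) = lie_map {1..n} (to_words n (a :: _ \<Rightarrow> 'f :: field))"
proof
  fix w
  show "to_words n (lie_omega n \<otimes>\<^bsub>sym_algebra n\<^esub> a) w = lie_map {1..n} (to_words n a) w"
  proof (cases "w \<in> permutations_of_set {1..n}")
    case True
    obtain m where m: "n = Suc m" using n by (cases n) auto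
    have len: "length w = n" by (rule length_word[OF True])
    have "lie_omega n \<otimes>\<^bsub>sym_algebra n\<^esub> a = foldr (\<lambda>j b. lie_factor n j \<otimes>\<^bsub>sym_algebra n\<^esub> b) [2..<Suc (Suc m)] a"
      unfolding lie_omega_def Let_def foldr_mult one_mult[OF a] unfolding m ..
    then have "to_words n (lie_omega n \<otimes>\<^bsub>sym_algebra n\<^esub> a) w
        = (\<Sum>s\<in>permutations_of_set (set w). lie_coeff s w * a (word_perm n s))"
      using True partial_lie_mult[OF True _ a, of m] m len by (simp add: to_words_def)
    also have "set w = {1..n}" using True by (simp add: permutations_of_set_def)
    finally show ?thesis by (simp add: lie_map_def to_words_def mult.commute cong: sum.cong)
  next
    case False
    have "lie_coeff s w = (0 :: 'f)" if s: "s \<in> permutations_of_set {1..n}" for s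
    proof (rule ccontr)
      assume "lie_coeff s w \<noteq> (0 :: 'f)"
      then have "mset w = mset s" by (rule mset_eq_if_lie_coeff_nonzero)
      then have "w \<in> permutations_of_set {1..n}"
        using s mset_eq_imp_distinct_iff[of w s] mset_eq_setD[of w s] by (auto simp: permutations_of_set_def)
      then show False using False by simp
    qed
    then show ?thesis using False by (simp add: lie_map_def to_words_def)
  qed
qed

text \<open>
  Right multiplication by \<open>h\<close> in the group algebra.
\<close>

definition perm_act :: "((nat \<Rightarrow> nat) \<Rightarrow> 'f :: field) \<Rightarrow> (nat \<Rightarrow> nat) \<Rightarrow> (nat \<Rightarrow> nat) \<Rightarrow> 'f" where
  "perm_act f h = (\<lambda>g. f (inv_into UNIV h \<circ> g))"

lemma left_mult_apply:
  "(b \<otimes>\<^bsub>sym_algebra n\<^esub> a) g =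
    (if g permutes {1..n} then \<Sum>y | y permutes {1..n}. b (inv_into UNIV y \<circ> g) * a y else 0)"
  unfolding sym_algebra_mult carrier_sym
  by (auto simp: sym_mult inv_sym_group_r intro!: sum.cong)

lemma linear_left_mult: "Vector_Spaces.linear fun_scale fun_scale (\<lambda>a. b \<otimes>\<^bsub>sym_algebra n\<^esub> a)"
proof unfold_locales
  show "b \<otimes>\<^bsub>sym_algebra n\<^esub> (a + a') = b \<otimes>\<^bsub>sym_algebra n\<^esub> a + b \<otimes>\<^bsub>sym_algebra n\<^esub> a'" for a a'
    by (auto simp: fun_eq_iff left_mult_apply distrib_left sum.distrib)
  show "b \<otimes>\<^bsub>sym_algebra n\<^esub> fun_scale c a = fun_scale c (b \<otimes>\<^bsub>sym_algebra n\<^esub> a)" for a c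
    by (auto simp: fun_eq_iff left_mult_apply fun_scale_def sum_distrib_left mult_ac)
qed

lemma perm_act_mult:
  assumes h: "h permutes {1..n}"
  shows "perm_act (b \<otimes>\<^bsub>sym_algebra n\<^esub> a) h = b \<otimes>\<^bsub>sym_algebra n\<^esub> perm_act a h"
proof
  fix g
  let ?i = "inv_into UNIV h"
  have i: "?i permutes {1..n}" by (rule permutes_inv[OF h])
  have hi: "h \<circ> (?i \<circ> x) = x" "?i \<circ> (h \<circ> x) = x" for x :: "nat \<Rightarrow> nat"
    by (simp_all add: comp_assoc[symmetric] permutes_inv_o[OF h])
  have iff: "(?i \<circ> g) permutes {1..n} \<longleftrightarrow> g permutes {1..n}"
  proof
    assume "(?i \<circ> g) permutes {1..n}"
    from permutes_compose[OF this h] show "g permutes {1..n}" by (simp add: hi)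
  qed (rule permutes_compose[OF _ i])
  have "(\<Sum>y | y permutes {1..n}. b (inv_into UNIV y \<circ> (?i \<circ> g)) * a y)
      = (\<Sum>y | y permutes {1..n}. b (inv_into UNIV y \<circ> g) * a (?i \<circ> y))"
  proof (rule sum.reindex_bij_witness[where i = "\<lambda>y. ?i \<circ> y" and j = "\<lambda>y. h \<circ> y"])
    fix y assume y: "y \<in> {y. y permutes {1..n}}"
    then have "inv_into UNIV (h \<circ> y) = inv_into UNIV y \<circ> ?i"
      using permutes_bij[OF h] permutes_bij by (auto intro: o_inv_distrib)
    then show "b (inv_into UNIV (h \<circ> y) \<circ> g) * a (?i \<circ> (h \<circ> y)) = b (inv_into UNIV y \<circ> (?i \<circ> g)) * a y"
      by (simp add: hi comp_assoc)
  qed (use permutes_compose[OF _ i] permutes_compose[OF _ h] hi in auto)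
  then show "perm_act (b \<otimes>\<^bsub>sym_algebra n\<^esub> a) h g = (b \<otimes>\<^bsub>sym_algebra n\<^esub> perm_act a h) g"
    by (simp only: perm_act_def left_mult_apply iff)
qed

lemma perm_act_supported:
  assumes "a \<in> supported {x. x permutes {1..n}}" "h permutes {1..n}"
  shows "perm_act a h \<in> supported {x. x permutes {1..n}}"
proof -
  have "g permutes {1..n}" if g: "(inv_into UNIV h \<circ> g) permutes {1..n}" for g
  proof -
    have "h \<circ> (inv_into UNIV h \<circ> g) = g" by (simp add: comp_assoc[symmetric] permutes_inv_o[OF assms(2)])
    then show ?thesis using permutes_compose[OF g assms(2)] by simp
  qed
  then show ?thesis using assms(1) unfolding supported_def perm_act_def by blast
qed

lemma to_words_act:
  assumes h: "h permutes {1..n}"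
  shows "to_words n (perm_act f h) = word_act (to_words n f) h"
proof
  fix w
  let ?i = "inv_into UNIV h"
  have i: "?i permutes {1..n}" by (rule permutes_inv[OF h])
  have "map ?i w \<in> permutations_of_set {1..n} \<longleftrightarrow> w \<in> permutations_of_set {1..n}"
  proof
    assume "map ?i w \<in> permutations_of_set {1..n}"
    then have "map h (map ?i w) \<in> permutations_of_set {1..n}" by (rule map_permutes_permutations[OF h])
    then show "w \<in> permutations_of_set {1..n}" by (simp add: permutes_inv_o[OF h])
  qed (rule map_permutes_permutations[OF i])
  moreover have "?i \<circ> word_perm n w = word_perm n (map ?i w)" if "w \<in> permutations_of_set {1..n}"
  proof
    fix x show "(?i \<circ> word_perm n w) x = word_perm n (map ?i w) x"
      using length_word[OF that] permutes_not_in[OF i, of x] by (auto simp: word_perm_def)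
  qed
  ultimately show "to_words n (perm_act f h) w = word_act (to_words n f) h w"
    by (simp add: to_words_def perm_act_def word_act_def)
qed

lemma linear_to_words: "Vector_Spaces.linear fun_scale fun_scale (to_words n)"
proof unfold_locales
  show "to_words n (f + g) = to_words n f + to_words n g" "to_words n (fun_scale c f) = fun_scale c (to_words n f)" for f g c
    by (auto simp: to_words_def fun_scale_def fun_eq_iff)
qed

interpretation to_words: Vector_Spaces.linear fun_scale fun_scale "to_words n" for n
  by (rule linear_to_words)

lemma to_words_supported: "to_words n ` supported {x. x permutes {1..n}} = (supported (permutations_of_set {1..n}) :: (nat list \<Rightarrow> 'f :: field) set)"
proof
  show "to_words n ` supported {x. x permutes {1..n}} \<subseteq> (supported (permutations_of_set {1..n}) :: (nat list \<Rightarrow> 'f) set)"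
    by (auto simp: to_words_def supported_def)
  show "(supported (permutations_of_set {1..n}) :: (nat list \<Rightarrow> 'f) set) \<subseteq> to_words n ` supported {x. x permutes {1..n}}"
  proof
    fix f :: "nat list \<Rightarrow> 'f" assume f: "f \<in> supported (permutations_of_set {1..n})"
    define g where "g x = (if x permutes {1..n} then f (perm_word n x) else 0)" for x
    have "to_words n g = f"
      using f word_perm_permutes perm_word_word_perm by (auto simp: to_words_def g_def supported_def fun_eq_iff)
    moreover have "g \<in> supported {x. x permutes {1..n}}" by (simp add: g_def supported_def)
    ultimately show "f \<in> to_words n ` supported {x. x permutes {1..n}}" by blast
  qed
qed

lemma to_words_inj:
  assumes "f \<in> supported {x. x permutes {1..n}}" "to_words n f = 0"
  shows "f = 0"
proof
  fix x show "f x = 0 x"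
  proof (cases "x permutes {1..n}")
    case True
    then show ?thesis
      using fun_cong[OF assms(2), of "perm_word n x"] perm_word_in word_perm_perm_word by (simp add: to_words_def)
  next
    case False
    then show ?thesis using assms(1) by (simp add: supported_def)
  qed
qed

lemma dim_to_words:
  fixes S :: "((nat \<Rightarrow> nat) \<Rightarrow> 'f :: field) set"
  assumes S: "fun_space.subspace S" "S \<subseteq> supported {x. x permutes {1..n}}"
  shows "fun_dim (to_words n ` S) = fun_dim S"
proof -
  let ?P = "{x. x permutes {1..n}}"
  have fin: "finite ?P" by (rule finite_permutations) simp
  have "{f \<in> S. to_words n f = 0} \<subseteq> fun_space.span {}" using to_words_inj S(2) by auto
  then have "fun_dim {f \<in> S. to_words n f = 0} \<le> card ({} :: ((nat \<Rightarrow> nat) \<Rightarrow> 'f) set)"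
    by (rule fun_space.dim_le_card) simp
  moreover have "fun_dim S = fun_dim (to_words n ` S) + fun_dim {f \<in> S. to_words n f = 0}"
  proof (rule vector_space_pair.rank_nullity[OF _ linear_to_words S(1)])
    show "vector_space_pair (fun_scale :: 'f \<Rightarrow> _) fun_scale" by unfold_locales
    show "finite (group_elem ` ?P)" using fin by simp
    show "S \<subseteq> fun_space.span (group_elem ` ?P)" unfolding span_group_elem[OF fin] by (rule S(2))
  qed
  ultimately show ?thesis by simp
qed

section \<open>The projective-free part of the Lie module\<close>

theorem corollary3p6:
  fixes p k :: nat and P :: "(nat \<Rightarrow> nat) set"
  defines "G \<equiv> sym_group_r (k * p)"
  defines "FP \<equiv> (group_algebra (G\<lparr>carrier := P\<rparr>) :: ((nat \<Rightarrow> nat) \<Rightarrow> 'f :: field) ring)"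
  defines "L \<equiv> (lie_module (k * p) :: ((nat \<Rightarrow> nat) \<Rightarrow> 'f, (nat \<Rightarrow> nat) \<Rightarrow> 'f) module)"
  defines "N \<equiv> card {D_subgroup p k #>\<^bsub>G\<^esub> x | x. x \<in> carrier G \<and>
                      conj_set G (diag_subgroup p k) x \<inter> P \<noteq> {\<one>\<^bsub>G\<^esub>}}"
  assumes "Factorial_Ring.prime p" and "CHAR('f) = p"
    and "k \<ge> 1" and "\<not> p dvd k"
    and "sylow_subgroup p G P"
  shows "(\<exists>U V. pr_pf_decomposition FP L U V) \<and>
         (\<forall>U V. pr_pf_decomposition FP L U V \<longrightarrow>
            fun_dim V = (p - 1) * fact (k - 1) * N)"
proof -
  define n where "n = k * p"
  let ?H = "G\<lparr>carrier := P\<rparr>"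
  have p2: "2 \<le> p" using prime_ge_2_nat[OF assms(5)] .
  have "1 * 1 \<le> k * p" using assms(7) p2 by (intro mult_mono) auto
  then have n1: "1 \<le> n" by (simp add: n_def)
  have P: "subgroup P G" using assms(9) by (simp add: sylow_subgroup_def)
  obtain m where m: "card P = p ^ m" using assms(9) by (auto simp: sylow_subgroup_def)
  have grp: "Group.group ?H"
    using group.subgroup_imp_group[OF group_sym_group_r P[unfolded G_def]] by (simp add: G_def)
  have order: "Coset.order ?H = p ^ m" using m by (simp add: order_def)
  have perm: "h permutes {1..n}" if "h \<in> carrier ?H" for h
    using subgroup.mem_carrier[OF P] that by (simp add: G_def carrier_sym n_def)
  have mult: "g \<otimes>\<^bsub>?H\<^esub> h = h \<circ> g" and one: "\<one>\<^bsub>?H\<^esub> = id" for g h by (simp_all add: G_def sym_mult sym_one)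
  obtain Y where Y: "Y \<subseteq> {1..n}" "card Y = p" "\<And>h. h \<in> carrier ?H \<Longrightarrow> h ` Y = Y"
    by (rule ex_invariant_subset[OF grp _ _ assms(5,7,8) order perm mult one]) (simp_all add: n_def)
  have letters: "p_letter_group ?H {1..n} Y p m"
    by (intro p_letter_group.intro p_letter_group_axioms.intro grp)
      (use Y order perm mult one assms(5) in auto)
  interpret letters: p_letter_group ?H "{1..n}" Y p m by (rule letters)
  obtain d where d: "\<And>B. B \<subseteq> Y \<Longrightarrow> B \<noteq> {} \<Longrightarrow> d B \<in> B"
    "\<And>h B. h \<in> carrier ?H \<Longrightarrow> B \<subset> Y \<Longrightarrow> B \<noteq> {} \<Longrightarrow> d (h ` B) = h (d B)"
    using letters.ex_equivariant_choice by blast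
  have finY: "finite Y" using finite_subset[OF Y(1)] by simp
  \<comment> \<open>Two letters of \<open>Y\<close> that normalize the intertwiners.\<close>
  obtain y0 where y0: "y0 \<in> Y" using Y(2) p2 by (metis all_not_in_conv card.empty not_numeral_le_zero)
  have "\<not> Y \<subseteq> {y0}" using Y(2) p2 card_mono[of "{y0}" Y] by auto
  then obtain y1 where y1: "y1 \<in> Y" "y0 \<noteq> y1" by blast
  have "letter_substitution {1..n} Y d ?H"
  proof (intro letter_substitution.intro letter_substitution_axioms.intro marked_alphabet.intro)
    show "finite {1..n}" "Y \<subseteq> {1..n}" "Y \<noteq> {}" using Y y0 by auto
  qed (use d Y perm mult one grp in auto)
  then have "p_letter_substitution ?H {1..k * p} Y p m d"
    using letters unfolding n_def by (intro p_letter_substitution.intro)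
  then interpret W: block_letters ?H k Y p m d y0 y1
    by (intro block_letters.intro block_letters_axioms.intro) (use assms(7) y0 y1 in auto)
  let ?perms = "{x. x permutes {1..n}}"
  have fin_perms: "finite ?perms" by (rule finite_permutations) simp
  have L: "carrier L = (\<lambda>a. lie_omega n \<otimes>\<^bsub>sym_algebra n\<^esub> a) ` supported ?perms"
    unfolding L_def lie_module_def Let_def carrier_sym_algebra[symmetric] by (auto simp: n_def)
  have L_sup: "carrier L \<subseteq> supported ?perms"
    unfolding L using mult_closed[of n] by (auto simp: carrier_sym_algebra)
  interpret rep: modular_representation fun_scale ?H "perm_act :: ((nat \<Rightarrow> nat) \<Rightarrow> 'f) \<Rightarrow> _" p m
  proof unfold_locales
    show "finite (carrier ?H)" by (rule letters.fin_carrier)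
    show "perm_act (u + v) g = perm_act u g + perm_act v g" "perm_act (fun_scale c v) g = fun_scale c (perm_act v g)"
      for u v :: "(nat \<Rightarrow> nat) \<Rightarrow> 'f" and c g by (auto simp: perm_act_def fun_scale_def)
    show "perm_act v \<one>\<^bsub>?H\<^esub> = v" for v :: "(nat \<Rightarrow> nat) \<Rightarrow> 'f" by (simp add: perm_act_def one)
    show "perm_act (perm_act v g) h = perm_act v (g \<otimes>\<^bsub>?H\<^esub> h)" if "g \<in> carrier ?H" "h \<in> carrier ?H" for v :: "(nat \<Rightarrow> nat) \<Rightarrow> 'f" and g h
      using permutes_bij[OF perm[OF that(1)]] permutes_bij[OF perm[OF that(2)]]
      unfolding perm_act_def mult by (simp add: o_inv_distrib comp_assoc)
  qed (use assms(5,6) order in auto)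
  interpret lin: Vector_Spaces.linear fun_scale fun_scale "\<lambda>a. lie_omega n \<otimes>\<^bsub>sym_algebra n\<^esub> (a :: (nat \<Rightarrow> nat) \<Rightarrow> 'f)"
    by (rule linear_left_mult)
  interpret M: group_algebra_module fun_scale ?H "perm_act :: ((nat \<Rightarrow> nat) \<Rightarrow> 'f) \<Rightarrow> _" p m L "group_elem ` ?perms"
  proof unfold_locales
    show "ring.add L = (+)" by (simp add: L_def lie_module_def Let_def group_algebra_def fun_eq_iff)
    show "\<zero>\<^bsub>L\<^esub> = 0" by (simp add: L_def lie_module_def Let_def group_algebra_def fun_eq_iff)
    show "finite (group_elem ` ?perms)" using fin_perms by simp
    show "carrier L \<subseteq> fun_space.span (group_elem ` ?perms)" unfolding span_group_elem[OF fin_perms] by (rule L_sup)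
    show "rep.invariant (carrier L)"
      unfolding rep.invariant_def
    proof (intro conjI ballI)
      show "fun_space.subspace (carrier L)" unfolding L by (rule lin.subspace_image[OF subspace_supported])
      show "perm_act v g \<in> carrier L" if "v \<in> carrier L" "g \<in> carrier ?H" for v g
        using that perm_act_mult[OF perm[OF that(2)]] perm_act_supported[OF _ perm[OF that(2)]] unfolding L by auto
    qed
    fix a :: "(nat \<Rightarrow> nat) \<Rightarrow> 'f" and v assume a: "a \<in> carrier (group_algebra ?H)" and v: "v \<in> carrier L"
    have v_out: "v g = 0" if "\<not> g permutes {1..n}" for g using that v L_sup by (auto simp: supported_def)
    show "a \<odot>\<^bsub>L\<^esub> v = (\<Sum>h\<in>carrier ?H. fun_scale (a h) (perm_act v h))"
    proof
      fix g
      have "(a \<odot>\<^bsub>L\<^esub> v) g = (v \<otimes>\<^bsub>sym_algebra n\<^esub> a) g" by (simp add: L_def lie_module_def Let_def n_def)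
      also have "\<dots> = (\<Sum>h\<in>carrier ?H. a h * v (inv_into UNIV h \<circ> g))"
      proof (cases "g permutes {1..n}")
        case True
        have "(\<Sum>y\<in>?perms. v (inv_into UNIV y \<circ> g) * a y) = (\<Sum>h\<in>carrier ?H. v (inv_into UNIV h \<circ> g) * a h)"
          by (rule sum.mono_neutral_right[OF fin_perms]) (use perm a in \<open>auto simp: group_algebra_def\<close>)
        then show ?thesis using True by (simp add: left_mult_apply mult.commute)
      next
        case False
        have "v (inv_into UNIV h \<circ> g) = 0" if h: "h \<in> carrier ?H" for h
          using perm_act_def[of v h] perm_act_supported[OF _ perm[OF h], of v] v L_sup False by (auto simp: supported_def fun_eq_iff)
        then show ?thesis using False by (simp add: left_mult_apply)
      qed
      finally show "(a \<odot>\<^bsub>L\<^esub> v) g = (\<Sum>h\<in>carrier ?H. fun_scale (a h) (perm_act v h)) g"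
        by (simp add: sum_fun_apply fun_scale_def perm_act_def)
    qed
  qed
  \<comment> \<open>From here on the rank of the norm is computed on words.\<close>
  let ?E = "supported (permutations_of_set {1..n}) :: (nat list \<Rightarrow> 'f) set"
  have words_L: "to_words n ` carrier L = lie_map {1..n} ` ?E"
  proof -
    have "to_words n ` carrier L = (\<lambda>a. lie_map {1..n} (to_words n a)) ` supported ?perms"
      unfolding L image_image using to_words_lie_omega[OF n1] by (intro image_cong) (auto simp: carrier_sym_algebra)
    also have "\<dots> = lie_map {1..n} ` ?E" unfolding to_words_supported[symmetric] by (simp add: image_image)
    finally show ?thesis .
  qed
  have norm_words: "to_words n (rep.norm f) = W.words.norm (to_words n f)" for f
    unfolding rep.norm_def W.words.norm_def to_words.sum by (intro sum.cong refl to_words_act perm)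
  have "to_words n ` rep.norm ` carrier L = W.words.norm ` lie_map {1..n} ` ?E"
    unfolding words_L[symmetric] by (simp add: image_image norm_words)
  moreover have "fun_dim (to_words n ` rep.norm ` carrier L) = fun_dim (rep.norm ` carrier L)"
  proof (rule dim_to_words)
    interpret norm: Vector_Spaces.linear fun_scale fun_scale rep.norm by (rule rep.linear_norm)
    show "fun_space.subspace (rep.norm ` carrier L)"
      using norm.subspace_image M.invariant_M unfolding rep.invariant_def by blast
    show "rep.norm ` carrier L \<subseteq> supported ?perms"
      using rep.norm_in_invariant[OF M.invariant_M] L_sup by blast
  qed
  ultimately have dim_norm: "fun_dim (W.words.norm ` lie_map {1..n} ` ?E) = fun_dim (rep.norm ` carrier L)" by simp
  have "fun_dim (to_words n ` carrier L) = fun_dim (carrier L)"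
    by (rule dim_to_words[OF _ L_sup]) (use M.invariant_M in \<open>simp add: rep.invariant_def\<close>)
  then have dim_L: "fun_dim (carrier L) = fact (n - 1)"
    using W.dim_lie_map_image[where ?'f = 'f] unfolding words_L by (simp add: n_def)
  have "Coset.order ?H * fun_dim (rep.norm ` carrier L) + (p - 1) * card W.symmetric_cuts = fact (n - 1)"
    using W.rank_norm_lie_p[where ?'f = 'f] dim_norm by (simp add: n_def)
  moreover have "card W.symmetric_cuts = fact (k - 1) * N"
    unfolding W.card_symmetric_cuts W.card_intertwiners N_def W.good_cosets_def by (simp add: G_def)
  ultimately have rank: "Coset.order ?H * fun_dim (rep.norm ` carrier L) + (p - 1) * fact (k - 1) * N = fun_dim (carrier L)"
    using dim_L by (simp add: mult.assoc)
  have "fun_dim V = (p - 1) * fact (k - 1) * N" if "pr_pf_decomposition FP L U V" for U V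
    using M.pr_pf_decomposition_dim(2)[of U V] that rank unfolding FP_def by linarith
  then show ?thesis using M.pr_pf_decomposition_dim(1) unfolding FP_def by blast
qed

end
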